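(* There exists an absolute constant $\beta_\infty$ (it can be checked numerically that $\beta_\infty=0.295\ldots$) with the following property. Let $u_0\in H^s(\mathbb{S})$ with $s>3/2$. (a) If there is $x_0\in\mathbb{S}$ with $u_0'(x_0)>\beta_\infty|u_0(x_0)|$, then for $\gamma\ll-1$ the (unique, $\gamma$-dependent) solution of the periodic rod equation with parameter $\gamma$ arising from $u_0$ blows up in finite time, and its maximal existence time satisfies $T^*=O(1/|\gamma|)$ as $\gamma\to-\infty$. (b) If there is $x_0\in\mathbb{S}$ with $u_0'(x_0)<-\beta_\infty|u_0(x_0)|$, then for $\gamma\gg1$ the (unique, $\gamma$-dependent) solution of the periodic rod equation with parameter $\gamma$ arising from $u_0$ blows up in finite time, and its maximal existence time satisfies $T^*=O(1/|\gamma|)$ as $\gamma\to+\infty$.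
   Context: $\mathbb{S}=\mathbb{R}/\mathbb{Z}$. The periodic rod equation with parameter $\gamma\in\mathbb{R}$ is $$u_t+\gamma uu_x=-\partial_x p*\Bigl(\tfrac{3-\gamma}{2}u^2+\tfrac{\gamma}{2}u_x^2\Bigr),\quad t\in(0,T),\ x\in\mathbb{S},\qquad u(0,x)=u_0(x),$$ where $*$ is convolution on $\mathbb{S}$ and $p(x)=\frac{\cosh(x-[x]-1/2)}{2\sinh(1/2)}$ is the (1-periodic) kernel of $(1-\partial_x^2)^{-1}$, with $[\cdot]$ the integer part. For $u_0\in H^s(\mathbb{S})$, $s>3/2$, there are a maximal time $0<T^*\le\infty$ (depending on $\gamma$ and $u_0$) and a unique solution $u\in C([0,T^* ),H^s(\mathbb{S}))\cap C^1([0,T^* ),H^{s-1}(\mathbb{S}))$ (known local well-posedness). "Blows up in finite time" means $T^*<\infty$. Here $\gamma\ll-1$ (respectively $\gamma\gg1$) means $\gamma<0$ (respectively $\gamma>0$) with $|\gamma|$ sufficiently large; how large, and the constant in $O(\cdot)$, may depend on $u_0$. The constant $\beta_\infty$ is $\lim_{\gamma\to\pm\infty}\beta_\gamma$, where for $\gamma\neq0$, with $\alpha=\frac{3-\gamma}{\gamma}$, $\beta_\gamma=\inf\{\beta\ge0:\ \beta^2+I(\alpha,\beta)-\alpha\ge0\}$ and $I(\alpha,\beta)=\inf\bigl\{\int_0^1(p+\beta p_x)(\alpha u^2+u_x^2)\,dx:\ u\in H^1(0,1),\ u(0)=u(1)=1\bigr\}$.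
   Formalization: The numerical remark "β_∞ = 0.295…" is replaced by |β_∞ − 0.295| < 0.001, because with the given definition of β_∞ its value is about 0.2941, so the literal digits 0.295… are false. *)

theory Defs
  imports "HOL-Analysis.Analysis" "HOL-Library.Landau_Symbols"
begin

section \<open>Sobolev spaces on the circle\<close>

text \<open>
  Functions on the circle \<open>\<real>/\<int>\<close> are 1-periodic functions on \<open>\<real>\<close>.
\<close>

definition fourier_coeff :: "(real \<Rightarrow> real) \<Rightarrow> int \<Rightarrow> complex" where
  "fourier_coeff f n = (LBINT x:{0..1}. of_real (f x) * cis (- 2 * pi * real_of_int n * x))"

definition sobolev_weight :: "real \<Rightarrow> int \<Rightarrow> real" where
  "sobolev_weight s n = (1 + (2 * pi * real_of_int n)\<^sup>2) powr s"

text \<open>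
  The space \<open>H\<^sup>s\<close> of the circle. It is used only for \<open>s > 1/2\<close>, where every class contains
  exactly one continuous function; the elements are these continuous representatives, so that
  pointwise values (and, for \<open>s > 3/2\<close>, classical first derivatives) make sense.
\<close>

definition sobolev_circle :: "real \<Rightarrow> (real \<Rightarrow> real) set" where
  "sobolev_circle s = {f. continuous_on UNIV f \<and> (\<forall>x. f (x + 1) = f x) \<and>
     (\<lambda>n. sobolev_weight s n * (cmod (fourier_coeff f n))\<^sup>2) summable_on UNIV}"

definition sobolev_norm :: "real \<Rightarrow> (real \<Rightarrow> real) \<Rightarrow> real" where
  "sobolev_norm s f = sqrt (\<Sum>\<^sub>\<infinity>n. sobolev_weight s n * (cmod (fourier_coeff f n))\<^sup>2)"

definition sobolev_continuous_on :: "real \<Rightarrow> real set \<Rightarrow> (real \<Rightarrow> real \<Rightarrow> real) \<Rightarrow> bool" where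
  "sobolev_continuous_on s J u \<longleftrightarrow>
     (\<forall>t\<in>J. u t \<in> sobolev_circle s \<and>
        ((\<lambda>\<tau>. sobolev_norm s (\<lambda>x. u \<tau> x - u t x)) \<longlongrightarrow> 0) (at t within J))"

definition sobolev_has_derivative_on ::
  "real \<Rightarrow> real set \<Rightarrow> (real \<Rightarrow> real \<Rightarrow> real) \<Rightarrow> (real \<Rightarrow> real \<Rightarrow> real) \<Rightarrow> bool" where
  "sobolev_has_derivative_on s J u v \<longleftrightarrow>
     (\<forall>t\<in>J. ((\<lambda>\<tau>. sobolev_norm s (\<lambda>x. (u \<tau> x - u t x) / (\<tau> - t) - v t x)) \<longlongrightarrow> 0)
        (at t within J))"


section \<open>The periodic rod equation\<close>

definition rod_kernel :: "real \<Rightarrow> real" where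
  "rod_kernel x = cosh (x - of_int \<lfloor>x\<rfloor> - 1/2) / (2 * sinh (1/2))"

text \<open>
  The kernel is not differentiable at the integers; the value of \<^term>\<open>deriv rod_kernel\<close> there
  is irrelevant, because the derivative only occurs under integrals.
\<close>

definition circle_convolution :: "(real \<Rightarrow> real) \<Rightarrow> (real \<Rightarrow> real) \<Rightarrow> real \<Rightarrow> real" where
  "circle_convolution f g x = (LBINT y:{0..1}. f (x - y) * g y)"

definition rod_solution ::
  "real \<Rightarrow> real \<Rightarrow> (real \<Rightarrow> real) \<Rightarrow> ereal \<Rightarrow> (real \<Rightarrow> real \<Rightarrow> real) \<Rightarrow> bool" where
  "rod_solution s \<gamma> u0 T u \<longleftrightarrow>
     (let J = {t. 0 \<le> t \<and> ereal t < T} in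
        u 0 = u0 \<and>
        sobolev_continuous_on s J u \<and>
        (\<exists>ut. sobolev_continuous_on (s - 1) J ut \<and>
           sobolev_has_derivative_on (s - 1) J u ut \<and>
           (\<forall>t x. 0 < t \<and> ereal t < T \<longrightarrow>
              ut t x + \<gamma> * u t x * deriv (u t) x =
              - circle_convolution (deriv rod_kernel)
                  (\<lambda>y. (3 - \<gamma>) / 2 * (u t y)\<^sup>2 + \<gamma> / 2 * (deriv (u t) y)\<^sup>2) x)))"

text \<open>
  The maximal existence time of the \<open>H\<^sup>s\<close> solution arising from \<open>u0\<close>. By local well-posedness, for
  \<open>s > 3/2\<close> and \<open>u0\<close> in \<open>H\<^sup>s\<close> it is positive and attained by a unique solution.
\<close>

definition rod_maximal_time :: "real \<Rightarrow> real \<Rightarrow> (real \<Rightarrow> real) \<Rightarrow> ereal" where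
  "rod_maximal_time s \<gamma> u0 = Sup {T. 0 < T \<and> (\<exists>u. rod_solution s \<gamma> u0 T u)}"


section \<open>The variational constants\<close>

text \<open>
  \<open>u\<close> is (the absolutely continuous representative on \<open>[0,1]\<close> of) an element of \<open>H\<^sup>1(0,1)\<close>
  and \<open>g\<close> is its derivative in \<open>L\<^sup>2(0,1)\<close>.
\<close>

definition H1_with_derivative :: "(real \<Rightarrow> real) \<Rightarrow> (real \<Rightarrow> real) \<Rightarrow> bool" where
  "H1_with_derivative u g \<longleftrightarrow>
     g \<in> borel_measurable borel \<and>
     set_integrable lborel {0..1} (\<lambda>x. (g x)\<^sup>2) \<and>
     (\<forall>x\<in>{0..1}. u x = u 0 + (LBINT y:{0..x}. g y))"

text \<open>
  The infima are taken in the extended reals: the functional is unbounded below for some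
  parameters, and the set of admissible \<open>\<beta>\<close> may be empty.
\<close>

definition rod_I :: "real \<Rightarrow> real \<Rightarrow> ereal" where
  "rod_I \<alpha> \<beta> = Inf {ereal (LBINT x:{0..1}.
       (rod_kernel x + \<beta> * deriv rod_kernel x) * (\<alpha> * (u x)\<^sup>2 + (g x)\<^sup>2)) | u g.
     H1_with_derivative u g \<and> u 0 = 1 \<and> u 1 = 1}"

definition rod_beta :: "real \<Rightarrow> ereal" where
  "rod_beta \<gamma> = (let \<alpha> = (3 - \<gamma>) / \<gamma> in
     Inf {ereal \<beta> | \<beta>. 0 \<le> \<beta> \<and> ereal (\<beta>\<^sup>2) + rod_I \<alpha> \<beta> - ereal \<alpha> \<ge> 0})"

end

theory Submission
  imports Defs "HOL-Computational_Algebra.Polynomial"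
begin

text \<open>
  Along a characteristic \<open>q' = \<gamma> u(t, q)\<close> put \<open>U = u(t, q)\<close>, \<open>X = - sgn(\<gamma>) u\<^sub>x(t, q)\<close> and
  \<open>\<alpha> = (3 - \<gamma>)/\<gamma>\<close>. The equation together with the definition of \<open>I(\<alpha>, b)\<close> gives
  \<open>(X \<plusminus> b U)' \<ge> \<bar>\<gamma>\<bar>/2 (X\<^sup>2 + (I(\<alpha>, b) - \<alpha>) U\<^sup>2)\<close>. If \<open>b\<^sup>2 + I(\<alpha>, b) - \<alpha> \<ge> 0\<close>, the factors
  \<open>A = X - b U\<close> and \<open>B = X + b U\<close> satisfy \<open>A', B' \<ge> \<bar>\<gamma>\<bar>/2 A B\<close>, so two positive initial values
  force blow-up before the time \<open>(1/A(0) + 1/B(0))/\<bar>\<gamma>\<bar>\<close>.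

  As \<open>\<gamma> \<rightarrow> \<plusminus>\<infinity>\<close>, \<open>\<alpha> \<rightarrow> -1\<close>. The function \<open>I\<close> is concave in each variable, even in \<open>b\<close> and
  monotone in \<open>\<alpha>\<close>, and \<open>b\<^sup>2 + I(-1, b) + 1\<close> crosses zero transversally near \<open>b = 0.294\<close>; both facts
  give the limit of \<open>\<beta>\<^sub>\<gamma>\<close>. Numerically, \<open>I\<close> is bounded above by a quartic test function and below
  by a Riccati certificate that is rational in \<open>tanh\<close>.
\<close>

section \<open>The variational problem\<close>

text \<open>One number \<open>b\<close>, slightly above the limit constant, has to be admissible for
  all large |gamma| at once, because the constant in O(1/|gamma|) is built from it. As gamma ->
  -infinity, alpha approaches -1 from below, where I is no larger than at -1; mere admissibility at
  alpha = -1 does not carry over, and strict slack there is required. Concavity turns a single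
  certified bound at (-1.0001, 3/10) into this slack, so rough numerical data decide the existence
  of the limit. The resulting enclosure 0.29401 <= B <= 0.2959 also locates the constant within
  0.001 of 0.295.

  Two regularity gaps shape the analysis. The Sobolev spaces are given by Fourier coefficients, so
  pointwise values and slopes have to come from an inversion theorem for absolutely convergent
  series. And u has no second space derivative, so the chain rule cannot produce the equation for
  u_x along a characteristic. Since T* is a supremum, it suffices to bound the length of a compact
  time interval inside the lifespan of an arbitrary solution.\<close>

definition kernel_weight :: "real \<Rightarrow> real \<Rightarrow> real" where
  "kernel_weight b z = (cosh (z - 1/2) + b * sinh (z - 1/2)) / (2 * sinh (1/2))"

lemma rod_kernel_eq: "0 \<le> z \<Longrightarrow> z < 1 \<Longrightarrow> rod_kernel z = kernel_weight 0 z"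
  by (simp add: rod_kernel_def kernel_weight_def floor_unique[of 0 z, simplified])

lemma kernel_weight_has_field_derivative [derivative_intros]:
  assumes "(f has_field_derivative f') (at x within S)"
  shows "((\<lambda>x. kernel_weight b (f x)) has_field_derivative
     (sinh (f x - 1/2) + b * cosh (f x - 1/2)) / (2 * sinh (1/2)) * f') (at x within S)"
  unfolding kernel_weight_def
  by (rule derivative_eq_intros assms refl | simp add: field_simps)+

lemma continuous_on_kernel_weight [continuous_intros]:
  "continuous_on S f \<Longrightarrow> continuous_on S (\<lambda>x. kernel_weight b (f x))"
  unfolding kernel_weight_def by (intro continuous_intros) auto

lemma deriv_rod_kernel:
  assumes "0 < z" "z < 1"
  shows "deriv rod_kernel z = sinh (z - 1/2) / (2 * sinh (1/2))"
proof -
  have "(kernel_weight 0 has_field_derivative sinh (z - 1/2) / (2 * sinh (1/2))) (at z)"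
    using kernel_weight_has_field_derivative[of "\<lambda>x. x" 1 z UNIV 0] by simp
  then have "(rod_kernel has_field_derivative sinh (z - 1/2) / (2 * sinh (1/2))) (at z)"
    by (rule has_field_derivative_transform_within_open[of _ _ _ "{0<..<1}"])
      (use assms in \<open>auto simp: rod_kernel_eq\<close>)
  then show ?thesis by (rule DERIV_imp_deriv)
qed

text \<open>The corner of the kernel sits at the integers, so under an integral over [0, 1] the
  smooth \<open>kernel_weight\<close> can stand in for p + b p'.\<close>

lemma rod_kernel_weight:
  assumes "0 < z" "z < 1"
  shows "rod_kernel z + b * deriv rod_kernel z = kernel_weight b z"
  using assms by (simp add: deriv_rod_kernel rod_kernel_eq) (simp add: kernel_weight_def add_divide_distrib)

lemma kernel_weight_pos:
  assumes "\<bar>b\<bar> \<le> 1" shows "kernel_weight b z > 0"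
proof -
  have c: "cosh y > \<bar>sinh y\<bar>" for y :: real
    using cosh_plus_sinh[of y] cosh_minus_sinh[of y] exp_gt_zero[of y] exp_gt_zero[of "-y"] by linarith
  have "\<bar>b * sinh (z - 1/2)\<bar> \<le> \<bar>sinh (z - 1/2)\<bar>"
    using assms by (simp add: abs_mult mult_left_le_one_le)
  with c[of "z - 1/2"] have "cosh (z - 1/2) + b * sinh (z - 1/2) > 0" by linarith
  then show ?thesis by (simp add: kernel_weight_def)
qed

lemma kernel_weight_reflect: "kernel_weight b (1 - z) = kernel_weight (- b) z"
proof -
  have "1 - z - 1/2 = - (z - 1/2)" by simp
  then show ?thesis unfolding kernel_weight_def by (simp only: cosh_minus sinh_minus) simp
qed

section \<open>Functions in H^1(0,1) and integration by parts\<close>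

lemma H1_with_derivativeD:
  assumes "H1_with_derivative u g"
  shows "g absolutely_integrable_on {0..1}"
    and "(\<lambda>x. (g x)\<^sup>2) absolutely_integrable_on {0..1}"
    and "\<And>x. x \<in> {0..1} \<Longrightarrow> u x = u 0 + integral {0..x} g"
    and "continuous_on {0..1} u"
    and "set_integrable lborel {0..1} g"
proof -
  have m: "g \<in> borel_measurable borel" and q: "set_integrable lborel {0..1} (\<lambda>x. (g x)\<^sup>2)"
    and e: "\<And>x. x \<in> {0..1} \<Longrightarrow> u x = u 0 + (LBINT y:{0..x}. g y)"
    using assms unfolding H1_with_derivative_def by blast+
  show i: "set_integrable lborel {0..1} g"
  \<comment> \<open>On a bounded interval 1 + g^2 is integrable, and it dominates |g|.\<close>
  proof (rule set_integrable_bound[where f="\<lambda>x. 1 + (g x)\<^sup>2"])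
    show "set_integrable lborel {0..1} (\<lambda>x. 1 + (g x)\<^sup>2)"
      by (intro set_integral_add q) (auto intro!: borel_integrable_atLeastAtMost' continuous_intros)
    show "set_borel_measurable lborel {0..1} g"
      using m unfolding set_borel_measurable_def by measurable
    have "norm y \<le> norm (1 + y\<^sup>2)" for y :: real
    proof -
      have "0 \<le> (\<bar>y\<bar> - 1/2)\<^sup>2" by simp
      then have "\<bar>y\<bar> \<le> 1 + y\<^sup>2" by (simp add: power2_diff) (simp add: power2_eq_square)
      then show ?thesis by simp
    qed
    then show "AE x in lborel. x \<in> {0..1} \<longrightarrow> norm (g x) \<le> norm (1 + (g x)\<^sup>2)" by auto
  qed
  show a: "g absolutely_integrable_on {0..1}"
    using i by (simp add: set_integrable_def integrable_completion)
  show "(\<lambda>x. (g x)\<^sup>2) absolutely_integrable_on {0..1}"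
    using q by (simp add: set_integrable_def integrable_completion)
  show e': "u x = u 0 + integral {0..x} g" if "x \<in> {0..1}" for x
  proof -
    have "set_integrable lborel {0..x} g"
      using that by (intro set_integrable_subset[OF i]) auto
    with e[OF that] show ?thesis by (simp add: set_borel_integral_eq_integral)
  qed
  have "g integrable_on {0..1}" using a by (rule set_lebesgue_integral_eq_integral(1))
  then have c: "continuous_on {0..1} (\<lambda>x. u 0 + integral {0..x} g)"
    by (intro continuous_intros indefinite_integral_continuous_1)
  show "continuous_on {0..1} u"
    by (rule continuous_on_eq[OF c]) (rule e'[symmetric])
qed

text \<open>Telescoping over an equidistant partition of mesh below d gives |H c - H 0| <= e (m c -
  m 0) for every e > 0. This takes the place of the theorem that an absolutely continuous function
  with derivative zero almost everywhere is constant; m controls the variation.\<close>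

lemma constant_if_small_increments:
  fixes H m :: "real \<Rightarrow> real"
  assumes "0 \<le> c" and "\<And>e. e > 0 \<Longrightarrow> \<exists>d>0. \<forall>x y. 0 \<le> x \<and> x \<le> y \<and> y \<le> c \<and> y - x < d \<longrightarrow>
     \<bar>H y - H x\<bar> \<le> e * (m y - m x)"
  shows "H c = H 0"
proof -
  have "\<bar>H c - H 0\<bar> \<le> e * (m c - m 0)" if e: "e > 0" for e
  proof -
    obtain d where d: "d > 0" "\<And>x y. 0 \<le> x \<Longrightarrow> x \<le> y \<Longrightarrow> y \<le> c \<Longrightarrow> y - x < d \<Longrightarrow>
       \<bar>H y - H x\<bar> \<le> e * (m y - m x)"
      using assms(2)[OF e] by blast
    obtain n :: nat where n: "n > 0" "c / real n < d"
    proof -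
      obtain n :: nat where "c / d < real n" using reals_Archimedean2 by blast
      moreover have "0 \<le> c / d" using d(1) \<open>0 \<le> c\<close> by simp
      ultimately have "0 < real n" "c / d < real n" by linarith+
      then show ?thesis using d(1)
        by (intro that[of n]) (auto simp: pos_divide_less_eq mult.commute)
    qed
    have "\<bar>H (c * real k / n) - H 0\<bar> \<le> e * (m (c * real k / n) - m 0)" if "k \<le> n" for k
      using that
    proof (induction k)
      case (Suc k)
      have "c * real (Suc k) / n - c * real k / n = c / n"
        by (simp add: diff_divide_distrib[symmetric] algebra_simps)
      moreover have "c * real (Suc k) \<le> c * n"
        using Suc.prems \<open>0 \<le> c\<close> by (intro mult_left_mono) auto
      then have "c * real (Suc k) / n \<le> c" using n by (simp add: field_simps)
      moreover have "c / n \<ge> 0" using \<open>0 \<le> c\<close> by simp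
      ultimately have "\<bar>H (c * real (Suc k) / n) - H (c * real k / n)\<bar> \<le> e * (m (c * real (Suc k) / n) - m (c * real k / n))"
        using n \<open>0 \<le> c\<close> by (intro d(2)) (simp, linarith+)
      moreover have "\<bar>H (c * real k / n) - H 0\<bar> \<le> e * (m (c * real k / n) - m 0)"
        using Suc by simp
      ultimately show ?case by (simp add: right_diff_distrib)
    qed simp
    from this[of n] n show ?thesis by simp
  qed
  note le = this
  have "\<bar>H c - H 0\<bar> \<le> 0"
  proof (rule field_le_epsilon)
    fix e :: real assume "e > 0"
    define M where "M = \<bar>m c - m 0\<bar> + 1"
    have M: "M > 0" by (simp add: M_def add_nonneg_pos)
    have "\<bar>H c - H 0\<bar> \<le> e / M * (m c - m 0)" using le[of "e / M"] \<open>e > 0\<close> M by simp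
    also have "\<dots> \<le> e / M * M" using \<open>e > 0\<close> M by (intro mult_left_mono) (auto simp: M_def)
    finally show "\<bar>H c - H 0\<bar> \<le> 0 + e" using M by simp
  qed
  then show ?thesis by simp
qed

lemma absolutely_integrable_continuous_mult:
  fixes f h :: "real \<Rightarrow> real"
  assumes "f absolutely_integrable_on {a..b}" "continuous_on {a..b} h"
  shows "(\<lambda>x. h x * f x) absolutely_integrable_on {a..b}"
proof (rule absolutely_integrable_bounded_measurable_product_real)
  show "h \<in> borel_measurable (lebesgue_on {a..b})"
    using assms(2) by (intro continuous_imp_measurable_on_sets_lebesgue) auto
  show "bounded (h ` {a..b})"
    using assms(2) by (intro compact_imp_bounded compact_continuous_image) auto
qed (use assms in auto)

text \<open>Integration by parts for absolutely continuous functions. The difference H of the two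
  sides has small increments relative to m = integral of |f| + |g|, because F and G are uniformly
  continuous; so H is constant.\<close>

lemma integral_product_rule:
  fixes F G f g :: "real \<Rightarrow> real"
  assumes c: "0 \<le> c" and f: "f absolutely_integrable_on {0..c}" and g: "g absolutely_integrable_on {0..c}"
    and F: "\<And>x. x \<in> {0..c} \<Longrightarrow> F x = F 0 + integral {0..x} f"
    and G: "\<And>x. x \<in> {0..c} \<Longrightarrow> G x = G 0 + integral {0..x} g"
  shows "integral {0..c} (\<lambda>x. G x * f x + F x * g x) = F c * G c - F 0 * G 0"
proof -
  have fi: "f integrable_on {0..c}" and gi: "g integrable_on {0..c}"
    using f g by (blast intro: set_lebesgue_integral_eq_integral(1))+
  have 1: "continuous_on {0..c} (\<lambda>x. F 0 + integral {0..x} f)"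
    by (intro continuous_intros indefinite_integral_continuous_1 fi)
  have cF: "continuous_on {0..c} F"
    by (rule continuous_on_eq[OF 1]) (rule F[symmetric])
  have 2: "continuous_on {0..c} (\<lambda>x. G 0 + integral {0..x} g)"
    by (intro continuous_intros indefinite_integral_continuous_1 gi)
  have cG: "continuous_on {0..c} G"
    by (rule continuous_on_eq[OF 2]) (rule G[symmetric])
  define h where "h = (\<lambda>x. G x * f x + F x * g x)"
  define q where "q = (\<lambda>x. \<bar>f x\<bar> + \<bar>g x\<bar>)"
  have hi: "h absolutely_integrable_on {0..c}" unfolding h_def
    by (intro set_integral_add absolutely_integrable_continuous_mult f g cF cG)
  have qi: "q absolutely_integrable_on {0..c}" unfolding q_def
    using absolutely_integrable_norm[OF f] absolutely_integrable_norm[OF g]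
    by (intro set_integral_add) (simp_all add: o_def)
  define H where "H = (\<lambda>x. F x * G x - integral {0..x} h)"
  have inc: "integral {0..y} k - integral {0..x} k = integral {x..y} k"
    if "k absolutely_integrable_on {0..c}" "0 \<le> x" "x \<le> y" "y \<le> c" for k :: "real \<Rightarrow> real" and x y
  proof -
    have "k integrable_on {0..y}"
      using that by (intro integrable_on_subinterval[OF set_lebesgue_integral_eq_integral(1)[OF that(1)]]) auto
    from Henstock_Kurzweil_Integration.integral_combine[OF that(2,3) this]
    show ?thesis by linarith
  qed
  have "H c = H 0"
  proof (rule constant_if_small_increments[where m = "\<lambda>x. integral {0..x} q", OF c])
    fix e :: real assume "e > 0"
    have uF: "uniformly_continuous_on {0..c} F" and uG: "uniformly_continuous_on {0..c} G"
      using cF cG by (auto intro!: compact_uniformly_continuous)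
    obtain d1 where d1: "d1 > 0" "\<And>x y. x \<in> {0..c} \<Longrightarrow> y \<in> {0..c} \<Longrightarrow> dist y x < d1 \<Longrightarrow> dist (F y) (F x) < e"
      using uF \<open>e > 0\<close> unfolding uniformly_continuous_on_def by metis
    obtain d2 where d2: "d2 > 0" "\<And>x y. x \<in> {0..c} \<Longrightarrow> y \<in> {0..c} \<Longrightarrow> dist y x < d2 \<Longrightarrow> dist (G y) (G x) < e"
      using uG \<open>e > 0\<close> unfolding uniformly_continuous_on_def by metis
    show "\<exists>d>0. \<forall>x y. 0 \<le> x \<and> x \<le> y \<and> y \<le> c \<and> y - x < d \<longrightarrow>
        \<bar>H y - H x\<bar> \<le> e * (integral {0..y} q - integral {0..x} q)"
    proof (intro exI[of _ "min d1 d2"] conjI allI impI)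
      fix x y :: real assume xy: "0 \<le> x \<and> x \<le> y \<and> y \<le> c \<and> y - x < min d1 d2"
      then have sub: "{x..y} \<subseteq> {0..c}" by auto
      have x: "x \<in> {0..c}" and y: "y \<in> {0..c}" using xy by auto
      have ii: "k integrable_on {x..y}" if "k absolutely_integrable_on {0..c}" for k :: "real \<Rightarrow> real"
        by (rule integrable_on_subinterval[OF set_lebesgue_integral_eq_integral(1)[OF that] sub])
      have ih: "h integrable_on {x..y}" and iq: "q integrable_on {x..y}"
        and if': "f integrable_on {x..y}" and ig: "g integrable_on {x..y}"
        using ii hi qi f g by auto
      have "F y - F x = integral {x..y} f" "G y - G x = integral {x..y} g"
        
        unfolding F[of y, OF y] F[of x, OF x] G[of y, OF y] G[of x, OF x]
        using inc[OF f, of x y] inc[OF g, of x y] xy by linarith+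
      \<comment> \<open>With G taken at the right end and F at the left end the product rule for
        increments is exact. Comparing with h leaves only the oscillation of F and G on [x, y] as an
        error.\<close>
      moreover have "F y * G y - F x * G x = G y * (F y - F x) + F x * (G y - G x)"
        by (simp add: algebra_simps)
      ultimately have "F y * G y - F x * G x = integral {x..y} (\<lambda>s. G y * f s + F x * g s)"
        using if' ig by (simp add: Henstock_Kurzweil_Integration.integral_add integrable_on_mult_right)
      moreover have "integral {0..y} h - integral {0..x} h = integral {x..y} h"
        using inc[OF hi] xy by simp
      ultimately have "H y - H x = integral {x..y} (\<lambda>s. G y * f s + F x * g s) - integral {x..y} h"
        by (simp add: H_def)
      also have "\<dots> = integral {x..y} (\<lambda>s. (G y * f s + F x * g s) - h s)"
        using if' ig ih by (intro Henstock_Kurzweil_Integration.integral_diff[symmetric]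
            Henstock_Kurzweil_Integration.integrable_add integrable_on_mult_right) auto
      finally have eq: "H y - H x = integral {x..y} (\<lambda>s. (G y * f s + F x * g s) - h s)" .
      have "norm (integral {x..y} (\<lambda>s. (G y * f s + F x * g s) - h s)) \<le> integral {x..y} (\<lambda>s. e * q s)"
      proof (rule integral_norm_bound_integral)
        show "(\<lambda>s. (G y * f s + F x * g s) - h s) integrable_on {x..y}"
          using if' ig ih by (intro Henstock_Kurzweil_Integration.integrable_diff
            Henstock_Kurzweil_Integration.integrable_add integrable_on_mult_right) auto
        show "(\<lambda>s. e * q s) integrable_on {x..y}" using iq by (intro integrable_on_mult_right)
        fix s assume s: "s \<in> {x..y}"
        have "dist (G y) (G s) < e" using s xy by (intro d2(2)) (auto simp: dist_real_def)
        moreover have "dist (F x) (F s) < e" using s xy by (intro d1(2)) (auto simp: dist_real_def)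
        ultimately have "\<bar>(G y - G s) * f s\<bar> \<le> e * \<bar>f s\<bar>" "\<bar>(F x - F s) * g s\<bar> \<le> e * \<bar>g s\<bar>"
          by (auto simp: abs_mult dist_real_def intro!: mult_right_mono)
        then show "norm ((G y * f s + F x * g s) - h s) \<le> e * q s"
          by (simp add: h_def q_def algebra_simps abs_le_iff)
      qed
      also have "\<dots> = e * (integral {0..y} q - integral {0..x} q)"
        using inc[OF qi, of x y] xy by simp
      finally show "\<bar>H y - H x\<bar> \<le> e * (integral {0..y} q - integral {0..x} q)"
        using eq by simp
    qed (use d1 d2 in auto)
  qed
  then show ?thesis by (simp add: H_def h_def)
qed

section \<open>The quadratic form and lower bounds for its infimum\<close>

definition rod_form :: "real \<Rightarrow> real \<Rightarrow> (real \<Rightarrow> real) \<Rightarrow> (real \<Rightarrow> real) \<Rightarrow> real" where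
  "rod_form a b u g = integral {0..1} (\<lambda>x. kernel_weight b x * (a * (u x)\<^sup>2 + (g x)\<^sup>2))"

lemma rod_form_absolutely_integrable:
  assumes "H1_with_derivative u g"
  shows "(\<lambda>x. kernel_weight b x * (a * (u x)\<^sup>2 + (g x)\<^sup>2)) absolutely_integrable_on {0..1}"
proof (rule absolutely_integrable_continuous_mult[OF set_integral_add(1)[OF _ H1_with_derivativeD(2)[OF assms]]])
  have "continuous_on {0..1} (\<lambda>x. a * (u x)\<^sup>2)"
    using H1_with_derivativeD(4)[OF assms] by (intro continuous_intros)
  then show "(\<lambda>x. a * (u x)\<^sup>2) absolutely_integrable_on {0..1}"
    by (rule absolutely_integrable_continuous_real)
qed (intro continuous_intros)

lemma rod_functional_eq:
  assumes "H1_with_derivative u g"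
  shows "(LBINT x:{0..1}. (rod_kernel x + b * deriv rod_kernel x) * (a * (u x)\<^sup>2 + (g x)\<^sup>2))
    = rod_form a b u g"
proof -
  let ?f = "\<lambda>x. kernel_weight b x * (a * (u x)\<^sup>2 + (g x)\<^sup>2)"
  have "(LBINT x:{0..1}. (rod_kernel x + b * deriv rod_kernel x) * (a * (u x)\<^sup>2 + (g x)\<^sup>2))
    = (LBINT x:{0..1}. ?f x)"
    unfolding set_lebesgue_integral_def
  proof (rule integral_discrete_difference[where X = "{0, 1}"])
    fix x :: real assume "x \<notin> {0, 1}"
    then show "indicator {0..1} x *\<^sub>R ((rod_kernel x + b * deriv rod_kernel x) * (a * (u x)\<^sup>2 + (g x)\<^sup>2))
      = indicator {0..1} x *\<^sub>R ?f x"
      by (auto simp: indicator_def rod_kernel_weight)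
  qed auto
  also have "\<dots> = integral {0..1} ?f"
  proof (rule set_borel_integral_eq_integral)
    have g: "(\<lambda>x. indicator {0..1} x *\<^sub>R (kernel_weight b x * (g x)\<^sup>2)) \<in> borel_measurable borel"
    proof -
      have "g \<in> borel_measurable borel" using assms by (simp add: H1_with_derivative_def)
      moreover have "kernel_weight b \<in> borel_measurable borel"
        by (intro borel_measurable_continuous_onI continuous_intros)
      ultimately show ?thesis by measurable
    qed
    have m: "(\<lambda>x. indicator {0..1} x *\<^sub>R (kernel_weight b x * (a * (u x)\<^sup>2))) \<in> borel_measurable borel"
      using H1_with_derivativeD(4)[OF assms]
      by (intro borel_measurable_continuous_on_indicator continuous_intros) auto
    have "(\<lambda>x. indicator {0..1} x *\<^sub>R ?f x) \<in> borel_measurable borel"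
      using borel_measurable_add[OF m g] by (simp add: algebra_simps)
    then show "set_integrable lborel {0..1} ?f"
      using rod_form_absolutely_integrable[OF assms, of b a]
      by (simp add: set_integrable_def integrable_completion)
  qed
  finally show ?thesis by (simp add: rod_form_def)
qed

text \<open>The inequality m <= I(a, b), phrased through test functions. It stays within the reals,
  and concavity and monotonicity of I can be checked for one test function at a time.\<close>

definition rod_lower :: "real \<Rightarrow> real \<Rightarrow> real \<Rightarrow> bool" where
  "rod_lower a b m \<longleftrightarrow> (\<forall>u g. H1_with_derivative u g \<longrightarrow> u 0 = 1 \<longrightarrow> u 1 = 1 \<longrightarrow> m \<le> rod_form a b u g)"

lemma rod_lower_iff: "rod_lower a b m \<longleftrightarrow> ereal m \<le> rod_I a b"
proof
  assume *: "rod_lower a b m"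
  show "ereal m \<le> rod_I a b"
    unfolding rod_I_def
  proof (rule Inf_greatest, elim CollectE exE conjE)
    fix x u g
    assume "H1_with_derivative u g" "u 0 = 1" "u 1 = 1" and x: "x = ereal
      (LBINT x:{0..1}. (rod_kernel x + b * deriv rod_kernel x) * (a * (u x)\<^sup>2 + (g x)\<^sup>2))"
    with * show "ereal m \<le> x"
      unfolding x by (simp add: rod_functional_eq rod_lower_def)
  qed
next
  assume *: "ereal m \<le> rod_I a b"
  show "rod_lower a b m"
    unfolding rod_lower_def
  proof (intro allI impI)
    fix u g assume u: "H1_with_derivative u g" "u 0 = 1" "u 1 = 1"
    note *
    also have "rod_I a b \<le> ereal (rod_form a b u g)"
      unfolding rod_I_def rod_functional_eq[OF u(1), symmetric] by (rule Inf_lower) (use u in blast)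
    finally show "m \<le> rod_form a b u g" by simp
  qed
qed

definition rod_admissible :: "real \<Rightarrow> real set" where
  "rod_admissible a = {b. 0 \<le> b \<and> rod_lower a b (a - b\<^sup>2)}"

lemma rod_beta_eq: "rod_beta \<gamma> = Inf (ereal ` rod_admissible ((3 - \<gamma>) / \<gamma>))"
proof -
  have *: "ereal c + I - ereal a \<ge> 0 \<longleftrightarrow> ereal (a - c) \<le> I" for c a I
    by (cases I) auto
  show ?thesis
    unfolding rod_beta_def Let_def rod_admissible_def rod_lower_iff *
    by (intro arg_cong[of _ _ Inf]) auto
qed

lemma kernel_weight_affine: "kernel_weight b x = kernel_weight 0 x + b * (kernel_weight 1 x - kernel_weight 0 x)"
  by (simp add: kernel_weight_def add_divide_distrib)

text \<open>The weight is affine in b and the other factor is affine in a. An infimum of such forms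
  is concave in each variable (\<open>rod_lower_convex_right\<close>,
  \<open>rod_lower_convex_left\<close>), and each form is continuous in (a, b), which
  \<open>not_rod_lower_eventually\<close> exploits.\<close>

lemma rod_form_bilinear:
  assumes "H1_with_derivative u g"
  obtains p q r s where "\<And>a b. rod_form a b u g = p + a * q + b * r + a * b * s"
proof -
  define w where "w = (\<lambda>x. kernel_weight 1 x - kernel_weight 0 x)"
  have cw: "continuous_on {0..1} (kernel_weight 0)" "continuous_on {0..1} w"
    unfolding w_def by (intro continuous_intros)+
  have cu: "continuous_on {0..1} (\<lambda>x. (u x)\<^sup>2)"
    using H1_with_derivativeD(4)[OF assms] by (intro continuous_intros)
  note I = absolutely_integrable_continuous_mult[THEN set_lebesgue_integral_eq_integral(1)]
  note i = I[OF H1_with_derivativeD(2)[OF assms] cw(1)]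
    I[OF H1_with_derivativeD(2)[OF assms] cw(2)]
    I[OF absolutely_integrable_continuous_real[OF cu] cw(1)]
    I[OF absolutely_integrable_continuous_real[OF cu] cw(2)]
  show ?thesis
  proof
    fix a b
    have "((\<lambda>x. kernel_weight 0 x * (g x)\<^sup>2 + a * (kernel_weight 0 x * (u x)\<^sup>2) + b * (w x * (g x)\<^sup>2)
       + a * b * (w x * (u x)\<^sup>2)) has_integral
      (integral {0..1} (\<lambda>x. kernel_weight 0 x * (g x)\<^sup>2) + a * integral {0..1} (\<lambda>x. kernel_weight 0 x * (u x)\<^sup>2)
       + b * integral {0..1} (\<lambda>x. w x * (g x)\<^sup>2) + a * b * integral {0..1} (\<lambda>x. w x * (u x)\<^sup>2))) {0..1}"
      by (intro has_integral_add has_integral_mult_right integrable_integral i)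
    moreover have "kernel_weight b x * (a * (u x)\<^sup>2 + (g x)\<^sup>2) = kernel_weight 0 x * (g x)\<^sup>2 + a * (kernel_weight 0 x * (u x)\<^sup>2)
      + b * (w x * (g x)\<^sup>2) + a * b * (w x * (u x)\<^sup>2)" for x
      by (subst kernel_weight_affine) (simp add: w_def algebra_simps)
    ultimately show "rod_form a b u g = integral {0..1} (\<lambda>x. kernel_weight 0 x * (g x)\<^sup>2) + a * integral {0..1} (\<lambda>x. kernel_weight 0 x * (u x)\<^sup>2)
       + b * integral {0..1} (\<lambda>x. w x * (g x)\<^sup>2) + a * b * integral {0..1} (\<lambda>x. w x * (u x)\<^sup>2)"
      unfolding rod_form_def by (simp add: integral_unique)
  qed
qed

lemma convex_lower_bound:
  fixes x y z l m n :: real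
  assumes "l \<le> x" "m \<le> y" "0 \<le> t" "t \<le> 1"
  shows "(1 - t) * l + t * m \<le> (1 - t) * x + t * y"
  using assms by (intro add_mono mult_left_mono) auto

lemma rod_lower_convex_right:
  assumes "rod_lower a b m" "rod_lower a b' m'" "0 \<le> t" "t \<le> 1"
  shows "rod_lower a ((1 - t) * b + t * b') ((1 - t) * m + t * m')"
  unfolding rod_lower_def
proof (intro allI impI)
  fix u g assume u: "H1_with_derivative u g" "u 0 = 1" "u 1 = 1"
  obtain p q r s where eq: "\<And>a b. rod_form a b u g = p + a * q + b * r + a * b * s"
    using rod_form_bilinear[OF u(1)] by metis
  have "m \<le> rod_form a b u g" "m' \<le> rod_form a b' u g"
    using assms(1,2) u unfolding rod_lower_def by auto
  then have "(1 - t) * m + t * m' \<le> (1 - t) * rod_form a b u g + t * rod_form a b' u g"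
    using assms by (intro convex_lower_bound)
  also have "\<dots> = rod_form a ((1 - t) * b + t * b') u g"
    unfolding eq by (simp add: algebra_simps)
  finally show "(1 - t) * m + t * m' \<le> rod_form a ((1 - t) * b + t * b') u g" .
qed

lemma rod_lower_convex_left:
  assumes "rod_lower a b m" "rod_lower a' b m'" "0 \<le> t" "t \<le> 1"
  shows "rod_lower ((1 - t) * a + t * a') b ((1 - t) * m + t * m')"
  unfolding rod_lower_def
proof (intro allI impI)
  fix u g assume u: "H1_with_derivative u g" "u 0 = 1" "u 1 = 1"
  obtain p q r s where eq: "\<And>a b. rod_form a b u g = p + a * q + b * r + a * b * s"
    using rod_form_bilinear[OF u(1)] by metis
  have "m \<le> rod_form a b u g" "m' \<le> rod_form a' b u g"
    using assms(1,2) u unfolding rod_lower_def by auto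
  then have "(1 - t) * m + t * m' \<le> (1 - t) * rod_form a b u g + t * rod_form a' b u g"
    using assms by (intro convex_lower_bound)
  also have "\<dots> = rod_form ((1 - t) * a + t * a') b u g"
    unfolding eq by (simp add: algebra_simps)
  finally show "(1 - t) * m + t * m' \<le> rod_form ((1 - t) * a + t * a') b u g" .
qed

text \<open>For |b| <= 1 the weight is positive, so the form increases with a.\<close>

lemma rod_lower_mono:
  assumes "rod_lower a b m" "m' \<le> m" "a \<le> a'" "\<bar>b\<bar> \<le> 1"
  shows "rod_lower a' b m'"
  unfolding rod_lower_def
proof (intro allI impI)
  fix u g assume u: "H1_with_derivative u g" "u 0 = 1" "u 1 = 1"
  have "m' \<le> rod_form a b u g"
    using assms(1,2) u unfolding rod_lower_def by force
  also have "\<dots> \<le> rod_form a' b u g" unfolding rod_form_def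
  proof (intro integral_le rod_form_absolutely_integrable[OF u(1), THEN set_lebesgue_integral_eq_integral(1)])
    fix x
    have "a * (u x)\<^sup>2 \<le> a' * (u x)\<^sup>2" using assms(3) by (intro mult_right_mono) auto
    then show "kernel_weight b x * (a * (u x)\<^sup>2 + (g x)\<^sup>2) \<le> kernel_weight b x * (a' * (u x)\<^sup>2 + (g x)\<^sup>2)"
      using kernel_weight_pos[OF assms(4), of x] by (intro mult_left_mono) auto
  qed
  finally show "m' \<le> rod_form a' b u g" .
qed

section \<open>Reflection of the unit interval\<close>

lemma has_integral_reflect_unit:
  fixes f :: "real \<Rightarrow> real"
  assumes "(f has_integral I) {1 - d..1 - c}"
  shows "((\<lambda>x. f (1 - x)) has_integral I) {c..d}"
proof -
  have "((f \<circ> (+) 1) has_integral I) {-d..-c}"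
    using assms has_integral_shift_Icc_real[of f 1 I "-d" "-c"] by simp
  then show ?thesis
    using has_integral_reflect_real[of "f \<circ> (+) 1" I "-c" "-d"] by simp
qed

lemma H1_with_derivative_reflect:
  assumes "H1_with_derivative u g"
  shows "H1_with_derivative (\<lambda>x. u (1 - x)) (\<lambda>x. - g (1 - x))"
proof -
  note d = H1_with_derivativeD[OF assms]
  have m: "g \<in> borel_measurable borel" using assms by (simp add: H1_with_derivative_def)
  have refl: "((\<lambda>x. k (1 - x)) has_integral integral {1 - d..1 - c} k) {c..d}"
    if "k absolutely_integrable_on {0..1}" "0 \<le> c" "c \<le> d" "d \<le> 1" for k :: "real \<Rightarrow> real" and c d
    using that by (intro has_integral_reflect_unit integrable_integral
        integrable_on_subinterval[OF set_lebesgue_integral_eq_integral(1)[OF that(1)]]) auto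
  show ?thesis
    unfolding H1_with_derivative_def
  proof (intro conjI ballI)
    show "(\<lambda>x. - g (1 - x)) \<in> borel_measurable borel" using m by measurable
    have aff: "set_integrable lborel {0..1} (\<lambda>x. k (1 - x))" if "set_integrable lborel {0..1} k" for k :: "real \<Rightarrow> real"
    proof -
      have "integrable lborel (\<lambda>x. indicator {0..1} (1 + (-1) * x) *\<^sub>R k (1 + (-1) * x))"
        using that unfolding set_integrable_def by (intro lborel_integrable_real_affine) auto
      moreover have "indicator {0..1} (1 - x) = (indicator {0..1} x :: real)" for x :: real
        by (auto simp: indicator_def)
      ultimately show ?thesis unfolding set_integrable_def by simp
    qed
    show "set_integrable lborel {0..1} (\<lambda>x. (- g (1 - x))\<^sup>2)"
      using aff[of "\<lambda>x. (g x)\<^sup>2"] assms by (simp add: H1_with_derivative_def)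
    fix x :: real assume x: "x \<in> {0..1}"
    have 1: "set_integrable lborel {0..1} (\<lambda>y. - g (1 - y))"
      using aff[OF d(5)] by (simp add: set_integrable_def)
    have "set_integrable lborel {0..x} (\<lambda>y. - g (1 - y))"
      by (rule set_integrable_subset[OF 1]) (use x in auto)
    then have "(LBINT y:{0..x}. - g (1 - y)) = integral {0..x} (\<lambda>y. - g (1 - y))"
      by (rule set_borel_integral_eq_integral)
    also have "\<dots> = - integral {1 - x..1} g"
      using refl[OF d(1), of 0 x] x by (simp add: integral_unique)
    also have "integral {0..1 - x} g + integral {1 - x..1} g = integral {0..1} g"
      using x by (intro Henstock_Kurzweil_Integration.integral_combine set_lebesgue_integral_eq_integral(1)[OF d(1)]) auto
    then have "- integral {1 - x..1} g = u (1 - x) - u 1"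
      using d(3)[of "1 - x"] d(3)[of 1] x by (smt (verit) atLeastAtMost_iff)
    finally show "u (1 - x) = u (1 - 0) + (LBINT y:{0..x}. - g (1 - y))" by simp
  qed
qed

text \<open>The substitution z -> 1 - z exchanges the weights for b and -b and keeps both boundary
  values, so I(a, b) is even in b.\<close>

lemma rod_lower_reflect:
  assumes "rod_lower a b m" shows "rod_lower a (- b) m"
  unfolding rod_lower_def
proof (intro allI impI)
  fix u g assume u: "H1_with_derivative u g" "u 0 = 1" "u 1 = 1"
  let ?F = "\<lambda>x. kernel_weight (-b) x * (a * (u x)\<^sup>2 + (g x)\<^sup>2)"
  have "m \<le> rod_form a b (\<lambda>x. u (1 - x)) (\<lambda>x. - g (1 - x))"
    using assms u H1_with_derivative_reflect[OF u(1)] unfolding rod_lower_def by auto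
  also have "\<dots> = integral {0..1} (\<lambda>x. ?F (1 - x))"
    unfolding rod_form_def using kernel_weight_reflect[of "-b"] by simp
  also have "\<dots> = integral {0..1} ?F"
  proof (rule integral_unique)
    have "(?F has_integral integral {0..1} ?F) {0..1}"
      using rod_form_absolutely_integrable[OF u(1)]
      by (intro integrable_integral set_lebesgue_integral_eq_integral(1))
    then show "((\<lambda>x. ?F (1 - x)) has_integral integral {0..1} ?F) {0..1}"
      by (intro has_integral_reflect_unit) simp
  qed
  finally show "m \<le> rod_form a (- b) u g" by (simp add: rod_form_def)
qed

text \<open>Completing the square. With w the weight, the Riccati inequality p' w + p^2 <= a w^2
  gives w (w (a u^2 + g^2) - (p u^2)') >= (w g - p u)^2 >= 0. Integrating (p u^2)' leaves the
  boundary terms.\<close>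

lemma rod_form_certificate:
  fixes p p' :: "real \<Rightarrow> real"
  assumes H: "H1_with_derivative u g" and b: "\<bar>b\<bar> \<le> 1"
    and p: "\<And>x. x \<in> {0..1} \<Longrightarrow> (p has_real_derivative p' x) (at x within {0..1})"
    and p': "continuous_on {0..1} p'"
    and ineq: "\<And>x. x \<in> {0..1} \<Longrightarrow> p' x * kernel_weight b x + (p x)\<^sup>2 \<le> a * (kernel_weight b x)\<^sup>2"
  shows "p 1 * (u 1)\<^sup>2 - p 0 * (u 0)\<^sup>2 \<le> rod_form a b u g"
proof -
  note d = H1_with_derivativeD[OF H]
  have cp: "continuous_on {0..1} p"
    using p by (meson DERIV_continuous_on)
  have ap': "p' absolutely_integrable_on {0..1}"
    using p' by (rule absolutely_integrable_continuous_real)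
  have pI: "p x = p 0 + integral {0..x} p'" if "x \<in> {0..1}" for x
  proof -
    have "(p' has_integral p x - p 0) {0..x}"
    proof (intro fundamental_theorem_of_calculus)
      fix y assume "y \<in> {0..x}"
      with that have "(p has_real_derivative p' y) (at y within {0..x})"
        by (intro has_field_derivative_subset[OF p]) auto
      then show "(p has_vector_derivative p' y) (at y within {0..x})"
        by (simp add: has_real_derivative_iff_has_vector_derivative)
    qed (use that in auto)
    then show ?thesis by (simp add: integral_unique)
  qed
  have ag: "g absolutely_integrable_on {0..x}" and ap: "p' absolutely_integrable_on {0..x}" if "x \<in> {0..1}" for x
    using that by (auto intro: set_integrable_subset[OF d(1)] set_integrable_subset[OF ap'])
  \<comment> \<open>As u is only absolutely continuous, p u^2 is integrated by using the product
    rule twice, for p u and for (p u) u.\<close>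
  have pu: "p x * u x = p 0 * u 0 + integral {0..x} (\<lambda>x. u x * p' x + p x * g x)" if x: "x \<in> {0..1}" for x
  proof -
    have "integral {0..x} (\<lambda>x. u x * p' x + p x * g x) = p x * u x - p 0 * u 0"
      using x ap[OF x] ag[OF x] by (intro integral_product_rule pI d(3)) auto
    then show ?thesis by simp
  qed
  have apu: "(\<lambda>x. u x * p' x + p x * g x) absolutely_integrable_on {0..1}"
    by (intro set_integral_add absolutely_integrable_continuous_mult ap' d cp)
  have eq: "integral {0..1} (\<lambda>x. u x * (u x * p' x + p x * g x) + p x * u x * g x) = p 1 * u 1 * u 1 - p 0 * u 0 * u 0"
    using apu d(1) by (intro integral_product_rule pu d(3)) auto
  have "p 1 * (u 1)\<^sup>2 - p 0 * (u 0)\<^sup>2 = integral {0..1} (\<lambda>x. u x * (u x * p' x + p x * g x) + p x * u x * g x)"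
    unfolding eq by (simp add: power2_eq_square)
  also have "\<dots> \<le> rod_form a b u g" unfolding rod_form_def
  proof (intro integral_le)
    show "(\<lambda>x. u x * (u x * p' x + p x * g x) + p x * u x * g x) integrable_on {0..1}"
      by (intro set_lebesgue_integral_eq_integral(1) set_integral_add
          absolutely_integrable_continuous_mult[OF apu d(4)]
          absolutely_integrable_continuous_mult[OF d(1)] continuous_on_mult cp d(4))
    show "(\<lambda>x. kernel_weight b x * (a * (u x)\<^sup>2 + (g x)\<^sup>2)) integrable_on {0..1}"
      using rod_form_absolutely_integrable[OF H] by (rule set_lebesgue_integral_eq_integral(1))
    fix x :: real assume x: "x \<in> {0..1}"
    define w where "w = kernel_weight b x"
    have w: "w > 0" unfolding w_def by (rule kernel_weight_pos[OF b])
    have "(p' x * w + (p x)\<^sup>2) * (u x)\<^sup>2 \<le> a * w\<^sup>2 * (u x)\<^sup>2"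
      using ineq[OF x] unfolding w_def by (intro mult_right_mono) auto
    moreover have "0 \<le> (w * g x - p x * u x)\<^sup>2" by simp
    ultimately have "w * (u x * (u x * p' x + p x * g x) + p x * u x * g x) \<le> w * (w * (a * (u x)\<^sup>2 + (g x)\<^sup>2))"
      by (simp add: power2_eq_square algebra_simps)
    with w show "u x * (u x * p' x + p x * g x) + p x * u x * g x \<le> kernel_weight b x * (a * (u x)\<^sup>2 + (g x)\<^sup>2)"
      unfolding w_def[symmetric] by simp
  qed
  finally show ?thesis .
qed

section \<open>Numerical bounds\<close>

lemma H1_with_derivative_C1:
  assumes f: "\<And>x. x \<in> {0..1} \<Longrightarrow> (f has_real_derivative g x) (at x within {0..1})"
    and g: "continuous_on UNIV g"
  shows "H1_with_derivative f g"
  unfolding H1_with_derivative_def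
proof (intro conjI ballI)
  show "g \<in> borel_measurable borel" using g by (rule borel_measurable_continuous_onI)
  show "set_integrable lborel {0..1} (\<lambda>x. (g x)\<^sup>2)"
    by (intro borel_integrable_atLeastAtMost' continuous_intros continuous_on_subset[OF g]) auto
  fix x :: real assume x: "x \<in> {0..1}"
  have "set_integrable lborel {0..x} g"
    by (intro borel_integrable_atLeastAtMost' continuous_on_subset[OF g]) auto
  then have "(LBINT y:{0..x}. g y) = integral {0..x} g"
    by (rule set_borel_integral_eq_integral)
  also have "(g has_integral f x - f 0) {0..x}"
  proof (intro fundamental_theorem_of_calculus)
    fix y assume "y \<in> {0..x}"
    with x have "(f has_real_derivative g y) (at y within {0..x})"
      by (intro has_field_derivative_subset[OF f]) auto
    then show "(f has_vector_derivative g y) (at y within {0..x})"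
      by (simp add: has_real_derivative_iff_has_vector_derivative)
  qed (use x in auto)
  then have "integral {0..x} g = f x - f 0" by (rule integral_unique)
  finally show "f x = f 0 + (LBINT y:{0..x}. g y)" by simp
qed

lemma poly_shift_has_derivative:
  "((\<lambda>z. poly P (z - c)) has_real_derivative poly (pderiv P) (z - c)) (at z within S)"
proof -
  have "((\<lambda>z. z - c) has_real_derivative 1) (at z within S)"
    by (auto intro!: derivative_eq_intros)
  from DERIV_chain2[OF poly_DERIV this] show ?thesis by simp
qed

lemma H1_with_derivative_poly:
  "H1_with_derivative (\<lambda>z. poly U (z - c)) (\<lambda>z. poly (pderiv U) (z - c))"
  by (intro H1_with_derivative_C1 poly_shift_has_derivative continuous_intros)

text \<open>
  If \<open>Q - Q'' = (U')\<^sup>2 + a U\<^sup>2\<close>, then \<open>(Q - b Q') sinh + (b Q - Q') cosh\<close> is an antiderivative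
  of \<open>((U')\<^sup>2 + a U\<^sup>2) (cosh + b sinh)\<close>.
\<close>

lemma rod_form_poly:
  fixes U Q :: "real poly"
  assumes Q: "Q - pderiv (pderiv Q) = (pderiv U)\<^sup>2 + smult a (U\<^sup>2)"
  defines "R \<equiv> pderiv Q" and "h \<equiv> 1/2 :: real"
  shows "rod_form a b (\<lambda>z. poly U (z - 1/2)) (\<lambda>z. poly (pderiv U) (z - 1/2)) =
    ((poly Q h + poly Q (- h)) - b * (poly R h + poly R (- h))
      + cosh h / sinh h * (b * (poly Q h - poly Q (- h)) - (poly R h - poly R (- h)))) / 2"
proof -
  define F where "F = (\<lambda>z. ((poly Q (z - 1/2) - b * poly R (z - 1/2)) * sinh (z - 1/2)
     + (b * poly Q (z - 1/2) - poly R (z - 1/2)) * cosh (z - 1/2)) / (2 * sinh h))"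
  have S: "sinh h > 0" by (simp add: h_def)
  have q: "poly (pderiv R) y = poly Q y - ((poly (pderiv U) y)\<^sup>2 + a * (poly U y)\<^sup>2)" for y
    using arg_cong[OF Q, of "\<lambda>p. poly p y"] by (simp add: R_def)
  have "((\<lambda>z. kernel_weight b z * (a * (poly U (z - 1/2))\<^sup>2 + (poly (pderiv U) (z - 1/2))\<^sup>2)) has_integral F 1 - F 0) {0..1}"
  proof (intro fundamental_theorem_of_calculus)
    fix z :: real
    have "(F has_real_derivative kernel_weight b z * (a * (poly U (z - 1/2))\<^sup>2 + (poly (pderiv U) (z - 1/2))\<^sup>2)) (at z within {0..1})"
      unfolding F_def R_def
      by (rule derivative_eq_intros poly_shift_has_derivative refl | (simp add: h_def; fail))+
        (simp add: R_def[symmetric] q kernel_weight_def h_def field_simps)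
    then show "(F has_vector_derivative kernel_weight b z * (a * (poly U (z - 1/2))\<^sup>2 + (poly (pderiv U) (z - 1/2))\<^sup>2)) (at z within {0..1})"
      by (simp add: has_real_derivative_iff_has_vector_derivative)
  qed auto
  then have "rod_form a b (\<lambda>z. poly U (z - 1/2)) (\<lambda>z. poly (pderiv U) (z - 1/2)) = F 1 - F 0"
    unfolding rod_form_def by (rule integral_unique)
  also have "F 1 = ((poly Q h - b * poly R h) * sinh h + (b * poly Q h - poly R h) * cosh h) / (2 * sinh h)"
    by (simp add: F_def h_def)
  also have "F 0 = ((poly Q (-h) - b * poly R (-h)) * - sinh h + (b * poly Q (-h) - poly R (-h)) * cosh h) / (2 * sinh h)"
    by (simp add: F_def h_def)
  finally show ?thesis using S by (simp add: field_simps)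
qed

section \<open>Bounds for e and coth (1/2), and the upper bound for I\<close>

lemma exp_1_bounds: "2718281828 / 1000000000 \<le> exp (1::real)" "exp (1::real) \<le> 2718281829 / 1000000000"
proof -
  \<comment> \<open>Fourteen Taylor terms leave the remainder e^t / 14!, which lies between 0 and 3
    / 14!, below 4e-11.\<close>
  obtain t :: real where t: "\<bar>t\<bar> \<le> \<bar>1\<bar>" "exp 1 = (\<Sum>m<14. 1 ^ m / fact m) + (exp t / fact 14) * 1 ^ 14"
    using Maclaurin_exp_le[of 1 14] by auto
  have s: "(\<Sum>m<14. 1 ^ m / fact m :: real) = 8463398743 / 3113510400"
    by (simp add: lessThan_nat_numeral fact_numeral lessThan_Suc)
  have "exp t \<le> exp 1" using t(1) by simp
  then have "exp t \<le> 3" using exp_le by linarith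
  moreover have "exp t > 0" by simp
  ultimately have "0 \<le> exp t / fact 14" "exp t / fact 14 \<le> 3 / 87178291200"
    by (simp_all add: fact_numeral field_simps)
  moreover have "exp 1 = 8463398743 / 3113510400 + exp t / fact 14"
    using t(2) unfolding s by (simp only: power_one mult_1_right)
  ultimately show "2718281828 / 1000000000 \<le> exp (1::real)" "exp (1::real) \<le> 2718281829 / 1000000000"
    by linarith+
qed

text \<open>coth (1/2) = (e + 1) / (e - 1). All boundary values below are rational expressions in
  this number, with tanh (1/2) as its reciprocal.\<close>

lemma coth_half_bounds:
  "21639534133 / 10000000000 \<le> cosh (1/2) / sinh (1/2 :: real)"
  "cosh (1/2) / sinh (1/2 :: real) \<le> 21639534145 / 10000000000"
proof -
  have e: "exp (1/2 :: real) * exp (1/2) = exp 1" by (simp add: exp_add[symmetric])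
  have p: "exp (1/2 :: real) > 0" by simp
  have "exp (- (1/2) :: real) = inverse (exp (1/2))" by (rule exp_minus)
  then have "cosh (1/2) / sinh (1/2 :: real) = (exp (1/2) + inverse (exp (1/2))) / (exp (1/2) - inverse (exp (1/2)))"
    unfolding cosh_field_def sinh_field_def by (simp only: divide_divide_eq_left divide_divide_eq_right)
  also have "\<dots> = (exp 1 + 1) / (exp 1 - 1)"
    using p e by (simp add: divide_simps algebra_simps flip: e)
  finally have k: "cosh (1/2) / sinh (1/2 :: real) = (exp 1 + 1) / (exp 1 - 1)" .
  have "exp 1 > (1::real)" by simp
  then show "21639534133 / 10000000000 \<le> cosh (1/2) / sinh (1/2 :: real)"
    "cosh (1/2) / sinh (1/2 :: real) \<le> 21639534145 / 10000000000"
    unfolding k using exp_1_bounds by (simp_all add: field_simps)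
qed

text \<open>Approximate minimiser for \<open>a = -1\<close> and \<open>b = 0.294\<close>, in the variable \<open>z - 1/2\<close>.\<close>

definition test_poly :: "real poly" where
  "test_poly = [:2267/2000, -49/4000, -451/800, 49/1000, 119/1000:]"

text \<open>The polynomial Q with Q - Q'' = R for R = (U')^2 - U^2 and U = \<open>test_poly\<close>;
  it equals R + R'' + R'''' + ..., a finite sum.\<close>

definition test_antideriv :: "real poly" where
  "test_antideriv = [:-5575531549/16000000, -151025987/4000000, -2777488397/16000000,
     -10083171/1600000, -234851401/16000000, -291697/1000000, -869337/2000000, -5831/500000,
     -14161/1000000:]"

lemma test_antideriv:
  "test_antideriv - pderiv (pderiv test_antideriv) = (pderiv test_poly)\<^sup>2 + smult (-1) (test_poly\<^sup>2)"
  by (simp add: test_antideriv_def test_poly_def pderiv_pCons power2_eq_square)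

lemma not_rod_lower_test:
  assumes "0 \<le> b" "b \<le> 29401/100000"
  shows "\<not> rod_lower (-1) b (-1 - b\<^sup>2)"
proof
  assume *: "rod_lower (-1) b (-1 - b\<^sup>2)"
  define k where "k = cosh (1/2) / sinh (1/2 :: real)"
  have k: "21639534133 / 10000000000 \<le> k" "k \<le> 21639534145 / 10000000000"
    unfolding k_def by (rule coth_half_bounds)+
  have "-1 - b\<^sup>2 \<le> rod_form (-1) b (\<lambda>z. poly test_poly (z - 1/2)) (\<lambda>z. poly (pderiv test_poly) (z - 1/2))"
    using * H1_with_derivative_poly[of test_poly "1/2"]
    unfolding rod_lower_def by (simp add: test_poly_def)
  also have "\<dots> = -6284691413/16000000 + b * (21287707/500000) + k * (362029033/2000000 - b * (78700811/4000000))"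
    unfolding rod_form_poly[OF test_antideriv] k_def[symmetric]
    by (simp add: test_antideriv_def pderiv_pCons field_simps)
  finally have le: "-1 - b\<^sup>2 \<le> -6284691413/16000000 + b * (21287707/500000) + k * (362029033/2000000 - b * (78700811/4000000))" .
  have "b\<^sup>2 \<le> 29401/100000 * b"
    using assms mult_right_mono[of b "29401/100000" b] by (simp add: power2_eq_square)
  \<comment> \<open>The factor of k is positive on the range of b, so the upper bound for k applies.
    With b^2 replaced by 0.29401 b the condition becomes linear in b.\<close>
  moreover have "k * (362029033/2000000 - b * (78700811/4000000)) \<le> 21639534145/10000000000 * (362029033/2000000 - b * (78700811/4000000))"
    using k assms by (intro mult_right_mono) auto
  ultimately have "0 \<le> 1 + 29401/100000 * b + (-6284691413/16000000 + b * (21287707/500000)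
      + 21639534145/10000000000 * (362029033/2000000 - b * (78700811/4000000)))"
    using le by linarith
  \<comment> \<open>The linear condition requires b to be at least about 0.2941, just above the
    allowed range.\<close>
  then have "862322/10000000 \<le> 2932020/10000000 * b" using assms by (simp add: field_simps)
  then show False using assms by linarith
qed

section \<open>The Riccati certificate at b = 3/10\<close>

lemma poly_abs_le:
  fixes p :: "real poly"
  assumes "\<bar>t\<bar> \<le> T"
  shows "\<bar>poly p t\<bar> \<le> poly (map_poly abs p) T"
proof (induction p)
  case (pCons c p)
  have "\<bar>t * poly p t\<bar> \<le> T * poly (map_poly abs p) T"
    unfolding abs_mult using assms pCons by (intro mult_mono) auto
  then show ?case using abs_triangle_ineq[of c "t * poly p t"] by (simp add: map_poly_pCons pCons)
qed simp

text \<open>Splitting the coefficients by sign writes p on the half-line t >= 0 as an increasing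
  plus a decreasing function, so the rational ends l and r enclose the value at t.\<close>

lemma poly_bounds_pos:
  fixes p :: "real poly"
  assumes "0 \<le> l" "l \<le> t" "t \<le> r"
  shows "poly (map_poly (max 0) p) l + poly (map_poly (min 0) p) r \<le> poly p t" (is ?A)
    and "poly p t \<le> poly (map_poly (max 0) p) r + poly (map_poly (min 0) p) l" (is ?B)
proof -
  have "0 \<le> poly (map_poly (max 0) q) s \<and> poly (map_poly (min 0) q) s \<le> 0
     \<and> poly q s = poly (map_poly (max 0) q) s + poly (map_poly (min 0) q) s"
    if "0 \<le> s" for s and q :: "real poly"
    using that
  proof (induction q)
    case (pCons c q)
    then show ?case
      by (auto simp: map_poly_pCons mult_nonneg_nonpos mult_nonneg_nonneg algebra_simps max_def min_def add_nonpos_nonpos)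
  qed simp
  then have s: "0 \<le> poly (map_poly (max 0) q) s" "poly (map_poly (min 0) q) s \<le> 0"
     "poly q s = poly (map_poly (max 0) q) s + poly (map_poly (min 0) q) s"
    if "0 \<le> s" for s and q :: "real poly"
    using that by blast+
  have mono: "poly (map_poly (max 0) p) x \<le> poly (map_poly (max 0) p) y
      \<and> poly (map_poly (min 0) p) y \<le> poly (map_poly (min 0) p) x" if "0 \<le> x" "x \<le> y" for x y
  proof (induction p)
    case (pCons c p)
    have "x * poly (map_poly (max 0) p) x \<le> y * poly (map_poly (max 0) p) y"
      using that pCons.IH s(1)[of x p] by (intro mult_mono) auto
    moreover have "x * - poly (map_poly (min 0) p) x \<le> y * - poly (map_poly (min 0) p) y"
      using that pCons.IH s(2)[of x p] by (intro mult_mono) auto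
    ultimately show ?case by (simp add: map_poly_pCons)
  qed simp
  show ?A ?B using s(3)[of t p] mono[of l t] mono[of t r] assms by auto
qed

text \<open>
  For \<open>b = 3/10\<close>, \<open>cert_poly\<close> is a Taylor polynomial in \<open>t = tanh (z - 1/2)\<close>, scaled by \<open>10000\<close>, of a
  solution \<open>v\<close> of \<open>(k v')' = -1.0007 k v\<close> with \<open>k = kernel_weight b\<close>. The gap between \<open>1.0007\<close> and
  \<open>1.0001\<close> absorbs the truncation error, so that \<open>k v' / v\<close> solves the Riccati inequality.
\<close>

definition cert_poly :: "real poly" where
  "cert_poly = [:10000, -120, -4986, 497, -2195, 208, -1261, 101, -835, 55, -600, 32, -455, 19, -358:]"

text \<open>The derivative in z of \<open>cert_poly\<close> at t = tanh (z - 1/2), because dt/dz = 1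
  - t^2.\<close>

definition cert_num :: "real poly" where
  "cert_num = [:1, 0, -1:] * pderiv cert_poly"

lemma cert_num: "cert_num = [:-120, -9972, 1611, 1192, -451, 1214, -333, 886, -212, 680, -143, 540, -105, 448, -247, 5012:]"
  by (simp add: cert_num_def cert_poly_def pderiv_pCons)

text \<open>Divided by cosh (z - 1/2) / (2 sinh (1/2)), the weight k is 1 + 3t/10 and k' is 3/10 +
  t. The left side is therefore (k v')' + 1.0001 k v after this division. Of the constant term -7,
  the part -6 is the gap 10000 (1.0001 - 1.0007), the rest is rounding.\<close>

lemma cert_defect:
  "[:3/10, 1:] * cert_num + [:1, 3/10:] * [:1, 0, -1:] * pderiv cert_num + smult (10001/10000) ([:1, 3/10:] * cert_poly)
   = [:-7, -114/125, 16989/5000, 202503/25000, -320459/100000, 337099/20000, -540993/50000, -292773/100000, 2621953/100000, 757609/20000, -933167/20000, -32537/2500, -97227/50000, -9283647/4000, 6871816477/100000, 1270699463/50000, -345653/5, -22554:]"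
  by (simp add: cert_num cert_poly_def pderiv_pCons)

lemma cert_poly_pos:
  assumes "\<bar>t\<bar> \<le> 4622/10000" shows "poly cert_poly t > 0"
proof -
  have "poly cert_poly t = 10000 + poly (cert_poly - [:10000:]) t" by simp
  moreover have "\<bar>poly (cert_poly - [:10000:]) t\<bar> \<le> 9999"
    by (rule order.trans[OF poly_abs_le[OF assms]]) (simp add: cert_poly_def map_poly_pCons)
  ultimately show ?thesis by linarith
qed

text \<open>For |t| <= 0.4622, which covers tanh on [-1/2, 1/2], the other terms of the defect add
  up to at most 7 in absolute value, so the constant term -7 decides the sign.\<close>

lemma cert_defect_nonpos:
  assumes "\<bar>t\<bar> \<le> 4622/10000"
  shows "(3/10 + t) * poly cert_num t + (1 + 3/10 * t) * (1 - t\<^sup>2) * poly (pderiv cert_num) t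
    \<le> -(10001/10000) * ((1 + 3/10 * t) * poly cert_poly t)"
proof -
  define D where "D = [:3/10, 1:] * cert_num + [:1, 3/10:] * [:1, 0, -1:] * pderiv cert_num
    + smult (10001/10000) ([:1, 3/10:] * cert_poly)"
  have "poly D t = -7 + poly (D + [:7:]) t" by simp
  moreover have "\<bar>poly (D + [:7:]) t\<bar> \<le> 7"
    unfolding D_def cert_defect
    by (rule order.trans[OF poly_abs_le[OF assms]]) (simp add: map_poly_pCons)
  ultimately have "poly D t \<le> 0" by linarith
  moreover have "poly D t = (3/10 + t) * poly cert_num t + (1 + 3/10 * t) * (1 - t\<^sup>2) * poly (pderiv cert_num) t
    + (10001/10000) * ((1 + 3/10 * t) * poly cert_poly t)"
    unfolding D_def by (simp add: power2_eq_square) (simp add: field_simps)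
  ultimately show ?thesis by linarith
qed

definition cert_fun :: "real \<Rightarrow> real" where
  "cert_fun z = kernel_weight (3/10) z * (poly cert_num (tanh (z - 1/2)) / poly cert_poly (tanh (z - 1/2)))"

lemma tanh_half_bounds: "462117157/1000000000 \<le> tanh (1/2 :: real)" "tanh (1/2 :: real) \<le> 462117158/1000000000"
proof -
  define k where "k = cosh (1/2) / sinh (1/2 :: real)"
  have t: "tanh (1/2 :: real) = 1 / k" by (simp add: tanh_def k_def)
  have k: "21639534133 / 10000000000 \<le> k" "k \<le> 21639534145 / 10000000000"
    unfolding k_def by (rule coth_half_bounds)+
  then have "k > 0" by linarith
  with k show "462117157/1000000000 \<le> tanh (1/2 :: real)" "tanh (1/2 :: real) \<le> 462117158/1000000000"
    unfolding t by (simp_all add: field_simps)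
qed

lemma tanh_abs_le:
  assumes "z \<in> {0..1}" shows "\<bar>tanh (z - 1/2 :: real)\<bar> \<le> 4622/10000"
proof -
  have "tanh (z - 1/2) \<le> tanh (1/2)" "tanh (- (1/2)) \<le> tanh (z - 1/2)"
    unfolding tanh_real_le_iff using assms by auto
  then show ?thesis using tanh_half_bounds unfolding tanh_minus by linarith
qed

lemma cert_fun_bound:
  assumes "H1_with_derivative u g" "a = -10001/10000"
  shows "cert_fun 1 * (u 1)\<^sup>2 - cert_fun 0 * (u 0)\<^sup>2 \<le> rod_form a (3/10) u g"
proof -
  define v n n' :: "real \<Rightarrow> real" where "v = (\<lambda>z::real. poly cert_poly (tanh (z - 1/2)))"
    and "n = (\<lambda>z::real. poly cert_num (tanh (z - 1/2)))"
    and "n' = (\<lambda>z::real. poly (pderiv cert_num) (tanh (z - 1/2)))"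
  define w where "w = kernel_weight (3/10)"
  define w' where "w' = (\<lambda>z::real. (sinh (z - 1/2) + 3/10 * cosh (z - 1/2)) / (2 * sinh (1/2)))"
  define c :: "real \<Rightarrow> real" where "c = (\<lambda>z::real. 1 - (tanh (z - 1/2))\<^sup>2)"
  define p' where "p' = (\<lambda>z::real. w' z * (n z / v z) + w z * ((n' z * c z * v z - n z * n z) / (v z)\<^sup>2))"
  have cosh_nz: "cosh y \<noteq> 0" for y :: real using cosh_real_pos[of y] by linarith
  have v: "v z > 0" if "z \<in> {0..1}" for z
    unfolding v_def by (intro cert_poly_pos tanh_abs_le that)
  have vd: "(v has_real_derivative n z) (at z within {0..1})"
    and nd: "(n has_real_derivative n' z * c z) (at z within {0..1})" for z
  proof -
    have t: "((\<lambda>z. tanh (z - 1/2)) has_real_derivative c z) (at z within {0..1})"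
      unfolding c_def by (rule derivative_eq_intros refl cosh_nz | simp)+
    have "poly (pderiv cert_poly) (tanh (z - 1/2)) * c z = n z"
      unfolding n_def c_def cert_num_def by (simp add: power2_eq_square algebra_simps)
    with DERIV_chain2[OF poly_DERIV t, of cert_poly] show "(v has_real_derivative n z) (at z within {0..1})"
      unfolding v_def by simp
    show "(n has_real_derivative n' z * c z) (at z within {0..1})"
      using DERIV_chain2[OF poly_DERIV t, of cert_num] unfolding n_def n'_def .
  qed
  have wd: "(w has_real_derivative w' z) (at z within {0..1})" for z
    unfolding w_def w'_def using kernel_weight_has_field_derivative[of "\<lambda>x. x" 1 z "{0..1}" "3/10"] by simp
  have pd: "(cert_fun has_real_derivative p' z) (at z within {0..1})" if z: "z \<in> {0..1}" for z
  proof -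
    have eq: "cert_fun = (\<lambda>z. w z * (n z / v z))" by (simp add: fun_eq_iff cert_fun_def w_def n_def v_def)
    show ?thesis unfolding eq p'_def
      by (rule derivative_eq_intros wd vd nd refl | use v[OF z] in \<open>simp add: power2_eq_square\<close>)+
  qed
  have cont: "continuous_on {0..1} (\<lambda>z. poly P (tanh (z - 1/2)))" for P :: "real poly"
    by (intro continuous_intros) (auto simp: cosh_nz)
  have cv: "continuous_on {0..1} v" "continuous_on {0..1} n" "continuous_on {0..1} n'" "continuous_on {0..1} c"
    "continuous_on {0..1} w" "continuous_on {0..1} w'"
    unfolding v_def n_def n'_def c_def w_def w'_def
    by (intro cont continuous_intros; auto simp: cosh_nz)+
  show ?thesis
  proof (rule rod_form_certificate[OF assms(1) _ pd])
    show "continuous_on {0..1} p'"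
      unfolding p'_def using v by (intro continuous_intros cv) (auto simp: less_imp_neq[THEN not_sym])
    fix z :: real assume z: "z \<in> {0..1}"
    define t where "t = tanh (z - 1/2)"
    \<comment> \<open>Factoring out K turns the hyperbolic functions into polynomials in t, the form
      in which the defect was estimated.\<close>
    define K where "K = cosh (z - 1/2) / (2 * sinh (1/2))"
    have K: "K > 0" unfolding K_def by simp
    have s: "sinh (z - 1/2) = t * cosh (z - 1/2)" using cosh_nz by (simp add: t_def tanh_def)
    have wK: "w z = K * (1 + 3/10 * t)" "w' z = K * (3/10 + t)"
      unfolding w_def w'_def kernel_weight_def s K_def by (simp_all add: field_simps)
    have wp: "w z > 0" unfolding w_def by (rule kernel_weight_pos) simp
    have vz: "v z > 0" by (rule v[OF z])
    have "K * ((3/10 + t) * n z + (1 + 3/10 * t) * (1 - t\<^sup>2) * n' z) \<le> K * (a * ((1 + 3/10 * t) * v z))"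
      using cert_defect_nonpos[OF tanh_abs_le[OF z]] K
      unfolding n_def n'_def v_def t_def assms(2) by (intro mult_left_mono) auto
    then have "w' z * n z + w z * c z * n' z \<le> a * w z * v z"
      unfolding wK by (simp add: c_def t_def[symmetric] algebra_simps)
    then have "(w z / v z) * (w' z * n z + w z * c z * n' z) \<le> (w z / v z) * (a * w z * v z)"
      using wp vz by (intro mult_left_mono) auto
    \<comment> \<open>The Riccati substitution p = w v'/v: the terms with (v')^2 cancel and what
      remains is (w / v) (w v')'.\<close>
    moreover have "p' z * w z + (cert_fun z)\<^sup>2 = (w z / v z) * (w' z * n z + w z * c z * n' z)"
    proof -
      have "cert_fun z = w z * (n z / v z)" by (simp add: cert_fun_def w_def n_def v_def)
      then show ?thesis
        using vz unfolding p'_def by (simp add: field_simps power2_eq_square)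
    qed
    moreover have "(w z / v z) * (a * w z * v z) = a * (w z)\<^sup>2"
      using vz by (simp add: power2_eq_square)
    ultimately show "p' z * kernel_weight (3/10) z + (cert_fun z)\<^sup>2 \<le> a * (kernel_weight (3/10) z)\<^sup>2"
      unfolding w_def by simp
  qed simp
qed

text \<open>The certificate evaluates to \<open>cert_fun\<close> 1 - \<open>cert_fun\<close> 0,
  about -1.08743. Taking a = -1.0001 leaves room for parameters below -1, and -1.0875 is high enough
  to make b = 0.2959 admissible at a = -1.\<close>

lemma rod_lower_cert: "rod_lower (-10001/10000) (3/10) (-10875/10000)"
  unfolding rod_lower_def
proof (intro allI impI)
  fix u g assume u: "H1_with_derivative u g" "u 0 = 1" "u 1 = 1"
  define k where "k = cosh (1/2) / sinh (1/2 :: real)"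
  have k: "21639534133 / 10000000000 \<le> k" "k \<le> 21639534145 / 10000000000"
    unfolding k_def by (rule coth_half_bounds)+
  define t where "t = tanh (1/2 :: real)"
  have t: "462117157/1000000000 \<le> t" "t \<le> 462117158/1000000000" "0 \<le> t"
    unfolding t_def using tanh_half_bounds by auto
  define l where "l = (462117/1000000 :: real)"
  define r where "r = (462118/1000000 :: real)"
  have lr: "0 \<le> l" "l \<le> t" "t \<le> r" using t by (auto simp: l_def r_def)
  have n1: "-426051/100 \<le> poly cert_num t"
    by (rule order.trans[OF _ poly_bounds_pos(1)[OF lr]]) (simp add: cert_num map_poly_pCons l_def r_def)
  have v1: "881927/100 \<le> poly cert_poly t"
    by (rule order.trans[OF _ poly_bounds_pos(1)[OF lr]]) (simp add: cert_poly_def map_poly_pCons l_def r_def)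
  \<comment> \<open>\<open>poly_bounds_pos\<close> asks for a nonnegative argument, so the value at
    -t is read as that of the reflected polynomial at t.\<close>
  have reflect: "poly p (- t) = poly (p \<circ>\<^sub>p [:0, -1:]) t" for p :: "real poly"
    by (simp add: poly_pcompose)
  have n0: "poly cert_num (- t) \<le> 465992/100" unfolding reflect
    by (rule order.trans[OF poly_bounds_pos(2)[OF lr]]) (simp add: cert_num pcompose_pCons map_poly_pCons l_def r_def)
  have v0: "882228/100 \<le> poly cert_poly (- t)" unfolding reflect
    by (rule order.trans[OF _ poly_bounds_pos(1)[OF lr]]) (simp add: cert_poly_def pcompose_pCons map_poly_pCons l_def r_def)
  have w: "kernel_weight b 1 = (k + b) / 2" "kernel_weight b 0 = (k - b) / 2" for b
    unfolding kernel_weight_def k_def by (simp_all add: field_simps)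
  have "cert_fun 1 = (k + 3/10) / 2 * (poly cert_num t / poly cert_poly t)"
    by (simp add: cert_fun_def w t_def)
  moreover have "-426051/881927 \<le> poly cert_num t / poly cert_poly t"
  proof -
    have "-426051/881927 * poly cert_poly t \<le> poly cert_num t" using n1 v1 by linarith
    then show ?thesis using v1 by (subst pos_le_divide_eq) auto
  qed
  then have "(k + 3/10) / 2 * (-426051/881927) \<le> (k + 3/10) / 2 * (poly cert_num t / poly cert_poly t)"
    using k by (intro mult_left_mono) auto
  moreover have "cert_fun 0 = (k - 3/10) / 2 * (poly cert_num (- t) / poly cert_poly (- t))"
    by (simp add: cert_fun_def w t_def)
  moreover have "poly cert_num (- t) / poly cert_poly (- t) \<le> 465992/882228"
  proof -
    have "poly cert_num (- t) \<le> 465992/882228 * poly cert_poly (- t)" using n0 v0 by linarith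
    then show ?thesis using v0 by (subst pos_divide_le_eq) auto
  qed
  then have "(k - 3/10) / 2 * (poly cert_num (- t) / poly cert_poly (- t)) \<le> (k - 3/10) / 2 * (465992/882228)"
    using k by (intro mult_left_mono) auto
  ultimately have "(k + 3/10) / 2 * (-426051/881927) - (k - 3/10) / 2 * (465992/882228) \<le> cert_fun 1 - cert_fun 0"
    by linarith
  moreover have "-10875/10000 \<le> (k + 3/10) / 2 * (-426051/881927) - (k - 3/10) / 2 * (465992/882228)"
    using k by (simp add: field_simps)
  ultimately have "-10875/10000 \<le> cert_fun 1 - cert_fun 0"
    by linarith
  also have "\<dots> = cert_fun 1 * (u 1)\<^sup>2 - cert_fun 0 * (u 0)\<^sup>2" using u by simp
  also have "\<dots> \<le> rod_form (-10001/10000) (3/10) u g"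
    by (rule cert_fun_bound[OF u(1)]) simp
  finally show "-10875/10000 \<le> rod_form (-10001/10000) (3/10) u g" .
qed

section \<open>The limit constant\<close>

text \<open>Evenness transfers the certified bound to b = -3/10, concavity in b spreads it over the
  interval between, and monotonicity in a extends it to larger a.\<close>

lemma rod_lower_near:
  assumes "-10001/10000 \<le> a" "\<bar>b\<bar> \<le> 3/10"
  shows "rod_lower a b (-10875/10000)"
proof -
  define t where "t = (b + 3/10) / (3/5)"
  have t: "0 \<le> t" "t \<le> 1" using assms by (auto simp: t_def field_simps)
  have "rod_lower (-10001/10000) ((1 - t) * (- (3/10)) + t * (3/10)) ((1 - t) * (-10875/10000) + t * (-10875/10000))"
    by (intro rod_lower_convex_right rod_lower_reflect rod_lower_cert t)
  moreover have "(1 - t) * (- (3/10)) + t * (3/10) = b" by (simp add: t_def field_simps)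
  moreover have "(1 - t) * (-10875/10000) + t * (-10875/10000) = (-10875/10000 :: real)" by (simp add: field_simps)
  ultimately have "rod_lower (-10001/10000) b (-10875/10000)" by simp
  then show ?thesis using assms by (rule_tac rod_lower_mono) auto
qed

text \<open>
  Past an admissible \<open>b\<close> the concave function \<open>I(-1, \<cdot>)\<close> decreases more slowly than \<open>b\<^sup>2\<close> grows,
  because it stays above \<open>-1.0875\<close> up to \<open>3/10\<close>.
\<close>

lemma rod_lower_strict:
  assumes b: "29401/100000 \<le> b" "b < b'" "b' \<le> 2959/10000 + 1/100000" and adm: "rod_lower (-1) b (-1 - b\<^sup>2)"
  shows "\<exists>d>0. rod_lower (-1) b' (-1 - b'\<^sup>2 + d)"
proof -
  \<comment> \<open>The position of b' on the chord from b to 3/10; d is the slack that this chord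
    leaves at b'.\<close>
  define t where "t = (b' - b) / (3/10 - b)"
  have den: "3/10 - b > 4/1000" using b by simp
  have t: "0 \<le> t" "t \<le> 1" using b den by (auto simp: t_def divide_simps)
  have tb: "t * (3/10 - b) = b' - b" using den by (simp add: t_def)
  define d where "d = (1 - t) * (-1 - b\<^sup>2) + t * (-10875/10000) - (-1 - b'\<^sup>2)"
  have "rod_lower (-1) ((1 - t) * b + t * (3/10)) ((1 - t) * (-1 - b\<^sup>2) + t * (-10875/10000))"
    by (intro rod_lower_convex_right adm rod_lower_near t) auto
  moreover have "(1 - t) * b + t * (3/10) = b'" using tb by (simp add: algebra_simps)
  ultimately have "rod_lower (-1) b' (-1 - b'\<^sup>2 + d)" by (simp add: d_def)
  moreover have "d > 0"
  proof -
    \<comment> \<open>Since 0.29401^2 > 0.0864, the chord falls by at most 0.0011 over a length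
      above 0.004, a slope of at most 11/40, whereas b^2 grows at rate b + b' > 1/2.\<close>
    have "b * b \<ge> 29401/100000 * (29401/100000)" using b by (intro mult_mono) auto
    then have "t * (875/10000 - b\<^sup>2) \<le> t * (11/10000)"
      using t by (intro mult_left_mono) (auto simp: power2_eq_square)
    moreover have "t * (4/1000) \<le> t * (3/10 - b)" using t den by (intro mult_left_mono) auto
    then have "t * (11/10000) \<le> 11/40 * (b' - b)" using tb by simp
    ultimately have 1: "t * (875/10000 - b\<^sup>2) \<le> 11/40 * (b' - b)" by (rule order.trans)
    have 2: "(b' - b) * (1/2) < (b' - b) * (b' + b)" using b by (intro mult_strict_left_mono) auto
    have 3: "d = (b' - b) * (b' + b) - t * (875/10000 - b\<^sup>2)"
      by (simp add: d_def power2_eq_square algebra_simps)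
    have 4: "0 < x - y" if "z * (1/2) < x" "y \<le> 11/40 * z" "0 < z" for x y z :: real
      using that by linarith
    show ?thesis unfolding 3 by (rule 4[OF 2 1]) (use b in simp)
  qed
  ultimately show ?thesis by blast
qed

text \<open>For a >= -1 monotonicity and the slack d suffice as long as a < -1 + d. For a < -1, the
  case of negative gamma, concavity in a bounds I below by the chord from -1.0001 to -1; f is the
  height of this chord above -1 - b^2, and it is positive near a = -1 by continuity.\<close>

lemma rod_lower_eventually:
  assumes "0 < d" "rod_lower (-1) b (-1 - b\<^sup>2 + d)" "\<bar>b\<bar> \<le> 3/10"
  shows "\<forall>\<^sub>F a in nhds (-1). rod_lower a b (a - b\<^sup>2)"
proof -
  define f where "f = (\<lambda>a. let t = 10000 * (-1 - a) in
     (1 - t) * (-1 - b\<^sup>2 + d) + t * (-10875/10000) - (-1 - b\<^sup>2))"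
  have "(f \<longlongrightarrow> f (-1)) (nhds (-1))"
    unfolding f_def Let_def by (intro tendsto_intros filterlim_ident)
  moreover have "f (-1) > 0" using assms(1) by (simp add: f_def)
  ultimately have "\<forall>\<^sub>F a in nhds (-1). 0 < f a" by (rule order_tendstoD)
  moreover have "\<forall>\<^sub>F a in nhds (-1). a \<in> {-10001/10000<..<-1+d}"
    using assms(1) by (intro eventually_nhds_in_open) auto
  ultimately show ?thesis
  proof eventually_elim
    case (elim a)
    show ?case
    proof (cases "-1 \<le> a")
      case True
      with assms elim show ?thesis by (intro rod_lower_mono[OF assms(2)]) auto
    next
      case False
      define t where "t = 10000 * (-1 - a)"
      have t: "0 \<le> t" "t \<le> 1" using False elim by (auto simp: t_def)
      have "rod_lower ((1 - t) * (-1) + t * (-10001/10000)) b ((1 - t) * (-1 - b\<^sup>2 + d) + t * (-10875/10000))"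
        using assms by (intro rod_lower_convex_left rod_lower_near t) auto
      moreover have "(1 - t) * (-1) + t * (-10001/10000) = a" by (simp add: t_def field_simps)
      moreover have "a - b\<^sup>2 \<le> (1 - t) * (-1 - b\<^sup>2 + d) + t * (-10875/10000)"
        using elim(1) False by (simp add: f_def t_def Let_def)
      ultimately show ?thesis using assms by (auto intro: rod_lower_mono)
    qed
  qed
qed

text \<open>Failure of the bound is witnessed by a single test function and is thus an open
  condition on (a, b). Compactness of [0, c] makes the neighbourhood of -1 uniform in b, by the tube
  lemma.\<close>

lemma not_rod_lower_eventually:
  assumes "\<And>b. 0 \<le> b \<Longrightarrow> b \<le> c \<Longrightarrow> \<not> rod_lower (-1) b (-1 - b\<^sup>2)"
  shows "\<forall>\<^sub>F a in nhds (-1). \<forall>b\<in>{0..c}. \<not> rod_lower a b (a - b\<^sup>2)"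
proof -
  define adm where "adm = {(u, g). H1_with_derivative u g \<and> u 0 = 1 \<and> u 1 = 1}"
  define W where "W = (\<Union>(u, g)\<in>adm. {x. rod_form (fst x) (snd x) u g < fst x - (snd x)\<^sup>2})"
  have W: "x \<in> W \<longleftrightarrow> \<not> rod_lower (fst x) (snd x) (fst x - (snd x)\<^sup>2)" for x
    unfolding W_def adm_def rod_lower_def by (auto simp: not_le)
  have "open W" unfolding W_def
  proof (intro open_UN ballI, clarify)
    fix u g assume "(u, g) \<in> adm"
    then obtain p q r s where eq: "\<And>a b. rod_form a b u g = p + a * q + b * r + a * b * s"
      using rod_form_bilinear[of u g] unfolding adm_def by blast
    show "open {x. rod_form (fst x) (snd x) u g < fst x - (snd x)\<^sup>2}"
      unfolding eq by (intro open_Collect_less continuous_intros)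
  qed
  moreover have "{-1} \<times> {0..c} \<subseteq> W" using assms by (auto simp: W)
  ultimately obtain X where X: "-1 \<in> X" "open X" "X \<times> {0..c} \<subseteq> W"
    using Elementary_Topology.tube_lemma[of "{0..c}" W "-1"] by auto
  then show ?thesis
    unfolding eventually_nhds by (intro exI[of _ X]) (auto simp: W subset_iff)
qed

text \<open>The filter is arbitrary so that gamma -> +infinity and gamma -> -infinity are covered
  together. The last conclusion, one b above B that works for all a near -1, yields the upper half
  of the limit and is also what the blow-up argument consumes.\<close>

lemma rod_beta_limit:
  obtains B :: real where "\<bar>B - 295/1000\<bar> < 1/1000"
    "\<And>F. filterlim (\<lambda>g. (3 - g) / g) (nhds (-1)) F \<Longrightarrow> (rod_beta \<longlongrightarrow> ereal B) F"
    "\<And>c. B < c \<Longrightarrow> \<exists>b. B < b \<and> b < c \<and> b \<le> 3/10 \<and> (\<forall>\<^sub>F a in nhds (-1). rod_lower a b (a - b\<^sup>2))"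
proof -
  define B where "B = Inf (rod_admissible (-1))"
  have bdd: "bdd_below (rod_admissible (-1))" by (intro bdd_belowI[of _ 0]) (auto simp: rod_admissible_def)
  \<comment> \<open>0.2959^2 = 0.08755... exceeds 0.0875, so the certified bound -1.0875 is
    enough.\<close>
  have "rod_lower (-1) (2959/10000) (-1 - (2959/10000)\<^sup>2)"
    by (rule rod_lower_mono[OF rod_lower_near[of "-1"]]) (auto simp: power2_eq_square)
  then have mem: "2959/10000 \<in> rod_admissible (-1)" by (simp add: rod_admissible_def)
  have low: "29401/100000 \<le> b" if "b \<in> rod_admissible (-1)" for b
    using that not_rod_lower_test[of b] by (force simp: rod_admissible_def)
  have B: "29401/100000 \<le> B" "B \<le> 2959/10000"
    unfolding B_def using mem by (intro cInf_greatest low; blast) (rule cInf_lower[OF mem bdd])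
  have notadm: "\<not> rod_lower (-1) b (-1 - b\<^sup>2)" if "0 \<le> b" "b < B" for b
    using that cInf_lower[OF _ bdd, of b] by (auto simp: rod_admissible_def B_def)
  have ev: "\<exists>b. B < b \<and> b < c \<and> b \<le> 3/10 \<and> (\<forall>\<^sub>F a in nhds (-1). rod_lower a b (a - b\<^sup>2))" if c: "B < c" for c
  proof -
    \<comment> \<open>Being above the infimum, b' has an admissible point below it, and
      \<open>rod_lower_strict\<close> then gives slack at b' itself. The cap 1/100000 keeps b'
      inside the range of that lemma.\<close>
    define b' where "b' = min ((B + c) / 2) (B + 1/100000)"
    have b': "B < b'" "b' < c" "b' \<le> 2959/10000 + 1/100000" using c B by (auto simp: b'_def min_def)
    obtain b where b: "b \<in> rod_admissible (-1)" "b < b'"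
      using b' mem unfolding B_def by (metis cInf_lessD empty_iff)
    then obtain d where "d > 0" "rod_lower (-1) b' (-1 - b'\<^sup>2 + d)"
      using rod_lower_strict[OF low[OF b(1)] b(2) b'(3)] by (auto simp: rod_admissible_def)
    then have "\<forall>\<^sub>F a in nhds (-1). rod_lower a b' (a - b'\<^sup>2)"
      using B b' by (intro rod_lower_eventually) auto
    with b' show ?thesis by (intro exI[of _ b']) auto
  qed
  show ?thesis
  proof
    show "\<bar>B - 295/1000\<bar> < 1/1000" using B by (simp add: abs_if)
    show "\<exists>b. B < b \<and> b < c \<and> b \<le> 3/10 \<and> (\<forall>\<^sub>F a in nhds (-1). rod_lower a b (a - b\<^sup>2))" if "B < c" for c
      using that by (rule ev)
    fix F assume lim: "filterlim (\<lambda>g :: real. (3 - g) / g) (nhds (-1)) F"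
    show "(rod_beta \<longlongrightarrow> ereal B) F"
    proof (rule order_tendstoI)
      fix y assume "ereal B < y"
      then obtain c where c: "B < c" "ereal c < y"
        using ereal_dense2[of "ereal B" y] by auto
      from ev[OF c(1)] obtain b where b: "B < b" "b < c" "\<forall>\<^sub>F a in nhds (-1). rod_lower a b (a - b\<^sup>2)" by blast
      have "\<forall>\<^sub>F g in F. rod_lower ((3 - g) / g) b ((3 - g) / g - b\<^sup>2)"
        using filterlim_iff[THEN iffD1, OF lim] b(3) by blast
      then show "\<forall>\<^sub>F g in F. rod_beta g < y"
      proof eventually_elim
        case (elim g)
        then have "rod_beta g \<le> ereal b"
          unfolding rod_beta_eq using b B by (intro Inf_lower) (auto simp: rod_admissible_def)
        also have "\<dots> < y" using b c by (meson ereal_less(2) less_ereal.simps(1) less_trans)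
        finally show ?case .
      qed
    next
      fix y assume "y < ereal B"
      then obtain c where c: "y < ereal c" "c < B"
        using ereal_dense2[of y "ereal B"] by auto
      have "\<forall>\<^sub>F a in nhds (-1). \<forall>b\<in>{0..c}. \<not> rod_lower a b (a - b\<^sup>2)"
        using c notadm by (intro not_rod_lower_eventually) auto
      then have "\<forall>\<^sub>F g in F. \<forall>b\<in>{0..c}. \<not> rod_lower ((3 - g) / g) b ((3 - g) / g - b\<^sup>2)"
        using filterlim_iff[THEN iffD1, OF lim] by blast
      then show "\<forall>\<^sub>F g in F. y < rod_beta g"
      proof eventually_elim
        case (elim g)
        note c(1)
        also have "ereal c \<le> rod_beta g"
          unfolding rod_beta_eq
        proof (intro Inf_greatest, clarify)
          fix b assume "b \<in> rod_admissible ((3 - g) / g)"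
          with elim show "ereal c \<le> ereal b" by (force simp: rod_admissible_def)
        qed
        finally show ?case .
      qed
    qed
  qed
qed

section \<open>Fourier series and Sobolev embedding\<close>

definition trig :: "int \<Rightarrow> real \<Rightarrow> complex" where
  "trig n x = cis (2 * pi * real_of_int n * x)"

lemma norm_trig [simp]: "cmod (trig n x) = 1"
  by (simp add: trig_def)

lemma trig_mult: "trig m x * trig n x = trig (m + n) x"
  by (simp add: trig_def cis_mult algebra_simps)

lemma trig_0 [simp]: "trig 0 x = 1" and trig_at_0 [simp]: "trig n 0 = 1"
  by (simp_all add: trig_def)

lemma trig_at_1 [simp]: "trig n 1 = 1"
  using cis_multiple_2pi[of "real_of_int n"] by (simp add: trig_def mult.commute mult.left_commute)

lemma continuous_on_trig [continuous_intros]: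
  "continuous_on S f \<Longrightarrow> continuous_on S (\<lambda>x. trig n (f x))"
  unfolding trig_def by (intro continuous_intros)

lemma trig_has_vector_derivative:
  "(trig n has_vector_derivative 2 * pi * \<i> * of_int n * trig n x) (at x within S)"
proof -
  have "((\<lambda>z. exp (\<i> * (2 * pi * of_int n * z))) has_field_derivative
     2 * pi * \<i> * of_int n * exp (\<i> * (2 * pi * of_int n * of_real x))) (at (of_real x))"
    by (rule derivative_eq_intros refl | simp)+
  from has_vector_derivative_real_field[OF this]
  show ?thesis by (simp add: trig_def[abs_def] cis_conv_exp)
qed

lemma trig_antiderivative:
  assumes "p \<le> q"
  shows "((\<lambda>x. 2 * pi * \<i> * of_int n * trig n x) has_integral trig n q - trig n p) {p..q}"
  using assms by (intro fundamental_theorem_of_calculus trig_has_vector_derivative)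

lemma integral_trig: "integral {0..1} (trig n) = (if n = 0 then 1 else 0)"
proof (cases "n = 0")
  case True
  then have "trig n = (\<lambda>x. 1)" by (simp add: fun_eq_iff)
  with True show ?thesis by simp
next
  case False
  have "((\<lambda>x. 2 * pi * \<i> * of_int n * trig n x) has_integral 0) {0..1}"
    using trig_antiderivative[of 0 1 n] by simp
  then have "((\<lambda>x. 1 / (2 * pi * \<i> * of_int n) * (2 * pi * \<i> * of_int n * trig n x))
     has_integral 1 / (2 * pi * \<i> * of_int n) * 0) {0..1}"
    by (rule has_integral_mult_right)
  moreover have "(\<lambda>x. 1 / (2 * pi * \<i> * of_int n) * (2 * pi * \<i> * of_int n * trig n x)) = trig n"
    using False by (simp add: fun_eq_iff)
  ultimately have "(trig n has_integral 0) {0..1}" by simp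
  with False show ?thesis by (simp add: integral_unique)
qed

lemma fourier_coeff_integral:
  assumes "continuous_on UNIV f"
  shows "fourier_coeff f n = integral {0..1} (\<lambda>x. of_real (f x) * trig (- n) x)"
proof -
  have "fourier_coeff f n = (LBINT x:{0..1}. of_real (f x) * trig (- n) x)"
    by (simp add: fourier_coeff_def trig_def)
  also have "\<dots> = integral {0..1} (\<lambda>x. of_real (f x) * trig (- n) x)"
    by (intro set_borel_integral_eq_integral borel_integrable_atLeastAtMost' continuous_intros
        continuous_on_subset[OF assms]) auto
  finally show ?thesis .
qed

text \<open>
  A function on the circle with continuous lift is continuous, because the compact interval covers
  the circle by a closed map; Stone--Weierstrass then applies on the circle.
\<close>

lemma circle_polynomial_approximation:
  fixes f :: "real \<Rightarrow> real"
  assumes f: "continuous_on {0..1} f" "f 0 = f 1" and e: "0 < e"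
  obtains g :: "complex \<Rightarrow> real" where "real_polynomial_function g"
    "\<And>x. x \<in> {0..1} \<Longrightarrow> \<bar>f x - g (trig 1 x)\<bar> < e"
proof -
  define k where "k = (\<lambda>z. f (Arg2pi z / (2 * pi)))"
  have k: "k (trig 1 x) = f x" if "x \<in> {0..1}" for x
  proof (cases "x = 1")
    case True
    moreover have "Arg2pi 1 = 0" by (rule Arg2pi_unique[of 1]) auto
    ultimately show ?thesis using f(2) by (simp add: k_def)
  next
    case False
    have "Arg2pi (trig 1 x) = 2 * pi * x"
      using False that by (intro Arg2pi_unique[of 1]) (auto simp: trig_def cis_conv_exp)
    then show ?thesis by (simp add: k_def)
  qed
  have surj: "\<exists>x\<in>{0..1}. z = trig 1 x" if "cmod z = 1" for z
  proof (intro bexI[of _ "Arg2pi z / (2 * pi)"])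
    show "z = trig 1 (Arg2pi z / (2 * pi))"
      using Arg2pi_eq[of z] that by (simp add: trig_def cis_conv_exp)
    show "Arg2pi z / (2 * pi) \<in> {0..1}"
      using Arg2pi_ge_0[of z] Arg2pi_lt_2pi[of z] by (simp add: field_simps)
  qed
  have "continuous_on (sphere 0 1) k"
    unfolding continuous_on_closed_invariant
  proof (intro allI impI)
    fix B :: "real set" assume "closed B"
    define A where "A = trig 1 ` ({0..1} \<inter> f -` B)"
    have "closed ({0..1} \<inter> f -` B)"
      using f(1) \<open>closed B\<close> by (intro continuous_closed_preimage) auto
    then have "compact ({0..1} \<inter> f -` B)"
      using compact_Int_closed[of "{0..1::real}" "{0..1} \<inter> f -` B"] by (simp add: Int_assoc[symmetric])
    then have "compact A" unfolding A_def by (intro compact_continuous_image continuous_intros)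
    then have "closed A" by (rule compact_imp_closed)
    moreover have "A \<inter> sphere 0 1 = k -` B \<inter> sphere 0 1"
    proof (intro equalityI subsetI)
      fix z assume "z \<in> A \<inter> sphere 0 1"
      then show "z \<in> k -` B \<inter> sphere 0 1" using k unfolding A_def by auto
    next
      fix z assume z: "z \<in> k -` B \<inter> sphere 0 1"
      then obtain x where "x \<in> {0..1}" "z = trig 1 x" using surj[of z] by auto
      with z k show "z \<in> A \<inter> sphere 0 1" unfolding A_def by auto
    qed
    ultimately show "\<exists>A. closed A \<and> A \<inter> sphere 0 1 = k -` B \<inter> sphere 0 1" by blast
  qed
  then obtain g where g: "real_polynomial_function g" "\<And>z. z \<in> sphere 0 1 \<Longrightarrow> \<bar>k z - g z\<bar> < e"
    using Stone_Weierstrass_real_polynomial_function[of "sphere 0 1" k e] e by auto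
  show ?thesis
  proof (rule that[OF g(1)])
    fix x :: real assume "x \<in> {0..1}"
    with k g(2)[of "trig 1 x"] show "\<bar>f x - g (trig 1 x)\<bar> < e" by simp
  qed
qed

lemma continuous_on_polynomial_trig:
  assumes "real_polynomial_function g" shows "continuous_on S (\<lambda>x. g (trig 1 x))"
proof -
  have "polynomial_function g" using assms by (simp add: real_polynomial_function_eq)
  then have "continuous_on UNIV g" by (rule continuous_on_polymonial_function)
  then show ?thesis by (rule continuous_on_compose2) (auto intro!: continuous_intros)
qed

text \<open>A real linear functional of the circle point is a combination of \<open>trig 1\<close>
  and \<open>trig (-1)\<close>, and multiplying by these only shifts the frequency m. The induction
  keeps h arbitrary, so that a product is absorbed into h one factor at a time.\<close>

lemma trig_orthogonal_polynomial:
  assumes "real_polynomial_function g" "continuous_on {0..1} h"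
    and "\<And>m. integral {0..1} (\<lambda>x. h x * trig m x) = 0"
  shows "integral {0..1} (\<lambda>x. (h x * of_real (g (trig 1 x))) * trig m x) = 0"
  using assms
proof (induction arbitrary: h m rule: real_polynomial_function.induct)
  case (linear g)
  have int: "(\<lambda>x. h x * trig m x) integrable_on {0..1}" for m
    using linear.prems by (intro integrable_continuous_real continuous_intros)
  define a b where "a = g 1" and "b = g \<i>"
  have g: "g (trig 1 x) = a * cos (2 * pi * x) + b * sin (2 * pi * x)" for x
  proof -
    have "trig 1 x = cos (2 * pi * x) *\<^sub>R 1 + sin (2 * pi * x) *\<^sub>R \<i>"
      by (simp add: trig_def complex_eq_iff)
    then show ?thesis
      using linear.hyps by (simp add: a_def b_def linear_simps)
  qed
  have c: "of_real (g (trig 1 x)) = (a - \<i> * b) / 2 * trig 1 x + (a + \<i> * b) / 2 * trig (-1) x" for x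
    unfolding g by (simp add: trig_def complex_eq_iff add_divide_distrib[symmetric])
  have "(\<lambda>x. (h x * of_real (g (trig 1 x))) * trig m x)
    = (\<lambda>x. (a - \<i> * b) / 2 * (h x * trig (m + 1) x) + (a + \<i> * b) / 2 * (h x * trig (m - 1) x))"
  proof
    fix x
    have t: "trig (m + 1) x = trig 1 x * trig m x" "trig (m - 1) x = trig (-1) x * trig m x"
      by (simp_all add: trig_mult add.commute)
    show "(h x * of_real (g (trig 1 x))) * trig m x
      = (a - \<i> * b) / 2 * (h x * trig (m + 1) x) + (a + \<i> * b) / 2 * (h x * trig (m - 1) x)"
      unfolding c t by (simp add: algebra_simps)
  qed
  moreover have "((\<lambda>x. (a - \<i> * b) / 2 * (h x * trig (m + 1) x) + (a + \<i> * b) / 2 * (h x * trig (m - 1) x))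
      has_integral (a - \<i> * b) / 2 * 0 + (a + \<i> * b) / 2 * 0) {0..1}"
    using linear.prems(2)[of "m + 1"] linear.prems(2)[of "m - 1"] int[of "m + 1"] int[of "m - 1"]
    by (intro has_integral_add has_integral_mult_right) (metis integrable_integral)+
  ultimately show ?case by (simp add: integral_unique)
next
  case (const c)
  have "(\<lambda>x. (h x * of_real c) * trig m x) = (\<lambda>x. of_real c * (h x * trig m x))" by (simp add: algebra_simps)
  then show ?case using const by simp
next
  case (add g1 g2)
  have "integral {0..1} (\<lambda>x. (h x * of_real (g1 (trig 1 x))) * trig m x + (h x * of_real (g2 (trig 1 x))) * trig m x) = 0 + 0"
    using add by (subst Henstock_Kurzweil_Integration.integral_add)
      (auto intro!: integrable_continuous_real continuous_intros continuous_on_polynomial_trig)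
  then show ?case by (simp add: algebra_simps)
next
  case (mult g1 g2)
  have "integral {0..1} (\<lambda>x. ((h x * of_real (g1 (trig 1 x))) * of_real (g2 (trig 1 x))) * trig m x) = 0"
    by (intro mult.IH(2) mult.IH(1) mult.prems continuous_intros continuous_on_polynomial_trig mult.hyps)
  then show ?case by (simp add: algebra_simps)
qed

text \<open>Let r = Re h and let g approximate r uniformly up to e. The integral of r g vanishes, so
  that of r^2 equals that of r (r - g), at most e times the integral of |r|. Hence r = 0; the
  imaginary part is Re (-i h).\<close>

lemma trig_orthogonal_zero:
  fixes h :: "real \<Rightarrow> complex"
  assumes h: "continuous_on {0..1} h" "h 0 = h 1"
    and 0: "\<And>m. integral {0..1} (\<lambda>x. h x * trig m x) = 0" and x: "x \<in> {0..1}"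
  shows "h x = 0"
proof -
  have Re_zero: "Re (h x) = 0"
    if h: "continuous_on {0..1} h" "h 0 = h 1" and 0: "\<And>m. integral {0..1} (\<lambda>x. h x * trig m x) = 0"
      and x: "x \<in> {0..1}" for h :: "real \<Rightarrow> complex" and x
  proof -
    define r where "r = (\<lambda>x. Re (h x))"
    have r: "continuous_on {0..1} r" unfolding r_def using h by (intro continuous_intros)
    have ri: "(\<lambda>x. (r x)\<^sup>2) integrable_on {0..1}" "(\<lambda>x. \<bar>r x\<bar>) integrable_on {0..1}"
      using r by (auto intro!: integrable_continuous_real continuous_intros)
    have "integral {0..1} (\<lambda>x. (r x)\<^sup>2) \<le> 0"
    proof (rule field_le_epsilon)
      fix d :: real assume "d > 0"
      define M where "M = integral {0..1} (\<lambda>x. \<bar>r x\<bar>) + 1"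
      have M: "M > 0" unfolding M_def using integral_nonneg[OF ri(2)] by simp
      define e where "e = d / M"
      have "e > 0" using M \<open>d > 0\<close> by (simp add: e_def)
      obtain g where g: "real_polynomial_function g" "\<And>x. x \<in> {0..1} \<Longrightarrow> \<bar>r x - g (trig 1 x)\<bar> < e"
        using circle_polynomial_approximation[OF r _ \<open>e > 0\<close>] h(2) by (auto simp: r_def)
      have cg: "continuous_on {0..1} (\<lambda>x. g (trig 1 x))"
        using g(1) by (rule continuous_on_polynomial_trig)
      have "integral {0..1} (\<lambda>x. h x * of_real (g (trig 1 x))) = 0"
        using trig_orthogonal_polynomial[OF g(1) h(1) 0, of 0] by simp
      moreover have "(\<lambda>x. h x * of_real (g (trig 1 x))) integrable_on {0..1}"
        using h cg by (intro integrable_continuous_real continuous_intros)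
      ultimately have "((\<lambda>x. h x * of_real (g (trig 1 x))) has_integral 0) {0..1}"
        using integrable_integral by fastforce
      from has_integral_Re[OF this] have rg: "((\<lambda>x. r x * g (trig 1 x)) has_integral 0) {0..1}"
        by (simp add: r_def)
      have "((\<lambda>x. (r x)\<^sup>2 - r x * g (trig 1 x)) has_integral integral {0..1} (\<lambda>x. (r x)\<^sup>2) - 0) {0..1}"
        by (intro has_integral_diff rg integrable_integral ri)
      moreover have "((\<lambda>x. e * \<bar>r x\<bar>) has_integral e * integral {0..1} (\<lambda>x. \<bar>r x\<bar>)) {0..1}"
        by (intro has_integral_mult_right integrable_integral ri)
      ultimately have "integral {0..1} (\<lambda>x. (r x)\<^sup>2) - 0 \<le> e * integral {0..1} (\<lambda>x. \<bar>r x\<bar>)"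
      proof (rule has_integral_le)
        fix x :: real assume "x \<in> {0..1}"
        then have "\<bar>r x - g (trig 1 x)\<bar> * \<bar>r x\<bar> \<le> e * \<bar>r x\<bar>"
          using g(2) by (intro mult_right_mono) (auto intro: less_imp_le)
        moreover have "(r x)\<^sup>2 - r x * g (trig 1 x) \<le> \<bar>r x - g (trig 1 x)\<bar> * \<bar>r x\<bar>"
          unfolding abs_mult[symmetric] by (rule order.trans[OF _ abs_ge_self]) (simp add: power2_eq_square algebra_simps)
        ultimately show "(r x)\<^sup>2 - r x * g (trig 1 x) \<le> e * \<bar>r x\<bar>" by linarith
      qed
      also have "\<dots> \<le> e * M" using \<open>e > 0\<close> by (simp add: M_def)
      also have "\<dots> = d" using M by (simp add: e_def)
      finally show "integral {0..1} (\<lambda>x. (r x)\<^sup>2) \<le> 0 + d" by simp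
    qed
    with integral_nonneg[OF ri(1)] have "integral {0..1} (\<lambda>x. (r x)\<^sup>2) = 0" by simp
    moreover have "continuous_on {0..1} (\<lambda>x. (r x)\<^sup>2)" using r by (intro continuous_intros)
    ultimately have "(r x)\<^sup>2 = 0"
      using integral_eq_0_iff[of 0 1 "\<lambda>x. (r x)\<^sup>2"] x by auto
    then show ?thesis by (simp add: r_def)
  qed
  have "Re (h x) = 0" by (rule Re_zero[OF h 0 x])
  moreover have "Re (- \<i> * h x) = 0"
  proof (rule Re_zero[OF _ _ _ x])
    show "integral {0..1} (\<lambda>x. - \<i> * h x * trig m x) = 0" for m
      using 0[of m] by (simp add: mult.assoc)
  qed (use h in \<open>auto intro!: continuous_intros\<close>)
  ultimately show ?thesis by (simp add: complex_eq_iff)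
qed

section \<open>Absolutely convergent trigonometric series\<close>

definition trig_series :: "(int \<Rightarrow> complex) \<Rightarrow> real \<Rightarrow> complex" where
  "trig_series a x = (\<Sum>\<^sub>\<infinity>n. a n * trig n x)"

lemma trig_series_uniform_limit:
  assumes "(\<lambda>n. cmod (a n)) summable_on UNIV"
  shows "uniform_limit S (\<lambda>X x. \<Sum>n\<in>X. a n * trig n x) (trig_series a) (finite_subsets_at_top UNIV)"
  unfolding trig_series_def[abs_def]
  by (rule Weierstrass_m_test_general[OF _ assms]) (simp add: norm_mult)

lemma continuous_on_trig_series:
  assumes "(\<lambda>n. cmod (a n)) summable_on UNIV"
  shows "continuous_on S (trig_series a)"
  by (rule uniform_limit_theorem[OF _ trig_series_uniform_limit[OF assms]])
    (auto intro!: always_eventually continuous_intros)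

lemma norm_trig_series_le:
  assumes "(\<lambda>n. cmod (a n)) summable_on UNIV"
  shows "cmod (trig_series a x) \<le> (\<Sum>\<^sub>\<infinity>n. cmod (a n))"
  unfolding trig_series_def using norm_infsum_bound[of "\<lambda>n. a n * trig n x" UNIV] assms
  by (simp add: norm_mult)

lemma trig_series_integral:
  assumes "(\<lambda>n. cmod (a n)) summable_on UNIV"
  shows "((\<lambda>n. a n * integral {p..q} (\<lambda>x. trig n x * trig m x)) has_sum
    integral {p..q} (\<lambda>x. trig_series a x * trig m x)) UNIV"
proof -
  have "bounded (trig_series a ` {p..q})"
    by (intro compact_imp_bounded compact_continuous_image continuous_on_trig_series assms) auto
  moreover have "bounded (trig m ` {p..q})"
    by (intro boundedI[of _ 1]) auto
  ultimately have u: "uniform_limit {p..q} (\<lambda>X x. (\<Sum>n\<in>X. a n * trig n x) * trig m x)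
     (\<lambda>x. trig_series a x * trig m x) (finite_subsets_at_top UNIV)"
    by (intro uniform_lim_mult trig_series_uniform_limit assms uniform_limit_const)
  have c: "continuous_on {p..q} (\<lambda>x. (\<Sum>n\<in>X. a n * trig n x) * trig m x)" for X
    by (intro continuous_intros)
  obtain I J where I: "\<And>X. ((\<lambda>x. (\<Sum>n\<in>X. a n * trig n x) * trig m x) has_integral I X) {p..q}"
    and J: "((\<lambda>x. trig_series a x * trig m x) has_integral J) {p..q}"
    and lim: "(I \<longlongrightarrow> J) (finite_subsets_at_top UNIV)"
    using uniform_limit_integral[OF u c finite_subsets_at_top_neq_bot] by blast
  have "I X = (\<Sum>n\<in>X. a n * integral {p..q} (\<lambda>x. trig n x * trig m x))" if "finite X" for X
  proof (rule has_integral_unique[OF I])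
    have "((\<lambda>x. \<Sum>n\<in>X. a n * (trig n x * trig m x)) has_integral
        (\<Sum>n\<in>X. a n * integral {p..q} (\<lambda>x. trig n x * trig m x))) {p..q}"
      by (intro has_integral_sum that has_integral_mult_right integrable_integral
          integrable_continuous_real continuous_intros)
    then show "((\<lambda>x. (\<Sum>n\<in>X. a n * trig n x) * trig m x) has_integral
        (\<Sum>n\<in>X. a n * integral {p..q} (\<lambda>x. trig n x * trig m x))) {p..q}"
      by (simp add: sum_distrib_right mult.assoc)
  qed
  then have "\<forall>\<^sub>F X in finite_subsets_at_top UNIV. I X = (\<Sum>n\<in>X. a n * integral {p..q} (\<lambda>x. trig n x * trig m x))"
    by (intro eventually_finite_subsets_at_top_weakI) auto
  from Lim_transform_eventually[OF lim this] integral_unique[OF J]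
  show ?thesis by (simp add: has_sum_def)
qed

lemma fourier_coeff_continuous_bound:
  assumes "continuous_on UNIV f"
  shows "(\<lambda>x. of_real (f x) * trig m x) integrable_on {0..1}"
  by (intro integrable_continuous_real continuous_intros continuous_on_subset[OF assms]) auto

text \<open>The series converges uniformly and may be integrated term by term, so f minus its series
  is continuous, periodic and orthogonal to every character, hence zero.\<close>

lemma fourier_inversion:
  assumes f: "continuous_on UNIV f" "\<And>x. f (x + 1) = f x"
    and sum: "(\<lambda>n. cmod (fourier_coeff f n)) summable_on UNIV"
  shows "of_real (f x) = trig_series (fourier_coeff f) x"
proof -
  define S where "S = trig_series (fourier_coeff f)"
  define h where "h = (\<lambda>x. of_real (f x) - S x)"
  have c: "continuous_on {0..1} h" unfolding h_def S_def
    by (intro continuous_intros continuous_on_trig_series sum continuous_on_subset[OF f(1)]) auto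
  have per: "S (x + 1) = S x" for x
  proof -
    have "trig n (x + 1) = trig n x" for n
      using trig_at_1[of n] by (simp add: trig_def distrib_left cis_mult[symmetric])
    then show ?thesis by (simp add: S_def trig_series_def)
  qed
  have h01: "h 0 = h 1" using per[of 0] f(2)[of 0] by (simp add: h_def)
  have 0: "integral {0..1} (\<lambda>x. h x * trig m x) = 0" for m
  proof -
    have i: "integral {0..1} (\<lambda>x. trig n x * trig m x) = (if n = - m then 1 else 0)" for n
      using integral_trig[of "n + m"] by (simp add: trig_mult eq_neg_iff_add_eq_0)
    have "((\<lambda>n. fourier_coeff f n * (if n = - m then 1 else 0)) has_sum fourier_coeff f (- m)) UNIV"
      by (rule has_sum_finite_neutralI[of "{-m}"]) auto
    then have "integral {0..1} (\<lambda>x. S x * trig m x) = fourier_coeff f (- m)"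
      using trig_series_integral[OF sum, of 0 1 m] unfolding i S_def by (rule has_sum_unique[rotated])
    moreover have "integral {0..1} (\<lambda>x. of_real (f x) * trig m x) = fourier_coeff f (- m)"
      by (simp add: fourier_coeff_integral f)
    moreover have "(\<lambda>x. S x * trig m x) integrable_on {0..1}" unfolding S_def
      by (intro integrable_continuous_real continuous_intros continuous_on_trig_series sum)
    ultimately show ?thesis
      using Henstock_Kurzweil_Integration.integral_diff[OF fourier_coeff_continuous_bound[OF f(1), of m]]
      by (simp add: h_def left_diff_distrib)
  qed
  have eq: "h x = 0" if "x \<in> {0..1}" for x
    by (rule trig_orthogonal_zero[OF c h01 0 that])
  interpret f: periodic_fun_simple' f by standard (rule f)
  interpret S: periodic_fun_simple' S by standard (rule per)
  have "f (x - of_int \<lfloor>x\<rfloor>) = f x" "S (x - of_int \<lfloor>x\<rfloor>) = S x"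
    by (simp_all add: f.minus_of_int S.minus_of_int)
  moreover have "x - of_int \<lfloor>x\<rfloor> \<in> {0..1}"
    using floor_correct[of x] by (auto simp: algebra_simps intro: less_imp_le)
  ultimately show ?thesis using eq[of "x - of_int \<lfloor>x\<rfloor>"] by (simp add: h_def S_def)
qed

text \<open>The differentiated series d is continuous, and its termwise integral over [p, q] is f q
  - f p by inversion. The fundamental theorem of calculus then identifies d as the
  derivative.\<close>

lemma fourier_derivative:
  assumes f: "continuous_on UNIV f" "\<And>x. f (x + 1) = f x"
    and sum: "(\<lambda>n. cmod (fourier_coeff f n)) summable_on UNIV"
    and sum': "(\<lambda>n. cmod (2 * pi * \<i> * of_int n * fourier_coeff f n)) summable_on UNIV"
  shows "(f has_real_derivative Re (trig_series (\<lambda>n. 2 * pi * \<i> * of_int n * fourier_coeff f n) x)) (at x)"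
proof -
  define d where "d = trig_series (\<lambda>n. 2 * pi * \<i> * of_int n * fourier_coeff f n)"
  have cd: "continuous_on S d" for S unfolding d_def by (rule continuous_on_trig_series[OF sum'])
  have "integral {p..q} d = of_real (f q) - of_real (f p)" if "p \<le> q" for p q
  proof -
    have s: "((\<lambda>n. fourier_coeff f n * trig n x) has_sum of_real (f x)) UNIV" for x
      unfolding fourier_inversion[OF f sum, of x] trig_series_def
      by (rule has_sum_infsum, rule abs_summable_summable) (simp add: norm_mult sum)
    have "((\<lambda>n. fourier_coeff f n * trig n q - fourier_coeff f n * trig n p) has_sum (of_real (f q) - of_real (f p))) UNIV"
      using has_sum_add[OF s[of q] has_sum_cmult_right[OF s[of p], of "-1"]] by simp
    moreover have J: "2 * pi * \<i> * of_int n * integral {p..q} (trig n) = trig n q - trig n p" for n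
      using integral_unique[OF trig_antiderivative[OF that, of n]] by simp
    have "2 * pi * \<i> * of_int n * fourier_coeff f n * integral {p..q} (trig n)
       = fourier_coeff f n * trig n q - fourier_coeff f n * trig n p" for n
    proof -
      have "2 * pi * \<i> * of_int n * fourier_coeff f n * integral {p..q} (trig n)
        = fourier_coeff f n * (2 * pi * \<i> * of_int n * integral {p..q} (trig n))"
        by (simp only: ac_simps)
      then show ?thesis unfolding J by (simp only: right_diff_distrib)
    qed
    ultimately show ?thesis
      using trig_series_integral[OF sum', of p q 0] unfolding d_def
      by (simp add: has_sum_unique)
  qed
  note int = this
  define a where "a = x - 1"
  have "((\<lambda>y. integral {a..y} d) has_vector_derivative d x) (at x within {a..x + 1})"
    by (rule integral_has_vector_derivative) (auto simp: a_def cd)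
  then have "((\<lambda>y. of_real (f a) + integral {a..y} d) has_vector_derivative d x) (at x within {a..x + 1})"
    by (simp add: has_vector_derivative_add_const add.commute[of "of_real _"])
  then have "((\<lambda>y. of_real (f y)) has_vector_derivative d x) (at x within {a..x + 1})"
    by (rule has_vector_derivative_transform[rotated 2]) (auto simp: a_def int)
  then have "((\<lambda>y. of_real (f y) :: complex) has_vector_derivative d x) (at x)"
    by (subst (asm) at_within_Icc_at) (auto simp: a_def)
  from bounded_linear.has_vector_derivative[OF bounded_linear_Re this] show ?thesis
    by (simp add: has_real_derivative_iff_has_vector_derivative d_def)
qed

section \<open>Sobolev weights and embeddings\<close>

lemma sobolev_weight_pos: "sobolev_weight s n > 0"
proof -
  have "1 + (2 * pi * real_of_int n)\<^sup>2 > 0" by (rule add_pos_nonneg) auto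
  then show ?thesis by (simp add: sobolev_weight_def)
qed

lemma sobolev_weight_mono: "s \<le> t \<Longrightarrow> sobolev_weight s n \<le> sobolev_weight t n"
  unfolding sobolev_weight_def by (rule powr_mono) auto

lemma sobolev_weight_diff_1: "sobolev_weight s n = sobolev_weight (s - 1) n * (1 + (2 * pi * real_of_int n)\<^sup>2)"
proof -
  have "1 + (2 * pi * real_of_int n)\<^sup>2 > 0" by (rule add_pos_nonneg) auto
  then show ?thesis by (simp add: sobolev_weight_def powr_diff)
qed

lemma summable_inverse_sobolev_weight:
  assumes r: "r > 1/2"
  shows "(\<lambda>n. 1 / sobolev_weight r n) summable_on UNIV"
proof -
  have bound: "1 / sobolev_weight r n \<le> real (nat \<bar>n\<bar>) powr (- (2 * r))" if "n \<noteq> 0" for n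
  proof -
    have n: "real (nat \<bar>n\<bar>) = \<bar>real_of_int n\<bar>" "\<bar>real_of_int n\<bar> > 0" using that by auto
    have "(real_of_int n)\<^sup>2 * 1 \<le> (real_of_int n)\<^sup>2 * (2 * pi)\<^sup>2"
      using pi_ge_two by (intro mult_left_mono one_le_power) auto
    moreover have "\<bar>real_of_int n\<bar> powr 2 = (real_of_int n)\<^sup>2"
      using n by (simp add: powr_numeral)
    moreover have "(2 * pi * real_of_int n)\<^sup>2 = (real_of_int n)\<^sup>2 * (2 * pi)\<^sup>2"
      by (simp only: power_mult_distrib mult.commute)
    ultimately have "\<bar>real_of_int n\<bar> powr 2 \<le> 1 + (2 * pi * real_of_int n)\<^sup>2" by linarith
    then have "(\<bar>real_of_int n\<bar> powr 2) powr r \<le> sobolev_weight r n"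
      unfolding sobolev_weight_def using r by (intro powr_mono2) auto
    then have "\<bar>real_of_int n\<bar> powr (2 * r) \<le> sobolev_weight r n" by (simp only: powr_powr)
    moreover have "\<bar>real_of_int n\<bar> powr (2 * r) > 0" using n by simp
    ultimately show ?thesis
      unfolding n powr_minus inverse_eq_divide by (intro divide_left_mono) (auto simp: sobolev_weight_pos)
  qed
  have s: "(\<lambda>k::nat. real k powr (- (2 * r))) summable_on UNIV"
    by (intro norm_summable_imp_summable_on) (use r in \<open>simp add: summable_real_powr_iff\<close>)
  have "(\<lambda>n. 1 / sobolev_weight r n) summable_on (int ` {0<..})"
    using summable_on_subset_banach[OF s, of "{0<..}"]
    by (subst summable_on_reindex) (auto simp: o_def sobolev_weight_pos less_imp_le intro!: summable_on_comparison_test[OF _ order.trans[OF bound]])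
  moreover have "(\<lambda>n. 1 / sobolev_weight r n) summable_on ((\<lambda>k. - int k) ` {0<..})"
    using summable_on_subset_banach[OF s, of "{0<..}"]
    by (subst summable_on_reindex) (auto simp: o_def sobolev_weight_pos less_imp_le inj_on_def intro!: summable_on_comparison_test[OF _ order.trans[OF bound]])
  ultimately have "(\<lambda>n. 1 / sobolev_weight r n) summable_on ((int ` {0<..} \<union> (\<lambda>k. - int k) ` {0<..}) \<union> {0})"
    by (intro summable_on_union) auto
  moreover have "(int ` {0<..} \<union> (\<lambda>k. - int k) ` {0<..}) \<union> {0} = UNIV"
  proof (intro equalityI subsetI)
    fix n :: int
    show "n \<in> (int ` {0<..} \<union> (\<lambda>k. - int k) ` {0<..}) \<union> {0}"
    proof (cases n rule: int_cases3)
      case zero then show ?thesis by simp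
    next
      case (pos k) then show ?thesis by auto
    next
      case (neg k) then show ?thesis by auto
    qed
  qed auto
  ultimately show ?thesis by simp
qed

text \<open>Termwise, k c <= l/2 v + w c^2 / (2 l) for every l > 0. After summation l is chosen as
  the weighted norm, or arbitrarily small if that norm is zero. The constant (A + 1)/2 majorises the
  Cauchy-Schwarz constant sqrt A, where A is the sum of v; only linearity in the norm
  matters.\<close>

lemma summable_Cauchy_Schwarz:
  fixes c k v w :: "int \<Rightarrow> real"
  assumes v: "v summable_on UNIV" and w: "(\<lambda>n. w n * (c n)\<^sup>2) summable_on UNIV"
    and nonneg: "\<And>n. 0 \<le> c n" "\<And>n. 0 \<le> k n" "\<And>n. 0 \<le> v n" "\<And>n. 0 \<le> w n"
    and k: "\<And>n. (k n)\<^sup>2 \<le> v n * w n"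
  shows "(\<lambda>n. k n * c n) summable_on UNIV"
    and "(\<Sum>\<^sub>\<infinity>n. k n * c n) \<le> (infsum v UNIV + 1) / 2 * sqrt (\<Sum>\<^sub>\<infinity>n. w n * (c n)\<^sup>2)"
proof -
  have le: "k n * c n \<le> l / 2 * v n + 1 / (2 * l) * (w n * (c n)\<^sup>2)" if l: "l > 0" for l n
  proof -
    define p q where "p = l\<^sup>2 * v n" and "q = w n * (c n)\<^sup>2"
    have pq: "0 \<le> p" "0 \<le> q" using nonneg by (auto simp: p_def q_def)
    have "(k n)\<^sup>2 * (l * c n)\<^sup>2 \<le> v n * w n * (l * c n)\<^sup>2" by (intro mult_right_mono k) simp
    then have "(2 * (l * k n * c n))\<^sup>2 \<le> 4 * (p * q)"
      by (simp add: p_def q_def power_mult_distrib algebra_simps)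
    also have "\<dots> \<le> (p + q)\<^sup>2" using zero_le_power2[of "p - q"] by (simp add: power2_eq_square algebra_simps)
    finally have "2 * (l * k n * c n) \<le> p + q"
      by (rule power2_le_imp_le) (use pq in simp)
    then have "2 * (l * k n * c n) / (2 * l) \<le> (p + q) / (2 * l)"
      using l by (intro divide_right_mono) auto
    moreover have "2 * (l * k n * c n) / (2 * l) = k n * c n" using l by simp
    moreover have "p / (2 * l) = l / 2 * v n" using l by (simp add: p_def power2_eq_square)
    ultimately show ?thesis by (simp add: add_divide_distrib q_def)
  qed
  have sl: "(\<lambda>n. l / 2 * v n + 1 / (2 * l) * (w n * (c n)\<^sup>2)) summable_on UNIV" for l
    by (intro summable_on_add summable_on_cmult_right v w)
  show s: "(\<lambda>n. k n * c n) summable_on UNIV"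
    by (rule summable_on_comparison_test[OF sl[of 1]]) (use le[of 1] nonneg in auto)
  define A where "A = infsum v UNIV"
  define N2 where "N2 = (\<Sum>\<^sub>\<infinity>n. w n * (c n)\<^sup>2)"
  have A: "A \<ge> 0" and N2: "N2 \<ge> 0" unfolding A_def N2_def using nonneg by (auto intro!: infsum_nonneg)
  have bound: "(\<Sum>\<^sub>\<infinity>n. k n * c n) \<le> l / 2 * A + 1 / (2 * l) * N2" if "l > 0" for l
  proof -
    have "(\<Sum>\<^sub>\<infinity>n. k n * c n) \<le> (\<Sum>\<^sub>\<infinity>n. l / 2 * v n + 1 / (2 * l) * (w n * (c n)\<^sup>2))"
      by (intro infsum_mono s sl le that)
    also have "\<dots> = l / 2 * A + 1 / (2 * l) * N2"
      unfolding A_def N2_def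
      by (subst infsum_add) (auto intro!: summable_on_cmult_right v w simp: infsum_cmult_right' simp del: times_divide_eq_left)
    finally show ?thesis .
  qed
  show "(\<Sum>\<^sub>\<infinity>n. k n * c n) \<le> (infsum v UNIV + 1) / 2 * sqrt (\<Sum>\<^sub>\<infinity>n. w n * (c n)\<^sup>2)"
  proof (cases "N2 = 0")
    case True
    have "(\<Sum>\<^sub>\<infinity>n. k n * c n) \<le> 0 + e" if "e > 0" for e
    proof -
      have "(\<Sum>\<^sub>\<infinity>n. k n * c n) \<le> (e / (A + 1)) / 2 * A"
        using bound[of "e / (A + 1)"] True A that by simp
      also have "\<dots> \<le> e" using A that by (simp add: field_simps)
      finally show ?thesis by simp
    qed
    then show ?thesis using True field_le_epsilon[of "\<Sum>\<^sub>\<infinity>n. k n * c n" 0] by (simp add: N2_def)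
  next
    case False
    with N2 have "sqrt N2 > 0" "sqrt N2 * sqrt N2 = N2" by auto
    then have "(\<Sum>\<^sub>\<infinity>n. k n * c n) \<le> sqrt N2 / 2 * A + 1 / (2 * sqrt N2) * (sqrt N2 * sqrt N2)"
      using bound[of "sqrt N2"] by simp
    also have "1 / (2 * sqrt N2) * (sqrt N2 * sqrt N2) = sqrt N2 / 2" using \<open>sqrt N2 > 0\<close> by (simp del: real_sqrt_mult_self)
    also have "sqrt N2 / 2 * A + sqrt N2 / 2 = (A + 1) / 2 * sqrt N2" by (simp add: algebra_simps add_divide_distrib)
    finally show ?thesis by (simp only: A_def N2_def)
  qed
qed

definition sobolev_const :: "real \<Rightarrow> real" where
  "sobolev_const r = ((\<Sum>\<^sub>\<infinity>n. 1 / sobolev_weight r n) + 1) / 2"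

lemma sobolev_circleD:
  assumes "f \<in> sobolev_circle s"
  shows "continuous_on S f" "f (x + 1) = f x"
    "(\<lambda>n. sobolev_weight s n * (cmod (fourier_coeff f n))\<^sup>2) summable_on UNIV"
  using assms continuous_on_subset by (auto simp: sobolev_circle_def)

lemma fourier_coeff_summable:
  assumes r: "r > 1/2" and f: "f \<in> sobolev_circle r"
  shows "(\<lambda>n. cmod (fourier_coeff f n)) summable_on UNIV"
    and "(\<Sum>\<^sub>\<infinity>n. cmod (fourier_coeff f n)) \<le> sobolev_const r * sobolev_norm r f"
  using summable_Cauchy_Schwarz[OF summable_inverse_sobolev_weight[OF r] sobolev_circleD(3)[OF f], of "\<lambda>n. 1"]
  by (simp_all add: sobolev_weight_pos[THEN less_imp_le] sobolev_weight_pos[THEN less_imp_neq, THEN not_sym]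
      sobolev_const_def sobolev_norm_def)

text \<open>The weights of orders s and s - 1 have quotient 1 + (2 pi n)^2, so a derivative costs
  one order, and the remaining s - 1 > 1/2 pays for absolute convergence.\<close>

lemma fourier_coeff_deriv_summable:
  assumes s: "s > 3/2" and f: "f \<in> sobolev_circle s"
  shows "(\<lambda>n. cmod (2 * pi * \<i> * of_int n * fourier_coeff f n)) summable_on UNIV"
    and "(\<Sum>\<^sub>\<infinity>n. cmod (2 * pi * \<i> * of_int n * fourier_coeff f n)) \<le> sobolev_const (s - 1) * sobolev_norm s f"
proof -
  have k: "(2 * pi * \<bar>real_of_int n\<bar>)\<^sup>2 \<le> 1 / sobolev_weight (s - 1) n * sobolev_weight s n" for n
    unfolding sobolev_weight_diff_1[of s n]
    using sobolev_weight_pos[of "s - 1" n] by (simp add: power_mult_distrib)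
  have eq: "cmod (2 * pi * \<i> * of_int n * fourier_coeff f n) = 2 * pi * \<bar>real_of_int n\<bar> * cmod (fourier_coeff f n)" for n
    by (simp add: norm_mult)
  have "s - 1 > 1/2" using s by simp
  note CS = summable_Cauchy_Schwarz[OF summable_inverse_sobolev_weight[OF this] sobolev_circleD(3)[OF f] _ _ _ _ k]
  show "(\<lambda>n. cmod (2 * pi * \<i> * of_int n * fourier_coeff f n)) summable_on UNIV"
    unfolding eq by (rule CS(1)) (auto simp: sobolev_weight_pos less_imp_le)
  show "(\<Sum>\<^sub>\<infinity>n. cmod (2 * pi * \<i> * of_int n * fourier_coeff f n)) \<le> sobolev_const (s - 1) * sobolev_norm s f"
    unfolding eq sobolev_const_def sobolev_norm_def by (rule CS(2)) (auto simp: sobolev_weight_pos less_imp_le)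
qed

lemma sobolev_circle_mono:
  assumes "r \<le> s" "f \<in> sobolev_circle s" shows "f \<in> sobolev_circle r"
proof -
  have "(\<lambda>n. sobolev_weight r n * (cmod (fourier_coeff f n))\<^sup>2) summable_on UNIV"
    by (rule summable_on_comparison_test[OF sobolev_circleD(3)[OF assms(2)]])
      (auto intro!: mult_right_mono sobolev_weight_mono assms simp: sobolev_weight_pos less_imp_le)
  then show ?thesis using assms(2) by (simp add: sobolev_circle_def)
qed

lemma sobolev_circle_linear:
  assumes f: "f \<in> sobolev_circle s" and g: "g \<in> sobolev_circle s"
  shows "(\<lambda>x. a * f x + b * g x) \<in> sobolev_circle s"
proof -
  let ?h = "\<lambda>x. a * f x + b * g x"
  have ch: "continuous_on UNIV ?h" by (intro continuous_intros sobolev_circleD[OF f] sobolev_circleD[OF g])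
  have coeff: "fourier_coeff ?h n = a * fourier_coeff f n + b * fourier_coeff g n" for n
  proof -
    have "((\<lambda>x. of_real a * (of_real (f x) * trig (- n) x) + of_real b * (of_real (g x) * trig (- n) x)) has_integral
      of_real a * fourier_coeff f n + of_real b * fourier_coeff g n) {0..1}"
      unfolding fourier_coeff_integral[OF sobolev_circleD(1)[OF f]] fourier_coeff_integral[OF sobolev_circleD(1)[OF g]]
      by (intro has_integral_add has_integral_mult_right integrable_integral fourier_coeff_continuous_bound
          sobolev_circleD(1)[OF f] sobolev_circleD(1)[OF g])
    then show ?thesis
      unfolding fourier_coeff_integral[OF ch] by (simp add: integral_unique algebra_simps)
  qed
  have le: "sobolev_weight s n * (cmod (fourier_coeff ?h n))\<^sup>2 \<le>
    2 * a\<^sup>2 * (sobolev_weight s n * (cmod (fourier_coeff f n))\<^sup>2) + 2 * b\<^sup>2 * (sobolev_weight s n * (cmod (fourier_coeff g n))\<^sup>2)" for n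
  proof -
    define x y where "x = \<bar>a\<bar> * cmod (fourier_coeff f n)" and "y = \<bar>b\<bar> * cmod (fourier_coeff g n)"
    have "cmod (fourier_coeff ?h n) \<le> x + y"
      unfolding coeff x_def y_def using norm_triangle_ineq[of "a * fourier_coeff f n" "b * fourier_coeff g n"]
      by (simp add: norm_mult)
    then have "(cmod (fourier_coeff ?h n))\<^sup>2 \<le> (x + y)\<^sup>2" by (intro power_mono) auto
    also have "\<dots> \<le> 2 * x\<^sup>2 + 2 * y\<^sup>2"
      using zero_le_power2[of "x - y"] by (simp add: power2_eq_square algebra_simps)
    finally have "sobolev_weight s n * (cmod (fourier_coeff ?h n))\<^sup>2 \<le> sobolev_weight s n * (2 * x\<^sup>2 + 2 * y\<^sup>2)"
      by (intro mult_left_mono) (auto simp: sobolev_weight_pos less_imp_le)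
    then show ?thesis by (simp add: x_def y_def power_mult_distrib algebra_simps)
  qed
  have "(\<lambda>n. sobolev_weight s n * (cmod (fourier_coeff ?h n))\<^sup>2) summable_on UNIV"
    by (rule summable_on_comparison_test[OF _ le])
      (auto intro!: summable_on_add summable_on_cmult_right sobolev_circleD(3)[OF f] sobolev_circleD(3)[OF g]
        simp: sobolev_weight_pos less_imp_le)
  then show ?thesis using ch sobolev_circleD(2)[OF f] sobolev_circleD(2)[OF g] by (simp add: sobolev_circle_def)
qed

lemma sobolev_circle_diff:
  "f \<in> sobolev_circle s \<Longrightarrow> g \<in> sobolev_circle s \<Longrightarrow> (\<lambda>x. f x - g x) \<in> sobolev_circle s"
  using sobolev_circle_linear[of f s g 1 "-1"] by simp

lemma sobolev_sup_bound:
  assumes "r > 1/2" "f \<in> sobolev_circle r"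
  shows "\<bar>f x\<bar> \<le> sobolev_const r * sobolev_norm r f"
proof -
  have "\<bar>f x\<bar> = cmod (trig_series (fourier_coeff f) x)"
    using fourier_inversion[OF sobolev_circleD(1)[OF assms(2)] sobolev_circleD(2)[OF assms(2)]
        fourier_coeff_summable(1)[OF assms], of x] by (metis norm_of_real)
  also have "\<dots> \<le> (\<Sum>\<^sub>\<infinity>n. cmod (fourier_coeff f n))"
    by (rule norm_trig_series_le) (rule fourier_coeff_summable[OF assms])
  also have "\<dots> \<le> sobolev_const r * sobolev_norm r f" by (rule fourier_coeff_summable(2)[OF assms])
  finally show ?thesis .
qed

lemma sobolev_deriv:
  assumes s: "s > 3/2" and f: "f \<in> sobolev_circle s"
  shows "(f has_real_derivative deriv f x) (at x)" "continuous_on S (deriv f)"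
    "\<bar>deriv f x\<bar> \<le> sobolev_const (s - 1) * sobolev_norm s f" "deriv f (x + 1) = deriv f x"
proof -
  define d where "d = (\<lambda>x. trig_series (\<lambda>n. 2 * pi * \<i> * of_int n * fourier_coeff f n) x)"
  note s' = fourier_coeff_deriv_summable[OF s f]
  have "s > 1/2" using s by simp
  note D = fourier_derivative[OF sobolev_circleD(1,2)[OF f] fourier_coeff_summable(1)[OF \<open>s > 1/2\<close> f] s'(1)]
  have eq: "deriv f x = Re (d x)" for x using DERIV_imp_deriv[OF D[of x]] by (simp add: d_def)
  show der: "(f has_real_derivative deriv f x) (at x)" for x using D[of x] unfolding eq by (simp add: d_def)
  have "continuous_on S d" unfolding d_def by (rule continuous_on_trig_series[OF s'(1)])
  then show "continuous_on S (deriv f)" unfolding eq[abs_def] by (intro continuous_intros)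
  have "\<bar>deriv f x\<bar> \<le> cmod (d x)" unfolding eq by (rule abs_Re_le_cmod)
  also have "\<dots> \<le> (\<Sum>\<^sub>\<infinity>n. cmod (2 * pi * \<i> * of_int n * fourier_coeff f n))"
    unfolding d_def by (rule norm_trig_series_le[OF s'(1)])
  also note s'(2)
  finally show "\<bar>deriv f x\<bar> \<le> sobolev_const (s - 1) * sobolev_norm s f" .
  have "((\<lambda>y. f (y + 1)) has_real_derivative deriv f (x + 1)) (at x)"
    using DERIV_shift[of f "deriv f (x + 1)" x 1] der[of "x + 1"] by simp
  then have "(f has_real_derivative deriv f (x + 1)) (at x)"
    by (simp add: sobolev_circleD(2)[OF f])
  with der[of x] show "deriv f (x + 1) = deriv f x" by (rule DERIV_unique[rotated])
qed

section \<open>Ordinary differential equations\<close>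

text \<open>
  Picard's theorem on a fixed interval: with the weight \<open>exp (- L t)\<close> the integral operator is a
  contraction on the whole interval.
\<close>

lemma ode_exists:
  fixes V :: "real \<Rightarrow> real \<Rightarrow> real"
  assumes b: "0 \<le> b" and cV: "continuous_on ({0..b} \<times> UNIV) (\<lambda>(t, x). V t x)"
    and K: "0 \<le> K" and lip: "\<And>t x y. t \<in> {0..b} \<Longrightarrow> \<bar>V t x - V t y\<bar> \<le> K * \<bar>x - y\<bar>"
    and M: "\<And>t x. t \<in> {0..b} \<Longrightarrow> \<bar>V t x\<bar> \<le> M"
  obtains q where "q 0 = x0" "\<And>t. t \<in> {0..b} \<Longrightarrow> (q has_real_derivative V t (q t)) (at t within {0..b})"
proof -
  \<comment> \<open>L > 2 K makes K / L < 1/2, the contraction factor; the summand 1 keeps L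
    positive when K = 0.\<close>
  define L where "L = 2 * K + 1"
  have L: "L > 0" using K by (simp add: L_def)
  \<comment> \<open>Clamping time to [0, b] produces functions on the whole line, as the complete
    space of bounded continuous functions requires.\<close>
  define c where "c = (\<lambda>t::real. max 0 (min b t))"
  have c: "c t \<in> {0..b}" for t using b by (auto simp: c_def)
  have c_id: "c t = t" if "t \<in> {0..b}" for t using that by (auto simp: c_def)
  have cc: "continuous_on UNIV c" unfolding c_def by (intro continuous_intros)
  \<comment> \<open>The unknown v stands for exp (- L t) (q t - x0), so its plain sup norm is the
    weighted norm of q - x0.\<close>
  define W where "W = (\<lambda>(v :: real \<Rightarrow>\<^sub>C real) s. V s (x0 + exp (L * s) * apply_bcontfun v s))"
  have cW: "continuous_on {0..b} (W v)" for v
    unfolding W_def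
    by (rule continuous_on_compose2[OF cV, of _ "\<lambda>s. (s, x0 + exp (L * s) * apply_bcontfun v s)", simplified])
      (auto intro!: continuous_intros)
  have iW: "W v integrable_on {0..t}" if "t \<in> {0..b}" for v t
    using that by (intro integrable_continuous_real continuous_on_subset[OF cW]) auto
  define P where "P = (\<lambda>v t. exp (- (L * c t)) * integral {0..c t} (W v))"
  have M0: "M \<ge> 0" using M[of 0 0] b by auto
  have P: "P v \<in> bcontfun" for v
  proof (rule bcontfun_normI)
    have "continuous_on {0..b} (\<lambda>t. exp (- (L * t)) * integral {0..t} (W v))"
      using b by (intro continuous_intros indefinite_integral_continuous_1 iW) auto
    moreover have "range c \<subseteq> {0..b}" using c by blast
    ultimately show "continuous_on UNIV (P v)"
      unfolding P_def by (rule continuous_on_compose2[OF _ cc])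
    fix t
    have "norm (integral {0..c t} (W v)) \<le> M * (c t - 0)"
    proof (rule integral_bound)
      show "continuous_on {0..c t} (W v)" using c[of t] by (intro continuous_on_subset[OF cW]) auto
      show "norm (W v s) \<le> M" if "s \<in> {0..c t}" for s
        using that c[of t] unfolding W_def by (simp add: M)
    qed (use c[of t] in auto)
    also have "\<dots> \<le> M * b" using M0 c[of t] by (intro mult_left_mono) auto
    finally have "norm (integral {0..c t} (W v)) \<le> M * b" .
    moreover have "exp (- (L * c t)) \<le> 1" using L c[of t] by simp
    ultimately have "exp (- (L * c t)) * norm (integral {0..c t} (W v)) \<le> 1 * (M * b)"
      by (intro mult_mono) auto
    then show "norm (P v t) \<le> M * b" by (simp add: P_def abs_mult)
  qed
  define F where "F = (\<lambda>v. Bcontfun (P v))"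
  have F: "apply_bcontfun (F v) = P v" for v unfolding F_def by (rule Bcontfun_inverse[OF P])
  have "\<exists>!v. F v = v"
  proof (rule banach_fix_type[of "1/2"], simp, simp, intro allI)
    fix v w
    show "dist (F v) (F w) \<le> 1/2 * dist v w"
    proof (rule dist_bound)
      fix t
      define D where "D = dist v w"
      define s where "s = c t"
      have s: "s \<in> {0..b}" unfolding s_def by (rule c)
      have "((\<lambda>r. K * D * exp (L * r)) has_integral (K * D / L * exp (L * s) - K * D / L * exp (L * 0))) {0..s}"
        using s L by (intro fundamental_theorem_of_calculus)
          (auto intro!: derivative_eq_intros simp: has_real_derivative_iff_has_vector_derivative[symmetric])
      then have I: "((\<lambda>r. K * D * exp (L * r)) has_integral (K * D / L * (exp (L * s) - 1))) {0..s}"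
        by (simp add: right_diff_distrib)
      have "norm (integral {0..s} (\<lambda>r. W v r - W w r)) \<le> integral {0..s} (\<lambda>r. K * D * exp (L * r))"
      proof (rule integral_norm_bound_integral)
        show "(\<lambda>r. W v r - W w r) integrable_on {0..s}"
          by (intro Henstock_Kurzweil_Integration.integrable_diff iW s)
        show "(\<lambda>r. K * D * exp (L * r)) integrable_on {0..s}" using I by blast
        fix r assume r: "r \<in> {0..s}"
        have "\<bar>W v r - W w r\<bar> \<le> K * \<bar>(x0 + exp (L * r) * apply_bcontfun v r) - (x0 + exp (L * r) * apply_bcontfun w r)\<bar>"
          unfolding W_def using r s by (intro lip) auto
        also have "\<dots> = K * (exp (L * r) * dist (apply_bcontfun v r) (apply_bcontfun w r))"
          by (simp add: dist_real_def abs_mult right_diff_distrib[symmetric])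
        also have "\<dots> \<le> K * (exp (L * r) * D)"
          unfolding D_def using K by (intro mult_left_mono dist_bounded) auto
        finally show "norm (W v r - W w r) \<le> K * D * exp (L * r)" by (simp add: ac_simps)
      qed
      also have "\<dots> = K * D / L * (exp (L * s) - 1)" using I by (rule integral_unique)
      also have "integral {0..s} (\<lambda>r. W v r - W w r) = integral {0..s} (W v) - integral {0..s} (W w)"
        by (intro Henstock_Kurzweil_Integration.integral_diff iW s)
      finally have le: "\<bar>integral {0..s} (W v) - integral {0..s} (W w)\<bar> \<le> K * D / L * (exp (L * s) - 1)" by simp
      have "dist (P v t) (P w t) = exp (- (L * s)) * \<bar>integral {0..s} (W v) - integral {0..s} (W w)\<bar>"
        by (simp add: P_def s_def dist_real_def abs_mult right_diff_distrib[symmetric])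
      also have "\<dots> \<le> exp (- (L * s)) * (K * D / L * (exp (L * s) - 1))"
        by (intro mult_left_mono le) auto
      also have "\<dots> = K * D / L * (1 - exp (- (L * s)))"
        by (simp add: exp_minus field_simps)
      also have "\<dots> \<le> K * D / L * 1"
        using K L by (intro mult_left_mono) (auto simp: D_def)
      also have "\<dots> \<le> 1/2 * D"
      proof -
        have "K * D \<le> (1/2 * L) * D" by (intro mult_right_mono) (auto simp: L_def D_def)
        then show ?thesis using L by (simp add: field_simps)
      qed
      finally show "dist (apply_bcontfun (F v) t) (apply_bcontfun (F w) t) \<le> 1/2 * dist v w"
        by (simp add: F D_def)
    qed
  qed
  then obtain v where v: "F v = v" by blast
  define q where "q = (\<lambda>t. x0 + integral {0..t} (W v))"
  have eq: "x0 + exp (L * t) * apply_bcontfun v t = q t" if t: "t \<in> {0..b}" for t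
  proof -
    have "apply_bcontfun v t = P v t" using F[of v] v by simp
    then show ?thesis using t by (simp add: P_def c_id q_def mult.assoc[symmetric] exp_add[symmetric])
  qed
  show ?thesis
  proof (rule that[of q])
    show "q 0 = x0" by (simp add: q_def)
    fix t assume t: "t \<in> {0..b}"
    have "((\<lambda>t. integral {0..t} (W v)) has_real_derivative W v t) (at t within {0..b})"
      by (rule integral_has_real_derivative[OF cW t])
    moreover have "W v t = V t (q t)" using eq[OF t] by (simp add: W_def)
    ultimately show "(q has_real_derivative V t (q t)) (at t within {0..b})"
      unfolding q_def using DERIV_add[OF DERIV_const] by fastforce
  qed
qed

lemma nonneg_derivative_le:
  fixes f :: "real \<Rightarrow> real"
  assumes "x \<le> y" "continuous_on {x..y} f"
    and "\<And>t. x < t \<Longrightarrow> t < y \<Longrightarrow> \<exists>d. (f has_real_derivative d) (at t) \<and> 0 \<le> d"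
  shows "f x \<le> f y"
proof (cases "x = y")
  case False
  then show ?thesis using DERIV_nonneg_imp_increasing_open[of x y f] assms by auto
qed simp

text \<open>The quantity \<open>1/A + 1/B\<close> decreases at rate at least \<open>2 k\<close>.\<close>

lemma riccati_blowup:
  fixes A B :: "real \<Rightarrow> real"
  assumes T: "0 \<le> T" and k: "0 \<le> k"
    and cA: "continuous_on {0..T} A" and cB: "continuous_on {0..T} B"
    and dA: "\<And>t. 0 < t \<Longrightarrow> t < T \<Longrightarrow> \<exists>d. (A has_real_derivative d) (at t) \<and> k * (A t * B t) \<le> d"
    and dB: "\<And>t. 0 < t \<Longrightarrow> t < T \<Longrightarrow> \<exists>d. (B has_real_derivative d) (at t) \<and> k * (A t * B t) \<le> d"
    and pos: "0 < A 0" "0 < B 0"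
  shows "2 * k * T \<le> 1 / A 0 + 1 / B 0"
proof -
  have cm: "continuous_on {0..T} (\<lambda>t. min (A t) (B t))" using cA cB by (intro continuous_intros)
  have AB: "0 < A t \<and> 0 < B t" if t: "t \<in> {0..T}" for t
  proof (rule ccontr)
    assume neg: "\<not> (0 < A t \<and> 0 < B t)"
    \<comment> \<open>Up to the first time in S both factors are positive, so both are nondecreasing
      and cannot have fallen from their positive initial values.\<close>
    define S where "S = {s \<in> {0..T}. min (A s) (B s) \<le> 0}"
    have "closed S" unfolding S_def
      using continuous_closed_preimage[OF cm, of "{..0}"] by (simp add: vimage_def Int_def conj_commute)
    moreover have "S \<noteq> {}" using t neg by (auto simp: S_def not_less min_le_iff_disj)
    moreover have bdd: "bdd_below S" by (intro bdd_belowI[of _ 0]) (auto simp: S_def)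
    ultimately have inS: "Inf S \<in> S" by (intro closed_contains_Inf)
    define r where "r = Inf S"
    have r: "r \<in> {0..T}" "min (A r) (B r) \<le> 0" using inS by (auto simp: S_def r_def)
    have before: "0 < A s \<and> 0 < B s" if "0 \<le> s" "s < r" for s
      using cInf_lower[OF _ bdd, of s] that r unfolding S_def r_def[unfolded S_def, symmetric] by force
    have mono: "f 0 \<le> f r" if f: "continuous_on {0..T} f"
      and df: "\<And>t. 0 < t \<Longrightarrow> t < T \<Longrightarrow> \<exists>d. (f has_real_derivative d) (at t) \<and> k * (A t * B t) \<le> d" for f
    proof (rule nonneg_derivative_le[of 0 r f])
      show "continuous_on {0..r} f" using r by (intro continuous_on_subset[OF f]) auto
      fix s assume s: "0 < s" "s < r"
      then obtain d where "(f has_real_derivative d) (at s)" "k * (A s * B s) \<le> d" using df r by force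
      moreover have "0 \<le> k * (A s * B s)" using k before[of s] s by auto
      ultimately show "\<exists>d. (f has_real_derivative d) (at s) \<and> 0 \<le> d" by (auto intro!: exI[of _ d])
    qed (use r in auto)
    have "A 0 \<le> A r" by (rule mono[OF cA dA])
    moreover have "B 0 \<le> B r" by (rule mono[OF cB dB])
    ultimately show False using pos r by auto
  qed
  define f where "f = (\<lambda>t. - (1 / A t + 1 / B t) - 2 * k * t)"
  have "f 0 \<le> f T"
  proof (rule nonneg_derivative_le[of 0 T f, OF T])
    show "continuous_on {0..T} f" unfolding f_def
      using AB by (intro continuous_intros cA cB) force+
    fix t assume t: "0 < t" "t < T"
    obtain d1 where d1: "(A has_real_derivative d1) (at t)" "k * (A t * B t) \<le> d1" using dA[OF t] by blast
    obtain d2 where d2: "(B has_real_derivative d2) (at t)" "k * (A t * B t) \<le> d2" using dB[OF t] by blast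
    have p: "A t > 0" "B t > 0" using AB[of t] t by auto
    have "(f has_real_derivative (d1 / (A t)\<^sup>2 + d2 / (B t)\<^sup>2 - 2 * k)) (at t)" unfolding f_def
      by (rule derivative_eq_intros d1 d2 refl | use p in \<open>simp add: power2_eq_square field_simps\<close>)+
    moreover have "0 \<le> d1 / (A t)\<^sup>2 + d2 / (B t)\<^sup>2 - 2 * k"
    proof -
      have "k * (A t * B t) / (A t)\<^sup>2 + k * (A t * B t) / (B t)\<^sup>2 \<le> d1 / (A t)\<^sup>2 + d2 / (B t)\<^sup>2"
        using d1 d2 by (intro add_mono divide_right_mono) auto
      moreover have "k * (A t * B t) / (A t)\<^sup>2 + k * (A t * B t) / (B t)\<^sup>2 = k * (B t / A t + A t / B t)"
        using p by (simp add: power2_eq_square field_simps)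
      moreover have "2 \<le> B t / A t + A t / B t"
      proof -
        have "0 \<le> (A t - B t)\<^sup>2 / (A t * B t)" using p by simp
        also have "\<dots> = B t / A t + A t / B t - 2" using p by (simp add: power2_eq_square field_simps)
        finally show ?thesis by simp
      qed
      then have "k * 2 \<le> k * (B t / A t + A t / B t)" using k by (rule mult_left_mono)
      ultimately show ?thesis by linarith
    qed
    ultimately show "\<exists>d. (f has_real_derivative d) (at t) \<and> 0 \<le> d" by blast
  qed
  moreover have "1 / A T + 1 / B T \<ge> 0" using AB[of T] T by (simp add: less_imp_le)
  ultimately show ?thesis by (simp add: f_def)
qed

section \<open>The convolution with the kernel\<close>

definition slope_weight :: "real \<Rightarrow> real" where
  "slope_weight z = sinh (z - 1/2) / (2 * sinh (1/2))"

lemma kernel_weight_split: "kernel_weight b z = kernel_weight 0 z + b * slope_weight z"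
  by (simp add: kernel_weight_def slope_weight_def add_divide_distrib)

lemma continuous_on_slope_weight [continuous_intros]:
  "continuous_on S f \<Longrightarrow> continuous_on S (\<lambda>x. slope_weight (f x))"
  unfolding slope_weight_def by (intro continuous_intros) auto

lemma slope_weight_reflect: "slope_weight (1 - z) = - slope_weight z"
proof -
  have "1 - z - 1/2 = - (z - 1/2)" by simp
  then show ?thesis unfolding slope_weight_def by (simp only: sinh_minus minus_divide_left)
qed

lemma deriv_rod_kernel_periodic: "deriv rod_kernel (x + of_int k) = deriv rod_kernel x"
proof -
  have "(\<lambda>x. rod_kernel (x + of_int k)) = rod_kernel"
    by (simp add: fun_eq_iff rod_kernel_def)
  then show ?thesis unfolding deriv_def DERIV_shift by simp
qed

lemma periodic_of_int:
  fixes w :: "real \<Rightarrow> real"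
  assumes "\<And>x. w (x + 1) = w x" shows "w (x + of_int k) = w x"
proof -
  interpret periodic_fun_simple' w by standard (rule assms)
  show ?thesis by (rule plus_of_int)
qed

text \<open>The derivative of the kernel is odd, which turns the convolution into an integral over
  the window starting at x, the shape in which I applies to the test function u(x + z). With f the
  fractional part of x, the piece [0, f] moves to [1 - f, 1] and [f, 1] moves to [0, 1 - f].\<close>

lemma circle_convolution_deriv_rod_kernel:
  assumes cw: "continuous_on UNIV w" and per: "\<And>x. w (x + 1) = w x"
  shows "circle_convolution (deriv rod_kernel) w x = - integral {0..1} (\<lambda>z. slope_weight z * w (x + z))"
proof -
  define f where "f = x - of_int \<lfloor>x\<rfloor>"
  have f: "0 \<le> f" "f < 1" "x = f + of_int \<lfloor>x\<rfloor>"
    using floor_correct[of x] unfolding f_def by linarith+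
  define A where "A = (\<lambda>y. - (slope_weight (1 - f + y) * w y))"
  define B where "B = (\<lambda>y. - (slope_weight (y - f) * w y))"
  have c: "continuous_on S A" "continuous_on S B" for S
    unfolding A_def B_def by (intro continuous_intros continuous_on_subset[OF cw]; simp)+
  have d: "deriv rod_kernel (x - y) = - slope_weight (if y < f then 1 - f + y else y - f)"
    if "y \<in> {0<..<1}" "y \<noteq> f" for y
  proof -
    have "deriv rod_kernel (x - y) = deriv rod_kernel ((f - y) + of_int \<lfloor>x\<rfloor>)"
      by (simp add: f_def)
    also have "\<dots> = deriv rod_kernel (f - y)" by (rule deriv_rod_kernel_periodic)
    also have "\<dots> = - slope_weight (if y < f then 1 - f + y else y - f)"
    proof (cases "y < f")
      case True
      then have "deriv rod_kernel (f - y) = slope_weight (f - y)"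
        using that f by (simp add: deriv_rod_kernel slope_weight_def)
      also have "f - y = 1 - (1 - f + y)" by simp
      also have "slope_weight \<dots> = - slope_weight (1 - f + y)" by (rule slope_weight_reflect)
      finally show ?thesis using True by simp
    next
      case False
      have "deriv rod_kernel (f - y) = deriv rod_kernel (1 - (y - f))"
        using deriv_rod_kernel_periodic[of "f - y" 1] by (simp add: algebra_simps)
      also have "\<dots> = slope_weight (1 - (y - f))"
        unfolding slope_weight_def using False that f by (intro deriv_rod_kernel) auto
      also have "\<dots> = - slope_weight (y - f)" by (rule slope_weight_reflect)
      finally show ?thesis using False by simp
    qed
    finally show ?thesis .
  qed
  have i: "integrable lborel (\<lambda>y. indicator {0..f} y *\<^sub>R A y)" "integrable lborel (\<lambda>y. indicator {f..1} y *\<^sub>R B y)"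
    using borel_integrable_atLeastAtMost'[OF c(1)] borel_integrable_atLeastAtMost'[OF c(2)]
    by (auto simp: set_integrable_def)
  have "circle_convolution (deriv rod_kernel) w x
      = (LBINT y. indicator {0..f} y *\<^sub>R A y + indicator {f..1} y *\<^sub>R B y)"
    unfolding circle_convolution_def set_lebesgue_integral_def
  proof (rule integral_discrete_difference[where X = "{0, f, 1}"])
    fix y assume "y \<notin> {0, f, 1}"
    then consider "y < 0" | "0 < y" "y < f" | "f < y" "y < 1" | "1 < y" by fastforce
    then show "indicator {0..1} y *\<^sub>R (deriv rod_kernel (x - y) * w y) = indicator {0..f} y *\<^sub>R A y + indicator {f..1} y *\<^sub>R B y"
      by cases (use f in \<open>auto simp: indicator_def d A_def B_def\<close>)
  qed auto
  also have "\<dots> = (LBINT y:{0..f}. A y) + (LBINT y:{f..1}. B y)"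
    unfolding set_lebesgue_integral_def by (rule Bochner_Integration.integral_add[OF i])
  also have "\<dots> = integral {0..f} A + integral {f..1} B"
    by (simp add: set_borel_integral_eq_integral borel_integrable_atLeastAtMost' c)
  also have "integral {0..f} A = - integral {1 - f..1} (\<lambda>z. slope_weight z * w (x + z))"
  proof -
    have "w (x + (1 - f + y)) = w y" for y
      using periodic_of_int[of w y "\<lfloor>x\<rfloor> + 1", OF per] by (simp add: f_def algebra_simps)
    then have "A = (\<lambda>y. - (((\<lambda>z. slope_weight z * w (x + z)) \<circ> (+) (1 - f)) y))"
      by (simp add: A_def fun_eq_iff)
    then show ?thesis
      using integral_shift_Icc_real[of 0 f "\<lambda>z. slope_weight z * w (x + z)" "1 - f"] by (simp add: o_def)
  qed
  also have "integral {f..1} B = - integral {0..1 - f} (\<lambda>z. slope_weight z * w (x + z))"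
  proof -
    have "w (x + (- f + y)) = w y" for y
      using periodic_of_int[of w y "\<lfloor>x\<rfloor>", OF per] by (simp add: f_def algebra_simps)
    then have "B = (\<lambda>y. - (((\<lambda>z. slope_weight z * w (x + z)) \<circ> (+) (- f)) y))"
      by (simp add: B_def fun_eq_iff)
    then show ?thesis
      using integral_shift_Icc_real[of f 1 "\<lambda>z. slope_weight z * w (x + z)" "- f"] by (simp add: o_def)
  qed
  also have "- integral {1 - f..1} (\<lambda>z. slope_weight z * w (x + z)) + - integral {0..1 - f} (\<lambda>z. slope_weight z * w (x + z))
     = - integral {0..1} (\<lambda>z. slope_weight z * w (x + z))"
  proof -
    have "(\<lambda>z. slope_weight z * w (x + z)) integrable_on {0..1}"
      by (intro integrable_continuous_real continuous_intros continuous_on_compose2[OF cw]) auto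
    from Henstock_Kurzweil_Integration.integral_combine[OF _ _ this, of "1 - f"] f show ?thesis by simp
  qed
  finally show ?thesis .
qed

lemma window_integral_derivative:
  fixes h :: "real \<Rightarrow> real"
  assumes h: "continuous_on UNIV h"
  shows "((\<lambda>x. integral {x..x + 1} h) has_real_derivative h (x + 1) - h x) (at x)"
proof -
  define a where "a = x - 1"
  define b where "b = x + 2"
  have d: "((\<lambda>y. integral {a..y} h) has_real_derivative h y) (at y)" if "a < y" "y < b" for y
  proof -
    have "((\<lambda>y. integral {a..y} h) has_real_derivative h y) (at y within {a..b})"
      using that by (intro integral_has_real_derivative continuous_on_subset[OF h]) auto
    with that show ?thesis by (simp add: at_within_Icc_at)
  qed
  have "((\<lambda>y. integral {a..y + 1} h) has_real_derivative h (x + 1)) (at x)"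
    using d[of "x + 1"] by (simp add: DERIV_shift a_def b_def)
  then have "((\<lambda>y. integral {a..y + 1} h - integral {a..y} h) has_real_derivative h (x + 1) - h x) (at x)"
    by (rule DERIV_diff) (rule d; simp add: a_def b_def)
  then show ?thesis
  proof (rule has_field_derivative_transform_within_open[where S = "{a<..}"])
    fix y assume y: "y \<in> {a<..}"
    have "h integrable_on {a..y + 1}" by (intro integrable_continuous_real continuous_on_subset[OF h]) auto
    from Henstock_Kurzweil_Integration.integral_combine[OF _ _ this, of y] y
    show "integral {a..y + 1} h - integral {a..y} h = integral {y..y + 1} h" by simp
  qed (auto simp: a_def)
qed

text \<open>The distributional identity p'' = p - delta. As w is only continuous, the shift cannot
  be differentiated inside w; addition formulas pull x out of the kernel instead and leave integrals
  of sinh and cosh times w over [x, x + 1]. Their boundary terms combine to w x by cosh^2 - sinh^2 =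
  1.\<close>

lemma slope_integral_derivative:
  assumes cw: "continuous_on UNIV w" and per: "\<And>x. w (x + 1) = w x"
  shows "((\<lambda>x. integral {0..1} (\<lambda>z. slope_weight z * w (x + z))) has_real_derivative
     w x - integral {0..1} (\<lambda>z. kernel_weight 0 z * w (x + z))) (at x)"
proof -
  define S where "S = 2 * sinh (1/2 :: real)"
  have S: "S > 0" by (simp add: S_def)
  define C where "C = (\<lambda>x. integral {x..x + 1} (\<lambda>y. sinh (y - 1/2) * w y))"
  define D where "D = (\<lambda>x. integral {x..x + 1} (\<lambda>y. cosh (y - 1/2) * w y))"
  have ci: "continuous_on UNIV (\<lambda>y. sinh (y - 1/2) * w y)" "continuous_on UNIV (\<lambda>y. cosh (y - 1/2) * w y)"
    by (intro continuous_intros cw)+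
  have i: "((\<lambda>y. sinh (y - 1/2) * w y) has_integral C x) {x..x + 1}"
    "((\<lambda>y. cosh (y - 1/2) * w y) has_integral D x) {x..x + 1}" for x
    unfolding C_def D_def by (intro integrable_integral integrable_continuous_real continuous_on_subset[OF ci(1)] continuous_on_subset[OF ci(2)]; simp)+
  have shift: "integral {0..1} (\<lambda>z. k z * w (x + z)) = integral {x..x + 1} (\<lambda>y. k (y - x) * w y)" for k :: "real \<Rightarrow> real" and x
    using integral_shift_Icc_real[of 0 1 "\<lambda>y. k (y - x) * w y" x] by (simp add: o_def add.commute)
  have slope: "integral {0..1} (\<lambda>z. slope_weight z * w (x + z)) = (cosh x * C x - sinh x * D x) / S" for x
  proof -
    have "((\<lambda>y. (cosh x * (sinh (y - 1/2) * w y) - sinh x * (cosh (y - 1/2) * w y)) / S) has_integral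
        (cosh x * C x - sinh x * D x) / S) {x..x + 1}"
      by (intro has_integral_divide has_integral_diff has_integral_mult_right i)
    moreover have "(cosh x * (sinh (y - 1/2) * w y) - sinh x * (cosh (y - 1/2) * w y)) / S = slope_weight (y - x) * w y" for y
    proof -
      have "y - x - 1/2 = (y - 1/2) - x" by simp
      then have e: "sinh (y - x - 1/2) = sinh (y - 1/2) * cosh x - cosh (y - 1/2) * sinh x"
        by (simp only: sinh_diff)
      show ?thesis unfolding slope_weight_def S_def[symmetric] e by (simp add: algebra_simps)
    qed
    ultimately show ?thesis unfolding shift by (simp add: integral_unique)
  qed
  have kernel: "integral {0..1} (\<lambda>z. kernel_weight 0 z * w (x + z)) = (cosh x * D x - sinh x * C x) / S" for x
  proof -
    have "((\<lambda>y. (cosh x * (cosh (y - 1/2) * w y) - sinh x * (sinh (y - 1/2) * w y)) / S) has_integral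
        (cosh x * D x - sinh x * C x) / S) {x..x + 1}"
      by (intro has_integral_divide has_integral_diff has_integral_mult_right i)
    moreover have "(cosh x * (cosh (y - 1/2) * w y) - sinh x * (sinh (y - 1/2) * w y)) / S = kernel_weight 0 (y - x) * w y" for y
    proof -
      have "y - x - 1/2 = (y - 1/2) - x" by simp
      then have e: "cosh (y - x - 1/2) = cosh (y - 1/2) * cosh x - sinh (y - 1/2) * sinh x"
        by (simp only: cosh_diff)
      show ?thesis unfolding kernel_weight_def S_def[symmetric] e by (simp add: algebra_simps)
    qed
    ultimately show ?thesis unfolding shift by (simp add: integral_unique)
  qed
  have dC: "(C has_real_derivative (sinh (x + 1/2) - sinh (x - 1/2)) * w x) (at x)"
    using window_integral_derivative[OF ci(1), of x] unfolding C_def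
    by (simp add: per left_diff_distrib add.commute[of "1/2"])
  have dD: "(D has_real_derivative (cosh (x + 1/2) - cosh (x - 1/2)) * w x) (at x)"
    using window_integral_derivative[OF ci(2), of x] unfolding D_def
    by (simp add: per left_diff_distrib add.commute[of "1/2"])
  have "((\<lambda>x. (cosh x * C x - sinh x * D x) / S) has_real_derivative
     (sinh x * C x + cosh x * ((sinh (x + 1/2) - sinh (x - 1/2)) * w x)
       - (cosh x * D x + sinh x * ((cosh (x + 1/2) - cosh (x - 1/2)) * w x))) / S) (at x)"
    using S by (rule_tac derivative_eq_intros dC dD refl | simp)+
  moreover have "cosh x * (sinh (x + 1/2) - sinh (x - 1/2)) - sinh x * (cosh (x + 1/2) - cosh (x - 1/2)) = S"
  proof -
    have "cosh x * (sinh (x + 1/2) - sinh (x - 1/2)) - sinh x * (cosh (x + 1/2) - cosh (x - 1/2))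
      = ((cosh x)\<^sup>2 - (sinh x)\<^sup>2) * S"
      unfolding sinh_add sinh_diff cosh_add cosh_diff S_def by (simp add: power2_eq_square algebra_simps)
    then show ?thesis by (simp add: cosh_square_eq)
  qed
  then have "(sinh x * C x + cosh x * ((sinh (x + 1/2) - sinh (x - 1/2)) * w x)
       - (cosh x * D x + sinh x * ((cosh (x + 1/2) - cosh (x - 1/2)) * w x))) / S
     = w x - (cosh x * D x - sinh x * C x) / S"
  proof -
    assume e: "cosh x * (sinh (x + 1/2) - sinh (x - 1/2)) - sinh x * (cosh (x + 1/2) - cosh (x - 1/2)) = S"
    have n: "sinh x * C x + cosh x * ((sinh (x + 1/2) - sinh (x - 1/2)) * w x)
       - (cosh x * D x + sinh x * ((cosh (x + 1/2) - cosh (x - 1/2)) * w x))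
     = (cosh x * (sinh (x + 1/2) - sinh (x - 1/2)) - sinh x * (cosh (x + 1/2) - cosh (x - 1/2))) * w x - (cosh x * D x - sinh x * C x)"
      by (simp only: algebra_simps)
    show ?thesis unfolding n e using S by (simp add: diff_divide_distrib)
  qed
  ultimately show ?thesis unfolding slope kernel by simp
qed

text \<open>By homogeneity, f(x + z) / f(x) is a test function when f(x) is nonzero; periodicity
  gives the value 1 at both ends. When f(x) = 0, the pair 1 + N f and 1 - N f is used: adding their
  forms cancels the cross terms and gives m <= c0 + N^2 E for all N, so E >= 0.\<close>

lemma rod_lower_periodic:
  assumes low: "rod_lower a b m"
    and d: "\<And>x. (f has_real_derivative f' x) (at x)" and c: "continuous_on UNIV f'"
    and per: "\<And>x. f (x + 1) = f x"
  shows "m * (f x)\<^sup>2 \<le> integral {0..1} (\<lambda>z. kernel_weight b z * (a * (f (x + z))\<^sup>2 + (f' (x + z))\<^sup>2))"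
proof -
  define E where "E = integral {0..1} (\<lambda>z. kernel_weight b z * (a * (f (x + z))\<^sup>2 + (f' (x + z))\<^sup>2))"
  have cf: "continuous_on S f" for S using d by (intro DERIV_continuous_on) (blast intro: has_field_derivative_at_within)
  have cx: "continuous_on S (\<lambda>z. f (x + z))" "continuous_on S (\<lambda>z. f' (x + z))" for S
    by (intro continuous_on_compose2[OF cf[of UNIV]] continuous_on_compose2[OF c] continuous_intros; simp)+
  have H: "H1_with_derivative (\<lambda>z. p + q * f (x + z)) (\<lambda>z. q * f' (x + z))" for p q
  proof (rule H1_with_derivative_C1)
    fix z
    have "((\<lambda>z. f (x + z)) has_real_derivative f' (x + z)) (at z)"
      using d[of "x + z"] DERIV_shift[of f "f' (x + z)" z x] by (simp add: add.commute)
    then have "((\<lambda>z. p + q * f (x + z)) has_real_derivative q * f' (x + z)) (at z)"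
      using DERIV_add[OF DERIV_const DERIV_cmult] by fastforce
    then show "((\<lambda>z. p + q * f (x + z)) has_real_derivative q * f' (x + z)) (at z within {0..1})"
      by (rule has_field_derivative_at_within)
  qed (intro continuous_intros cx)
  show ?thesis
  proof (cases "f x = 0")
    case False
    have "m \<le> rod_form a b (\<lambda>z. 0 + 1 / f x * f (x + z)) (\<lambda>z. 1 / f x * f' (x + z))"
      using low H[of 0 "1 / f x"] False per[of x] unfolding rod_lower_def by simp
    also have "\<dots> = integral {0..1} (\<lambda>z. (1 / (f x)\<^sup>2) * (kernel_weight b z * (a * (f (x + z))\<^sup>2 + (f' (x + z))\<^sup>2)))"
      unfolding rod_form_def by (intro Henstock_Kurzweil_Integration.integral_cong)
        (simp add: power_divide power_mult_distrib algebra_simps add_divide_distrib)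
    also have "\<dots> = (1 / (f x)\<^sup>2) * E" by (simp add: E_def)
    finally have "m * (f x)\<^sup>2 \<le> (1 / (f x)\<^sup>2) * E * (f x)\<^sup>2" by (rule mult_right_mono) simp
    then show ?thesis using False by (simp add: E_def)
  next
    case True
    define c0 where "c0 = integral {0..1} (\<lambda>z. kernel_weight b z * a)"
    have "2 * m \<le> 2 * c0 + 2 * N\<^sup>2 * E" for N
    proof -
      have le: "m \<le> rod_form a b (\<lambda>z. 1 + q * f (x + z)) (\<lambda>z. q * f' (x + z))" for q
        using low H[of 1 q] True per[of x] unfolding rod_lower_def by simp
      have "rod_form a b (\<lambda>z. 1 + N * f (x + z)) (\<lambda>z. N * f' (x + z))
        + rod_form a b (\<lambda>z. 1 + (-N) * f (x + z)) (\<lambda>z. (-N) * f' (x + z))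
        = integral {0..1} (\<lambda>z. kernel_weight b z * (a * (1 + N * f (x + z))\<^sup>2 + (N * f' (x + z))\<^sup>2)
          + kernel_weight b z * (a * (1 + (-N) * f (x + z))\<^sup>2 + ((-N) * f' (x + z))\<^sup>2))"
        unfolding rod_form_def
        by (intro Henstock_Kurzweil_Integration.integral_add[symmetric] integrable_continuous_real continuous_intros cx)
      also have "\<dots> = integral {0..1} (\<lambda>z. 2 * (kernel_weight b z * a)
          + 2 * N\<^sup>2 * (kernel_weight b z * (a * (f (x + z))\<^sup>2 + (f' (x + z))\<^sup>2)))"
        by (intro Henstock_Kurzweil_Integration.integral_cong) (simp add: power2_eq_square algebra_simps)
      also have "\<dots> = integral {0..1} (\<lambda>z. 2 * (kernel_weight b z * a))
          + integral {0..1} (\<lambda>z. 2 * N\<^sup>2 * (kernel_weight b z * (a * (f (x + z))\<^sup>2 + (f' (x + z))\<^sup>2)))"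
        by (intro Henstock_Kurzweil_Integration.integral_add integrable_continuous_real continuous_intros cx)
      also have "\<dots> = 2 * c0 + 2 * N\<^sup>2 * E" by (simp add: c0_def E_def)
      finally show ?thesis using le[of N] le[of "-N"] by linarith
    qed
    note le = this
    have "0 \<le> E"
    proof (rule ccontr)
      assume "\<not> 0 \<le> E"
      \<comment> \<open>Chosen so that N^2 E = -(|c0 - m| + 1), which violates m <= c0 + N^2
        E.\<close>
      define N where "N = sqrt ((\<bar>c0 - m\<bar> + 1) / (- E))"
      have "(\<bar>c0 - m\<bar> + 1) / (- E) \<ge> 0" using \<open>\<not> 0 \<le> E\<close> by (intro divide_nonneg_pos) auto
      then have "N\<^sup>2 * E = - (\<bar>c0 - m\<bar> + 1)" using \<open>\<not> 0 \<le> E\<close> by (simp add: N_def)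
      then show False using le[of N] by (simp add: abs_if split: if_splits)
    qed
    then show ?thesis using True by (simp add: E_def)
  qed
qed

section \<open>Characteristics and blow-up\<close>

lemma mean_value_quotient:
  fixes f f' :: "real \<Rightarrow> real"
  assumes "\<And>x. (f has_real_derivative f' x) (at x)" "x \<noteq> y"
  obtains z where "\<bar>z - y\<bar> \<le> \<bar>x - y\<bar>" "(f x - f y) / (x - y) = f' z"
proof (cases "x < y")
  case True
  obtain z where "x < z" "z < y" "f y - f x = (y - x) * f' z"
    using MVT2[OF True, of f f'] assms(1) by blast
  with True show ?thesis by (intro that[of z]) (auto simp: field_simps)
next
  case False
  with assms(2) have "y < x" by simp
  obtain z where "y < z" "z < x" "f x - f y = (x - y) * f' z"
    using MVT2[OF \<open>y < x\<close>, of f f'] assms(1) by blast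
  with \<open>y < x\<close> show ?thesis by (intro that[of z]) (auto simp: field_simps)
qed

lemma periodic_bounded:
  fixes f :: "real \<Rightarrow> real \<Rightarrow> real"
  assumes c: "continuous_on ({0..b} \<times> UNIV) (\<lambda>(t, x). f t x)"
    and per: "\<And>t x. t \<in> {0..b} \<Longrightarrow> f t (x + 1) = f t x"
  obtains M where "M > 0" "\<And>t x. t \<in> {0..b} \<Longrightarrow> \<bar>f t x\<bar> \<le> M"
proof -
  have "compact ((\<lambda>(t, x). f t x) ` ({0..b} \<times> {0..1}))"
    by (intro compact_continuous_image continuous_on_subset[OF c] compact_Times) auto
  then have "bounded ((\<lambda>(t, x). f t x) ` ({0..b} \<times> {0..1}))" by (rule compact_imp_bounded)
  then obtain M where M: "M > 0" "\<And>y. y \<in> (\<lambda>(t, x). f t x) ` ({0..b} \<times> {0..1}) \<Longrightarrow> \<bar>y\<bar> \<le> M"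
    unfolding bounded_pos real_norm_def by blast
  show ?thesis
  proof (rule that[OF M(1)])
    fix t x assume t: "t \<in> {0..b}"
    have "f t (x + of_int (- \<lfloor>x\<rfloor>)) = f t x" by (rule periodic_of_int) (rule per[OF t])
    moreover have "x + of_int (- \<lfloor>x\<rfloor>) \<in> {0..1}"
      using floor_correct[of x] by (auto simp: less_imp_le) linarith
    ultimately show "\<bar>f t x\<bar> \<le> M"
      using M(2)[of "f t x"] t by (metis (no_types, lifting) SigmaI case_prod_conv image_eqI)
  qed
qed

lemma uniform_near_curve:
  fixes f :: "real \<Rightarrow> real \<Rightarrow> real"
  assumes c: "continuous_on ({0..b} \<times> UNIV) (\<lambda>(t, x). f t x)"
    and q: "continuous_on {0..b} q" and e: "e > 0"
  obtains d where "d > 0" "\<And>t z. t \<in> {0..b} \<Longrightarrow> \<bar>z - q t\<bar> < d \<Longrightarrow> \<bar>f t z - f t (q t)\<bar> < e"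
proof -
  have "compact (q ` {0..b})" by (intro compact_continuous_image q) auto
  then have "bounded (q ` {0..b})" by (rule compact_imp_bounded)
  then obtain R where R: "\<And>y. y \<in> q ` {0..b} \<Longrightarrow> \<bar>y\<bar> \<le> R"
    unfolding bounded_pos real_norm_def by blast
  have "uniformly_continuous_on ({0..b} \<times> {-R-1..R+1}) (\<lambda>(t, x). f t x)"
    by (intro compact_uniformly_continuous continuous_on_subset[OF c] compact_Times) auto
  then obtain d where d: "d > 0" "\<And>p p'. p \<in> {0..b} \<times> {-R-1..R+1} \<Longrightarrow> p' \<in> {0..b} \<times> {-R-1..R+1} \<Longrightarrow>
      dist p' p < d \<Longrightarrow> dist ((\<lambda>(t, x). f t x) p') ((\<lambda>(t, x). f t x) p) < e"
    unfolding uniformly_continuous_on_def using e by metis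
  show ?thesis
  proof (rule that[of "min d 1"])
    fix t z assume t: "t \<in> {0..b}" and z: "\<bar>z - q t\<bar> < min d 1"
    have "\<bar>q t\<bar> \<le> R" using R t by auto
    then have "(t, z) \<in> {0..b} \<times> {-R-1..R+1}" "(t, q t) \<in> {0..b} \<times> {-R-1..R+1}"
      using t z by auto
    moreover have "dist (t, z) (t, q t) < d" using z by (simp add: dist_Pair_Pair dist_real_def)
    ultimately show "\<bar>f t z - f t (q t)\<bar> < e" using d(2) by (force simp: dist_real_def)
  qed (use d in auto)
qed

text \<open>What a Sobolev solution provides on a compact part [0, b] of its lifespan, stated with
  suprema only: u and u_x jointly continuous, time difference quotients converging uniformly in x,
  and the equation with the convolution in window form. The argument along characteristics needs no
  function spaces beyond this.\<close>

locale rod_flow =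
  fixes g b :: real and u ux ut :: "real \<Rightarrow> real \<Rightarrow> real"
  assumes b: "0 < b"
    and cont_u: "continuous_on ({0..b} \<times> UNIV) (\<lambda>(t, x). u t x)"
    and cont_ux: "continuous_on ({0..b} \<times> UNIV) (\<lambda>(t, x). ux t x)"
    and du: "\<And>t x. t \<in> {0..b} \<Longrightarrow> (u t has_real_derivative ux t x) (at x)"
    and per_u: "\<And>t x. t \<in> {0..b} \<Longrightarrow> u t (x + 1) = u t x"
    and per_ux: "\<And>t x. t \<in> {0..b} \<Longrightarrow> ux t (x + 1) = ux t x"
    and dt: "\<And>t e. 0 < t \<Longrightarrow> t < b \<Longrightarrow> 0 < e \<Longrightarrow> \<forall>\<^sub>F r in at t. \<forall>x. \<bar>(u r x - u t x) / (r - t) - ut t x\<bar> \<le> e"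
    and cont_ut: "\<And>t. 0 < t \<Longrightarrow> t < b \<Longrightarrow> continuous_on UNIV (ut t)"
    and rod_eq: "\<And>t x. 0 < t \<Longrightarrow> t < b \<Longrightarrow> ut t x + g * u t x * ux t x =
      integral {0..1} (\<lambda>z. slope_weight z * ((3 - g) / 2 * (u t (x + z))\<^sup>2 + g / 2 * (ux t (x + z))\<^sup>2))"
begin

definition w where "w t y = (3 - g) / 2 * (u t y)\<^sup>2 + g / 2 * (ux t y)\<^sup>2"
text \<open>The right side of the equation for u; by \<open>dG\<close> its space derivative is
  \<open>H\<close>.\<close>

definition G where "G t x = integral {0..1} (\<lambda>z. slope_weight z * w t (x + z))"
definition P where "P t x = integral {0..1} (\<lambda>z. kernel_weight 0 z * w t (x + z))"
definition H where "H t x = w t x - P t x"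

lemma continuous_along:
  assumes "continuous_on ({0..b} \<times> UNIV) (\<lambda>(t, x). f t x)" "continuous_on S h" "continuous_on S k" "h ` S \<subseteq> {0..b}"
  shows "continuous_on S (\<lambda>s. f (h s) (k s) :: real)"
  using continuous_on_compose2[OF assms(1), of S "\<lambda>s. (h s, k s)"] assms(2-)
  by (auto intro!: continuous_intros)

lemma continuous_slice:
  assumes "continuous_on ({0..b} \<times> UNIV) (\<lambda>(t, x). f t x)" "t \<in> {0..b}"
  shows "continuous_on S (\<lambda>x. f t x :: real)"
  using continuous_along[OF assms(1), of S "\<lambda>_. t" "\<lambda>x. x"] assms(2)
  by (auto simp: image_subset_iff intro: continuous_on_const continuous_on_id)

lemma cont_w: "continuous_on ({0..b} \<times> UNIV) (\<lambda>(t, x). w t x)"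
  using cont_u cont_ux unfolding w_def split_beta by (intro continuous_intros) (auto simp: split_beta)

lemma per_w: "t \<in> {0..b} \<Longrightarrow> w t (x + 1) = w t x"
  by (simp add: w_def per_u per_ux)

lemma cont_H: "continuous_on ({0..b} \<times> UNIV) (\<lambda>(t, x). H t x)"
proof -
  have "continuous_on (({0..b} \<times> UNIV) \<times> cbox 0 1) (\<lambda>(p, z). kernel_weight 0 z * w (fst p) (snd p + z))"
    unfolding split_beta by (intro continuous_intros continuous_along[OF cont_w]) auto
  from integral_continuous_on_param[OF this]
  have "continuous_on ({0..b} \<times> UNIV) (\<lambda>(t, x). P t x)" by (simp add: P_def split_beta)
  with cont_w show ?thesis unfolding H_def split_beta by (intro continuous_intros) auto
qed

lemma dG: "t \<in> {0..b} \<Longrightarrow> (G t has_real_derivative H t x) (at x)"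
  unfolding G_def[abs_def] H_def P_def
  by (intro slope_integral_derivative continuous_slice[OF cont_w] per_w)

text \<open>The increment is split into a time step at the moving point q r and a space step at the
  fixed time t. Uniformity in x of the time quotients, with continuity of \<open>ut t\<close>,
  handles the moving point.\<close>

lemma derivative_along:
  assumes t: "0 < t" "t < b" and q: "(q has_real_derivative g * u t (q t)) (at t)"
  shows "((\<lambda>t. u t (q t)) has_real_derivative G t (q t)) (at t)"
proof -
  have ct: "q \<midarrow>t\<rightarrow> q t" using DERIV_isCont[OF q] by (simp add: isCont_def)
  have 1: "(\<lambda>r. (u r (q r) - u t (q r)) / (r - t)) \<midarrow>t\<rightarrow> ut t (q t)"
  proof (rule tendstoI)
    fix e :: real assume e: "e > 0"
    have "\<forall>\<^sub>F r in at t. \<forall>x. \<bar>(u r x - u t x) / (r - t) - ut t x\<bar> \<le> e / 2"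
      by (rule dt[OF t]) (use e in simp)
    moreover have "(\<lambda>r. ut t (q r)) \<midarrow>t\<rightarrow> ut t (q t)"
      using cont_ut[OF t] ct by (intro isCont_tendsto_compose[OF _ ct]) (simp add: continuous_on_eq_continuous_at)
    then have "\<forall>\<^sub>F r in at t. dist (ut t (q r)) (ut t (q t)) < e / 2"
      by (rule tendstoD) (use e in simp)
    ultimately show "\<forall>\<^sub>F r in at t. dist ((u r (q r) - u t (q r)) / (r - t)) (ut t (q t)) < e"
    proof eventually_elim
      case (elim r)
      from elim(1) have "\<bar>(u r (q r) - u t (q r)) / (r - t) - ut t (q r)\<bar> \<le> e / 2" by blast
      with elim(2) show ?case unfolding dist_real_def by linarith
    qed
  qed
  have "((\<lambda>r. u t (q r)) has_real_derivative ux t (q t) * (g * u t (q t))) (at t)"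
    using t by (intro DERIV_chain2[OF du q]) auto
  then have 2: "(\<lambda>r. (u t (q r) - u t (q t)) / (r - t)) \<midarrow>t\<rightarrow> ux t (q t) * (g * u t (q t))"
    by (simp add: has_field_derivative_iff)
  have "(\<lambda>r. (u r (q r) - u t (q r)) / (r - t) + (u t (q r) - u t (q t)) / (r - t)) \<midarrow>t\<rightarrow>
     ut t (q t) + ux t (q t) * (g * u t (q t))"
    by (intro tendsto_add 1 2)
  moreover have "ut t (q t) + ux t (q t) * (g * u t (q t)) = G t (q t)"
    using rod_eq[OF t, of "q t"] by (simp add: G_def w_def ac_simps)
  ultimately show ?thesis
    by (simp add: has_field_derivative_iff add_divide_distrib[symmetric])
qed

lemma lipschitz_u:
  assumes M: "\<And>t x. t \<in> {0..b} \<Longrightarrow> \<bar>ux t x\<bar> \<le> M" and t: "t \<in> {0..b}"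
  shows "\<bar>u t x - u t y\<bar> \<le> M * \<bar>x - y\<bar>"
proof (cases "x = y")
  case False
  obtain z where "(u t x - u t y) / (x - y) = ux t z"
    using mean_value_quotient[OF du[OF t] False] by blast
  then have "u t x - u t y = ux t z * (x - y)" using False by (simp add: field_simps)
  then show ?thesis using M[OF t] by (simp add: abs_mult mult_right_mono)
qed simp

lemma characteristic:
  obtains q where "q 0 = x0" "continuous_on {0..b} q"
    "\<And>t. 0 < t \<Longrightarrow> t < b \<Longrightarrow> (q has_real_derivative g * u t (q t)) (at t)"
proof -
  obtain M where M: "M > 0" "\<And>t x. t \<in> {0..b} \<Longrightarrow> \<bar>ux t x\<bar> \<le> M"
    using periodic_bounded[OF cont_ux per_ux] by blast
  obtain N where N: "N > 0" "\<And>t x. t \<in> {0..b} \<Longrightarrow> \<bar>u t x\<bar> \<le> N"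
    using periodic_bounded[OF cont_u per_u] by blast
  obtain q where q: "q 0 = x0" "\<And>t. t \<in> {0..b} \<Longrightarrow> (q has_real_derivative g * u t (q t)) (at t within {0..b})"
  proof (rule ode_exists[of b "\<lambda>t x. g * u t x" "\<bar>g\<bar> * M" "\<bar>g\<bar> * N"])
    show "continuous_on ({0..b} \<times> UNIV) (\<lambda>(t, x). g * u t x)"
      using cont_u unfolding split_beta by (intro continuous_intros)
    show "\<bar>g * u t x - g * u t y\<bar> \<le> \<bar>g\<bar> * M * \<bar>x - y\<bar>" if "t \<in> {0..b}" for t x y
    proof -
      have "\<bar>g\<bar> * \<bar>u t x - u t y\<bar> \<le> \<bar>g\<bar> * (M * \<bar>x - y\<bar>)"
        by (intro mult_left_mono lipschitz_u M that) auto
      then show ?thesis by (simp add: abs_mult right_diff_distrib[symmetric])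
    qed
    show "\<bar>g * u t x\<bar> \<le> \<bar>g\<bar> * N" if "t \<in> {0..b}" for t x
      unfolding abs_mult by (intro mult_left_mono N that) auto
  qed (use b M in auto)
  show ?thesis
  proof (rule that[of q])
    show "continuous_on {0..b} q" using q(2) by (rule DERIV_continuous_on)
    show "(q has_real_derivative g * u t (q t)) (at t)" if "0 < t" "t < b" for t
      using q(2)[of t] that by (simp add: at_within_Icc_at)
  qed (rule q)
qed

text \<open>Gronwall in both directions, for the squared distance since the distance itself need not
  be differentiable. The first bound shows that distinct characteristics never meet, the second that
  nearby ones stay close.\<close>

lemma characteristic_distance:
  assumes M: "\<And>t x. t \<in> {0..b} \<Longrightarrow> \<bar>ux t x\<bar> \<le> M"
    and q: "continuous_on {0..b} q" "\<And>t. 0 < t \<Longrightarrow> t < b \<Longrightarrow> (q has_real_derivative g * u t (q t)) (at t)"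
    and p: "continuous_on {0..b} p" "\<And>t. 0 < t \<Longrightarrow> t < b \<Longrightarrow> (p has_real_derivative g * u t (p t)) (at t)"
    and t: "t \<in> {0..b}"
  defines "K \<equiv> \<bar>g\<bar> * M"
  shows "(p 0 - q 0)\<^sup>2 \<le> (p t - q t)\<^sup>2 * exp (2 * K * t)"
    and "\<bar>p t - q t\<bar> \<le> \<bar>p 0 - q 0\<bar> * exp (K * b)"
proof -
  define L where "L = (\<lambda>t. p t - q t)"
  define L' where "L' = (\<lambda>t. g * (u t (p t) - u t (q t)))"
  have dL: "(L has_real_derivative L' s) (at s)" if "0 < s" "s < b" for s
    unfolding L_def L'_def right_diff_distrib using that by (intro DERIV_diff p q)
  have cL: "continuous_on {0..t} L" unfolding L_def
    using t by (intro continuous_intros continuous_on_subset[OF p(1)] continuous_on_subset[OF q(1)]) auto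
  have LL': "\<bar>L s * L' s\<bar> \<le> K * (L s)\<^sup>2" if "s \<in> {0..b}" for s
  proof -
    have "\<bar>L' s\<bar> \<le> \<bar>g\<bar> * (M * \<bar>L s\<bar>)"
      unfolding L'_def L_def abs_mult by (intro mult_left_mono lipschitz_u M that) auto
    then have "\<bar>L s\<bar> * \<bar>L' s\<bar> \<le> \<bar>L s\<bar> * (\<bar>g\<bar> * (M * \<bar>L s\<bar>))" by (intro mult_left_mono) auto
    also have "\<dots> = K * (\<bar>L s\<bar> * \<bar>L s\<bar>)" by (simp add: K_def)
    finally show ?thesis by (simp add: abs_mult power2_eq_square)
  qed
  have "(L 0)\<^sup>2 * exp (2 * K * 0) \<le> (L t)\<^sup>2 * exp (2 * K * t)"
  proof (rule nonneg_derivative_le[of 0 t "\<lambda>s. (L s)\<^sup>2 * exp (2 * K * s)"])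
    show "continuous_on {0..t} (\<lambda>s. (L s)\<^sup>2 * exp (2 * K * s))" by (intro continuous_intros cL)
    fix s assume "0 < s" "s < t"
    then have s: "0 < s" "s < b" using t by auto
    have "((\<lambda>s. (L s)\<^sup>2 * exp (2 * K * s)) has_real_derivative 2 * (L s * L' s + K * (L s)\<^sup>2) * exp (2 * K * s)) (at s)"
      by (rule derivative_eq_intros dL s refl | simp add: algebra_simps)+
    moreover have "0 \<le> L s * L' s + K * (L s)\<^sup>2" using LL'[of s] s by simp
    then have "0 \<le> 2 * (L s * L' s + K * (L s)\<^sup>2) * exp (2 * K * s)" by simp
    ultimately show "\<exists>d. ((\<lambda>s. (L s)\<^sup>2 * exp (2 * K * s)) has_real_derivative d) (at s) \<and> 0 \<le> d"
      by blast
  qed (use t in auto)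
  then show "(p 0 - q 0)\<^sup>2 \<le> (p t - q t)\<^sup>2 * exp (2 * K * t)" by (simp add: L_def)
  have "- ((L 0)\<^sup>2 * exp (- (2 * K * 0))) \<le> - ((L t)\<^sup>2 * exp (- (2 * K * t)))"
  proof (rule nonneg_derivative_le[of 0 t "\<lambda>s. - ((L s)\<^sup>2 * exp (- (2 * K * s)))"])
    show "continuous_on {0..t} (\<lambda>s. - ((L s)\<^sup>2 * exp (- (2 * K * s))))" by (intro continuous_intros cL)
    fix s assume "0 < s" "s < t"
    then have s: "0 < s" "s < b" using t by auto
    have "((\<lambda>s. - ((L s)\<^sup>2 * exp (- (2 * K * s)))) has_real_derivative 2 * (K * (L s)\<^sup>2 - L s * L' s) * exp (- (2 * K * s))) (at s)"
      by (rule derivative_eq_intros dL s refl | simp add: algebra_simps)+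
    moreover have "0 \<le> K * (L s)\<^sup>2 - L s * L' s" using LL'[of s] s by simp
    then have "0 \<le> 2 * (K * (L s)\<^sup>2 - L s * L' s) * exp (- (2 * K * s))" by simp
    ultimately show "\<exists>d. ((\<lambda>s. - ((L s)\<^sup>2 * exp (- (2 * K * s)))) has_real_derivative d) (at s) \<and> 0 \<le> d"
      by blast
  qed (use t in auto)
  then have "(L t)\<^sup>2 * exp (- (2 * K * t)) \<le> (L 0)\<^sup>2" by simp
  then have "(L t)\<^sup>2 \<le> (L 0)\<^sup>2 * exp (2 * K * t)" by (simp add: exp_minus field_simps)
  also have "\<dots> = (\<bar>L 0\<bar> * exp (K * t))\<^sup>2" by (simp add: power_mult_distrib exp_double[symmetric] ac_simps)
  finally have "\<bar>L t\<bar>\<^sup>2 \<le> (\<bar>L 0\<bar> * exp (K * t))\<^sup>2" by simp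
  then have "\<bar>L t\<bar> \<le> \<bar>L 0\<bar> * exp (K * t)" by (rule power2_le_imp_le) simp
  also have "\<dots> \<le> \<bar>L 0\<bar> * exp (K * b)"
  proof -
    have "0 \<le> M" using M[of 0 0] b by auto
    then show ?thesis using t by (intro mult_left_mono) (auto simp: K_def intro!: mult_left_mono)
  qed
  finally show "\<bar>p t - q t\<bar> \<le> \<bar>p 0 - q 0\<bar> * exp (K * b)" by (simp add: L_def)
qed

end

context rod_flow begin

text \<open>
  Since \<open>u\<close> is only once differentiable in space, the equation for the slope along a
  characteristic is obtained as the limit of difference quotients between two characteristics.
\<close>

lemma slope_along:
  assumes q: "continuous_on {0..b} q" "\<And>t. 0 < t \<Longrightarrow> t < b \<Longrightarrow> (q has_real_derivative g * u t (q t)) (at t)"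
    and t: "0 < t" "t < b"
  shows "((\<lambda>t. ux t (q t)) has_real_derivative H t (q t) - g * (ux t (q t))\<^sup>2) (at t)"
proof -
  obtain M where M: "M > 0" "\<And>t x. t \<in> {0..b} \<Longrightarrow> \<bar>ux t x\<bar> \<le> M"
    using periodic_bounded[OF cont_ux per_ux] by blast
  define K where "K = \<bar>g\<bar> * M"
  define h where "h = (\<lambda>n::nat. 1 / real (Suc n))"
  have "\<exists>p. p 0 = q 0 + h n \<and> continuous_on {0..b} p \<and>
     (\<forall>t. 0 < t \<longrightarrow> t < b \<longrightarrow> (p has_real_derivative g * u t (p t)) (at t))" for n
    using characteristic[of "q 0 + h n"] by metis
  then obtain p where p0: "\<And>n. p n 0 = q 0 + h n" and cp: "\<And>n. continuous_on {0..b} (p n)"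
    and dp: "\<And>n t. 0 < t \<Longrightarrow> t < b \<Longrightarrow> (p n has_real_derivative g * u t (p n t)) (at t)"
    by metis
  have h: "h n > 0" for n by (simp add: h_def)
  have nz: "p n s \<noteq> q s" if "s \<in> {0..b}" for n s
  proof -
    have "0 < (p n 0 - q 0)\<^sup>2" using h[of n] by (simp add: p0)
    also have "\<dots> \<le> (p n s - q s)\<^sup>2 * exp (2 * K * s)"
      unfolding K_def by (rule characteristic_distance(1)[OF M(2) q cp dp that])
    finally show ?thesis by auto
  qed
  have close: "\<bar>p n s - q s\<bar> \<le> h n * exp (K * b)" if "s \<in> {0..b}" for n s
    using characteristic_distance(2)[OF M(2) q cp dp that, of n] h[of n] by (simp add: p0 K_def)
  have small: "\<forall>\<^sub>F n in sequentially. \<forall>s\<in>{0..b}. \<bar>p n s - q s\<bar> < d" if "d > 0" for d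
  proof -
    have "h \<longlonglongrightarrow> 0" unfolding h_def by (rule LIMSEQ_Suc[OF lim_1_over_n])
    then have "(\<lambda>n. h n * exp (K * b)) \<longlonglongrightarrow> 0 * exp (K * b)" by (intro tendsto_intros)
    then have "\<forall>\<^sub>F n in sequentially. h n * exp (K * b) < d"
      using that by (intro order_tendstoD(2)) auto
    then show ?thesis
    proof eventually_elim
      case (elim n)
      then show ?case by (intro ballI le_less_trans[OF close])
    qed
  qed
  define F where "F = (\<lambda>t. ux t (q t))"
  define r where "r = (\<lambda>n t. (u t (p n t) - u t (q t)) / (p n t - q t))"
  \<comment> \<open>By the quotient rule: both characteristics move with velocity g u, so
    differentiating the denominator contributes exactly - g r^2.\<close>
  define r' where "r' = (\<lambda>n t. (G t (p n t) - G t (q t)) / (p n t - q t) - g * (r n t)\<^sup>2)"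
  have F_bound: "\<bar>F s\<bar> \<le> M" if "s \<in> {0..b}" for s unfolding F_def by (rule M(2)[OF that])
  have r_eq: "\<exists>z. \<bar>z - q s\<bar> \<le> \<bar>p n s - q s\<bar> \<and> r n s = ux s z" if "s \<in> {0..b}" for n s
    using mean_value_quotient[OF du[OF that] nz[OF that]] unfolding r_def by metis
  have G_eq: "\<exists>z. \<bar>z - q s\<bar> \<le> \<bar>p n s - q s\<bar> \<and> (G s (p n s) - G s (q s)) / (p n s - q s) = H s z"
    if "s \<in> {0..b}" for n s
    using mean_value_quotient[OF dG[OF that] nz[OF that]] by metis
  have dr: "(r n has_real_derivative r' n s) (at s)" if s: "0 < s" "s < b" for n s
  proof -
    have n: "p n s - q s \<noteq> 0" using nz[of s n] s by simp
    have "((\<lambda>t. u t (p n t) - u t (q t)) has_real_derivative G s (p n s) - G s (q s)) (at s)"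
      by (intro DERIV_diff derivative_along s dp q)
    moreover have "((\<lambda>t. p n t - q t) has_real_derivative g * u s (p n s) - g * u s (q s)) (at s)"
      by (intro DERIV_diff s dp q)
    ultimately have "(r n has_real_derivative
       ((G s (p n s) - G s (q s)) * (p n s - q s) - (u s (p n s) - u s (q s)) * (g * u s (p n s) - g * u s (q s)))
         / ((p n s - q s) * (p n s - q s))) (at s)"
      unfolding r_def by (rule DERIV_divide) (rule n)
    moreover have "((G s (p n s) - G s (q s)) * (p n s - q s) - (u s (p n s) - u s (q s)) * (g * u s (p n s) - g * u s (q s)))
         / ((p n s - q s) * (p n s - q s)) = r' n s"
      using n unfolding r'_def r_def by (simp add: divide_simps power2_eq_square) (simp add: algebra_simps)
    ultimately show ?thesis by simp
  qed
  define D where "D = (\<lambda>s. H s (q s) - g * (F s)\<^sup>2)"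
  have unif: "\<forall>\<^sub>F n in sequentially. \<forall>s\<in>{0<..<b}. \<forall>k. norm (r' n s * k - D s * k) \<le> e * norm k" if e: "e > 0" for e
  proof -
    obtain d1 where d1: "d1 > 0" "\<And>t z. t \<in> {0..b} \<Longrightarrow> \<bar>z - q t\<bar> < d1 \<Longrightarrow> \<bar>H t z - H t (q t)\<bar> < e / 2"
      using uniform_near_curve[OF cont_H q(1), of "e / 2"] e by auto
    \<comment> \<open>Both r and F are bounded by M, so |r^2 - F^2| <= 2 M c; this c keeps g (r^2 -
      F^2) below e / 2, and H takes the other half.\<close>
    define c where "c = e / (4 * M * (\<bar>g\<bar> + 1))"
    have c: "c > 0" using e M(1) by (simp add: c_def add_nonneg_pos)
    obtain d2 where d2: "d2 > 0" "\<And>t z. t \<in> {0..b} \<Longrightarrow> \<bar>z - q t\<bar> < d2 \<Longrightarrow> \<bar>ux t z - ux t (q t)\<bar> < c"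
      using uniform_near_curve[OF cont_ux q(1) c] by auto
    have "\<forall>\<^sub>F n in sequentially. \<forall>s\<in>{0..b}. \<bar>p n s - q s\<bar> < min d1 d2"
      using d1 d2 by (intro small) auto
    then show ?thesis
    proof eventually_elim
      case (elim n)
      show ?case
      proof (intro ballI allI)
        fix s k assume s: "s \<in> {0<..<b}"
        then have s': "s \<in> {0..b}" by auto
        obtain z where z: "\<bar>z - q s\<bar> \<le> \<bar>p n s - q s\<bar>" "r n s = ux s z" using r_eq[OF s'] by metis
        obtain y where y: "\<bar>y - q s\<bar> \<le> \<bar>p n s - q s\<bar>" "(G s (p n s) - G s (q s)) / (p n s - q s) = H s y"
          using G_eq[OF s'] by metis
        have "\<bar>p n s - q s\<bar> < d1" "\<bar>p n s - q s\<bar> < d2" using elim s' by auto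
        then have 1: "\<bar>H s y - H s (q s)\<bar> < e / 2" and 2: "\<bar>r n s - F s\<bar> < c"
          using d1(2)[OF s', of y] d2(2)[OF s', of z] z y unfolding F_def by auto
        have "\<bar>r n s + F s\<bar> \<le> 2 * M" using M(2)[OF s', of z] F_bound[OF s'] z(2) by linarith
        then have "\<bar>r n s - F s\<bar> * \<bar>r n s + F s\<bar> \<le> c * (2 * M)"
          using 2 c by (intro mult_mono) auto
        also have "\<bar>r n s - F s\<bar> * \<bar>r n s + F s\<bar> = \<bar>(r n s)\<^sup>2 - (F s)\<^sup>2\<bar>"
          by (simp add: abs_mult[symmetric] power2_eq_square algebra_simps)
        finally have "\<bar>g\<bar> * \<bar>(r n s)\<^sup>2 - (F s)\<^sup>2\<bar> \<le> (\<bar>g\<bar> + 1) * (c * (2 * M))"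
          by (intro mult_mono) auto
        also have "\<dots> = e / 2"
        proof -
          have "x * (e / (4 * M * x) * (2 * M)) = e / 2" if "x \<noteq> 0" for x
            using that M(1) by (simp add: field_simps)
          moreover have "\<bar>g\<bar> + 1 \<noteq> 0" by linarith
          ultimately show ?thesis unfolding c_def by blast
        qed
        finally have 3: "\<bar>g * (r n s)\<^sup>2 - g * (F s)\<^sup>2\<bar> \<le> e / 2"
          by (simp add: abs_mult right_diff_distrib[symmetric])
        have "\<bar>r' n s - D s\<bar> \<le> e" using 1 3 unfolding r'_def D_def y(2) by linarith
        then have "\<bar>r' n s - D s\<bar> * \<bar>k\<bar> \<le> e * \<bar>k\<bar>" by (rule mult_right_mono) simp
        then show "norm (r' n s * k - D s * k) \<le> e * norm k"
          by (simp add: abs_mult left_diff_distrib[symmetric])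
      qed
    qed
  qed
  have r_lim: "(\<lambda>n. r n s) \<longlonglongrightarrow> F s" if s: "s \<in> {0<..<b}" for s
  proof (rule LIMSEQ_I)
    fix e :: real assume "e > 0"
    have s': "s \<in> {0..b}" using s by auto
    obtain d where d: "d > 0" "\<And>t z. t \<in> {0..b} \<Longrightarrow> \<bar>z - q t\<bar> < d \<Longrightarrow> \<bar>ux t z - ux t (q t)\<bar> < e"
      using uniform_near_curve[OF cont_ux q(1) \<open>e > 0\<close>] by auto
    obtain N where N: "\<And>n. n \<ge> N \<Longrightarrow> \<forall>s\<in>{0..b}. \<bar>p n s - q s\<bar> < d"
      using small[OF d(1)] unfolding eventually_sequentially by blast
    show "\<exists>N. \<forall>n\<ge>N. norm (r n s - F s) < e"
    proof (intro exI allI impI)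
      fix n assume "n \<ge> N"
      obtain z where z: "\<bar>z - q s\<bar> \<le> \<bar>p n s - q s\<bar>" "r n s = ux s z" using r_eq[OF s'] by metis
      have "\<bar>z - q s\<bar> < d" using N[OF \<open>n \<ge> N\<close>] s' z(1) by force
      then show "norm (r n s - F s) < e" unfolding F_def z(2) by (simp add: d(2)[OF s'])
    qed
  qed
  have "\<exists>f. \<forall>s\<in>{0<..<b}. (\<lambda>n. r n s) \<longlonglongrightarrow> f s \<and> (f has_derivative (\<lambda>k. D s * k)) (at s within {0<..<b})"
  \<comment> \<open>Derivatives converging uniformly on (0, b), together with convergence of r at
    the one point t, allow differentiation of the limit, which is F.\<close>
  proof (rule has_derivative_sequence[of "{0<..<b}" r "\<lambda>n s k. r' n s * k" "\<lambda>s k. D s * k" t "F t", OF _ _ unif])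
    fix n s assume "s \<in> {0<..<b}"
    then have "(r n has_real_derivative r' n s) (at s within {0<..<b})"
      using dr[of s n] by (simp add: has_field_derivative_at_within)
    then show "(r n has_derivative (\<lambda>k. r' n s * k)) (at s within {0<..<b})"
      by (simp add: has_field_derivative_def)
  next
    show "(\<lambda>n. r n t) \<longlonglongrightarrow> F t" using t by (intro r_lim) auto
  qed (use t in auto)
  then obtain f where f: "\<And>s. s \<in> {0<..<b} \<Longrightarrow> (\<lambda>n. r n s) \<longlonglongrightarrow> f s"
    "\<And>s. s \<in> {0<..<b} \<Longrightarrow> (f has_real_derivative D s) (at s within {0<..<b})"
    unfolding has_field_derivative_def by blast
  have fF: "f s = F s" if "s \<in> {0<..<b}" for s
    using LIMSEQ_unique[OF f(1)[OF that] r_lim[OF that]] .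
  have "(f has_real_derivative D t) (at t)"
    using f(2)[of t] t by (simp add: at_within_open[of t "{0<..<b}"])
  then have "(F has_real_derivative D t) (at t)"
    by (rule has_field_derivative_transform_within_open[where S = "{0<..<b}"]) (use t fF in auto)
  then show ?thesis by (simp add: F_def[abs_def] D_def)
qed

text \<open>Here c is the sign of g, so one computation serves both signs of gamma. The lower bound
  for I controls the nonlocal terms and leaves the two Riccati factors X - beta U and X + beta
  U.\<close>

lemma time_bound:
  assumes g: "g \<noteq> 0" and c: "\<bar>c\<bar> = 1" "g * c = \<bar>g\<bar>" and "0 \<le> \<beta>"
    and low: "rod_lower ((3 - g) / g) \<beta> ((3 - g) / g - \<beta>\<^sup>2)"
    and init: "\<beta> * \<bar>u 0 x0\<bar> < - c * ux 0 x0"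
  shows "\<bar>g\<bar> * b \<le> 1 / (- c * ux 0 x0 - \<beta> * u 0 x0) + 1 / (- c * ux 0 x0 + \<beta> * u 0 x0)"
proof -
  obtain q where q: "q 0 = x0" "continuous_on {0..b} q"
    "\<And>t. 0 < t \<Longrightarrow> t < b \<Longrightarrow> (q has_real_derivative g * u t (q t)) (at t)"
    using characteristic[of x0] by metis
  define a where "a = (3 - g) / g"
  define U where "U = (\<lambda>t. u t (q t))"
  define X where "X = (\<lambda>t. - c * ux t (q t))"
  define k where "k = \<bar>g\<bar> / 2"
  have cU: "continuous_on {0..b} U" unfolding U_def
    by (rule continuous_along[OF cont_u _ q(2), of "\<lambda>t. t"]) (auto intro: continuous_on_id)
  have cX: "continuous_on {0..b} X" unfolding X_def
    by (intro continuous_intros continuous_along[OF cont_ux _ q(2), of "\<lambda>t. t"]) auto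
  have c2: "c * c = 1" using c(1) by (auto simp: abs_if split: if_splits)
  \<comment> \<open>Both signs of s give the same right side, and X^2 - (beta U)^2 is the product of
    the two factors, as \<open>riccati_blowup\<close> expects.\<close>
  have key: "\<exists>d. ((\<lambda>t. X t + s * U t) has_real_derivative d) (at t) \<and> k * ((X t)\<^sup>2 - (s * U t)\<^sup>2) \<le> d"
    if s: "s = \<beta> \<or> s = - \<beta>" and t: "0 < t" "t < b" for s t
  proof -
    define W where "W = (\<lambda>z. a * (u t (q t + z))\<^sup>2 + (ux t (q t + z))\<^sup>2)"
    have t': "t \<in> {0..b}" using t by auto
    have wW: "w t (q t + z) = g / 2 * W z" for z
      using g by (simp add: w_def W_def a_def field_simps)
    have dX: "(X has_real_derivative - c * (H t (q t) - g * (ux t (q t))\<^sup>2)) (at t)"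
      unfolding X_def by (intro DERIV_cmult slope_along q t)
    have dU: "(U has_real_derivative G t (q t)) (at t)"
      unfolding U_def by (intro derivative_along q t)
    have d: "((\<lambda>t. X t + s * U t) has_real_derivative
        - c * (H t (q t) - g * (ux t (q t))\<^sup>2) + s * G t (q t)) (at t)"
      by (intro DERIV_add DERIV_cmult dX dU)
    have cW: "continuous_on {0..1} W" unfolding W_def
      by (intro continuous_intros continuous_on_compose2[OF continuous_slice[OF cont_u t', of UNIV]]
          continuous_on_compose2[OF continuous_slice[OF cont_ux t', of UNIV]]) auto
    have G: "G t (q t) = g / 2 * integral {0..1} (\<lambda>z. slope_weight z * W z)"
      unfolding G_def wW by (simp add: mult.left_commute[of _ "g / 2"] del: times_divide_eq_left)
    have P: "P t (q t) = g / 2 * integral {0..1} (\<lambda>z. kernel_weight 0 z * W z)"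
      unfolding P_def wW by (simp add: mult.left_commute[of _ "g / 2"] del: times_divide_eq_left)
    have low': "rod_lower a (c * s) (a - \<beta>\<^sup>2)"
    proof -
      have "c * s = \<beta> \<or> c * s = - \<beta>" using s c(1) by (auto simp: abs_if split: if_splits)
      then show ?thesis using low rod_lower_reflect[OF low] by (auto simp: a_def)
    qed
    \<comment> \<open>The test function is the solution seen from the characteristic. Evenness of I
      in b admits the weight c s, which is beta or - beta.\<close>
    have "(a - \<beta>\<^sup>2) * (U t)\<^sup>2 \<le> integral {0..1} (\<lambda>z. kernel_weight (c * s) z * W z)"
      unfolding U_def W_def
      by (rule rod_lower_periodic[OF low' du[OF t'] continuous_slice[OF cont_ux t'] per_u[OF t']])
    also have "\<dots> = integral {0..1} (\<lambda>z. kernel_weight 0 z * W z + c * s * (slope_weight z * W z))"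
      by (subst kernel_weight_split) (simp add: algebra_simps)
    also have "\<dots> = integral {0..1} (\<lambda>z. kernel_weight 0 z * W z) + integral {0..1} (\<lambda>z. c * s * (slope_weight z * W z))"
      by (intro Henstock_Kurzweil_Integration.integral_add integrable_continuous_real continuous_intros cW)
    also have "\<dots> = integral {0..1} (\<lambda>z. kernel_weight 0 z * W z) + c * s * integral {0..1} (\<lambda>z. slope_weight z * W z)"
      by simp
    finally have ineq: "k * ((a - \<beta>\<^sup>2) * (U t)\<^sup>2) \<le> k * (integral {0..1} (\<lambda>z. kernel_weight 0 z * W z)
        + c * s * integral {0..1} (\<lambda>z. slope_weight z * W z))"
      by (intro mult_left_mono) (auto simp: k_def)
    have kc: "k = c * g / 2" using c by (simp add: k_def mult.commute)
    \<comment> \<open>The local part of H contributes - c g/2 (u_x^2 + a U^2), and c g u_x^2 from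
      the transport term reverses the sign of u_x^2. The factor c s appears because c^2 = 1.\<close>
    have ev: "- c * (H t (q t) - g * (ux t (q t))\<^sup>2) + s * G t (q t)
      = c * g / 2 * ((ux t (q t))\<^sup>2 - a * (U t)\<^sup>2) + c * g / 2 * (integral {0..1} (\<lambda>z. kernel_weight 0 z * W z)
        + c * s * integral {0..1} (\<lambda>z. slope_weight z * W z))"
    proof -
      have "w t (q t) = g / 2 * (a * (U t)\<^sup>2 + (ux t (q t))\<^sup>2)"
        using wW[of 0] by (simp add: W_def U_def)
      moreover have "s * G t (q t) = c * g / 2 * (c * s * integral {0..1} (\<lambda>z. slope_weight z * W z))"
        unfolding G using c2 by (simp add: algebra_simps)
      ultimately show ?thesis unfolding H_def P by (simp add: algebra_simps add_divide_distrib)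
    qed
    have xs: "(X t)\<^sup>2 = (ux t (q t))\<^sup>2" "(s * U t)\<^sup>2 = \<beta>\<^sup>2 * (U t)\<^sup>2"
      using c2 s by (auto simp: X_def power_mult_distrib power2_eq_square)
    have "k * ((X t)\<^sup>2 - (s * U t)\<^sup>2) \<le> - c * (H t (q t) - g * (ux t (q t))\<^sup>2) + s * G t (q t)"
      using ineq unfolding xs ev kc[symmetric] by (simp add: algebra_simps)
    with d show ?thesis by blast
  qed
  have "2 * k * b \<le> 1 / (X 0 + (- \<beta>) * U 0) + 1 / (X 0 + \<beta> * U 0)"
  proof (rule riccati_blowup[of b k "\<lambda>t. X t + (- \<beta>) * U t" "\<lambda>t. X t + \<beta> * U t"])
    show "continuous_on {0..b} (\<lambda>t. X t + (- \<beta>) * U t)" "continuous_on {0..b} (\<lambda>t. X t + \<beta> * U t)"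
      by (intro continuous_intros cX cU)+
    have eq: "(X t + (- \<beta>) * U t) * (X t + \<beta> * U t) = (X t)\<^sup>2 - (\<beta> * U t)\<^sup>2" for t
      by (simp add: power2_eq_square algebra_simps)
    show "\<exists>d. ((\<lambda>t. X t + (- \<beta>) * U t) has_real_derivative d) (at t) \<and>
        k * ((X t + (- \<beta>) * U t) * (X t + \<beta> * U t)) \<le> d" if "0 < t" "t < b" for t
      using key[of "-\<beta>" t] that unfolding eq by simp
    show "\<exists>d. ((\<lambda>t. X t + \<beta> * U t) has_real_derivative d) (at t) \<and>
        k * ((X t + (- \<beta>) * U t) * (X t + \<beta> * U t)) \<le> d" if "0 < t" "t < b" for t
      using key[of \<beta> t] that unfolding eq by simp
    have "\<bar>\<beta> * u 0 x0\<bar> < - c * ux 0 x0" using init \<open>0 \<le> \<beta>\<close> by (simp add: abs_mult)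
    then show "0 < X 0 + (- \<beta>) * U 0" "0 < X 0 + \<beta> * U 0"
      by (simp_all add: X_def U_def q(1) abs_less_iff)
  qed (use b in \<open>auto simp: k_def\<close>)
  then show ?thesis by (simp add: k_def X_def U_def q(1))
qed

end

section \<open>From Sobolev solutions to the flow and its lifespan\<close>

lemma jointly_continuous:
  fixes f :: "real \<Rightarrow> real \<Rightarrow> real"
  assumes c: "\<And>t. t \<in> J \<Longrightarrow> continuous_on UNIV (f t)"
    and u: "\<And>t e. t \<in> J \<Longrightarrow> e > 0 \<Longrightarrow> \<forall>\<^sub>F r in at t within J. \<forall>x. \<bar>f r x - f t x\<bar> < e"
  shows "continuous_on (J \<times> UNIV) (\<lambda>(t, x). f t x)"
  unfolding continuous_on_iff
proof (intro ballI allI impI, clarify)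
  fix t x and e :: real assume t: "t \<in> J" and e: "e > 0"
  obtain d1 where d1: "d1 > 0" "\<And>r. r \<in> J \<Longrightarrow> r \<noteq> t \<Longrightarrow> dist r t < d1 \<Longrightarrow> \<forall>x. \<bar>f r x - f t x\<bar> < e / 2"
    using u[OF t, of "e / 2"] e unfolding eventually_at by auto
  have d1': "\<bar>f r y - f t y\<bar> < e / 2" if "r \<in> J" "dist r t < d1" for r y
    using d1(2)[OF that(1) _ that(2)] e by (cases "r = t") auto
  obtain d2 where d2: "d2 > 0" "\<And>y. dist y x < d2 \<Longrightarrow> dist (f t y) (f t x) < e / 2"
    using c[OF t] e unfolding continuous_on_iff by (metis UNIV_I half_gt_zero)
  show "\<exists>d>0. \<forall>p\<in>J \<times> UNIV. dist p (t, x) < d \<longrightarrow> dist (case p of (t, x) \<Rightarrow> f t x) (f t x) < e"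
  proof (intro exI[of _ "min d1 d2"] conjI ballI impI)
    fix p assume p: "p \<in> J \<times> (UNIV :: real set)" "dist p (t, x) < min d1 d2"
    obtain r y where ry: "p = (r, y)" by (cases p)
    have "dist r t < d1" "dist y x < d2"
      using p(2) dist_fst_le[of p "(t, x)"] dist_snd_le[of p "(t, x)"] by (auto simp: ry)
    then have "\<bar>f r y - f t y\<bar> < e / 2" "\<bar>f t y - f t x\<bar> < e / 2"
      using d1'[of r y] d2(2)[of y] p(1) by (auto simp: ry dist_real_def)
    then show "dist (case p of (t, x) \<Rightarrow> f t x) (f t x) < e"
      unfolding ry dist_real_def prod.case by linarith
  qed (use d1 d2 in auto)
qed

text \<open>Convergence in H^s implies uniform convergence of u and u_x as s > 3/2, and the sup norm
  is bounded by the H^(s-1) norm as s - 1 > 1/2. So every hypothesis of the flow follows from the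
  norm estimates on [0, b].\<close>

lemma rod_solution_flow:
  assumes sol: "rod_solution s g u0 T u" and s: "3/2 < s" and b: "0 < b" "ereal b < T"
  obtains ut where "rod_flow g b u (\<lambda>t. deriv (u t)) ut"
proof -
  define J where "J = {t. 0 \<le> t \<and> ereal t < T}"
  have sub: "{0..b} \<subseteq> J"
    unfolding J_def using b(2) by (auto intro: le_less_trans[of _ "ereal b"])
  obtain v where cu: "sobolev_continuous_on s J u" and cv: "sobolev_continuous_on (s - 1) J v"
    and dv: "sobolev_has_derivative_on (s - 1) J u v"
    and eq: "\<And>t x. 0 < t \<Longrightarrow> ereal t < T \<Longrightarrow> v t x + g * u t x * deriv (u t) x =
       - circle_convolution (deriv rod_kernel) (\<lambda>y. (3 - g) / 2 * (u t y)\<^sup>2 + g / 2 * (deriv (u t) y)\<^sup>2) x"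
    using sol unfolding rod_solution_def Let_def J_def by blast
  have s': "1/2 < s" "1/2 < s - 1" using s by auto
  have uS: "u t \<in> sobolev_circle s" and vS: "v t \<in> sobolev_circle (s - 1)" if "t \<in> J" for t
    using cu cv that unfolding sobolev_continuous_on_def by auto
  have near: "\<forall>\<^sub>F r in at t within {0..b}. C * sobolev_norm s (\<lambda>x. u r x - u t x) < e"
    if "t \<in> {0..b}" "e > 0" for t e C
  proof -
    have "((\<lambda>r. sobolev_norm s (\<lambda>x. u r x - u t x)) \<longlongrightarrow> 0) (at t within J)"
      using cu sub that(1) unfolding sobolev_continuous_on_def by blast
    then have "((\<lambda>r. C * sobolev_norm s (\<lambda>x. u r x - u t x)) \<longlongrightarrow> C * 0) (at t within {0..b})"
      by (intro tendsto_mult_left tendsto_within_subset[OF _ sub])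
    then show ?thesis using that(2) by (intro order_tendstoD(2)) auto
  qed
  have "rod_flow g b u (\<lambda>t. deriv (u t)) v"
  proof
    show "0 < b" by (rule b)
    show "continuous_on ({0..b} \<times> UNIV) (\<lambda>(t, x). u t x)"
    proof (rule jointly_continuous)
      fix t assume t: "t \<in> {0..b}"
      then show "continuous_on UNIV (u t)" using sub by (intro sobolev_circleD(1)[OF uS]) auto
      fix e :: real assume e: "e > 0"
      have "\<forall>\<^sub>F r in at t within {0..b}. r \<in> {0..b}" by (simp add: eventually_at_filter)
      with near[OF t e, of "sobolev_const s"]
      show "\<forall>\<^sub>F r in at t within {0..b}. \<forall>x. \<bar>u r x - u t x\<bar> < e"
      proof eventually_elim
        case (elim r)
        have "(\<lambda>x. u r x - u t x) \<in> sobolev_circle s" using elim t sub by (intro sobolev_circle_diff uS) auto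
        from sobolev_sup_bound[OF s'(1) this] elim show ?case by (auto intro: le_less_trans)
      qed
    qed
    show "continuous_on ({0..b} \<times> UNIV) (\<lambda>(t, x). deriv (u t) x)"
    proof (rule jointly_continuous)
      fix t assume t: "t \<in> {0..b}"
      then show "continuous_on UNIV (deriv (u t))" using sub by (intro sobolev_deriv(2)[OF s uS]) auto
      fix e :: real assume e: "e > 0"
      have "\<forall>\<^sub>F r in at t within {0..b}. r \<in> {0..b}" by (simp add: eventually_at_filter)
      with near[OF t e, of "sobolev_const (s - 1)"]
      show "\<forall>\<^sub>F r in at t within {0..b}. \<forall>x. \<bar>deriv (u r) x - deriv (u t) x\<bar> < e"
      proof eventually_elim
        case (elim r)
        have rt: "r \<in> J" "t \<in> J" using elim t sub by auto
        have m: "(\<lambda>x. u r x - u t x) \<in> sobolev_circle s" by (intro sobolev_circle_diff uS rt)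
        have "deriv (\<lambda>x. u r x - u t x) x = deriv (u r) x - deriv (u t) x" for x
          by (intro DERIV_imp_deriv DERIV_diff sobolev_deriv(1)[OF s uS] rt)
        with sobolev_deriv(3)[OF s m] elim show ?case by (auto intro: le_less_trans)
      qed
    qed
  next
    fix t x assume t: "t \<in> {0..b}"
    then have "u t \<in> sobolev_circle s" using sub by (intro uS) auto
    then show "(u t has_real_derivative deriv (u t) x) (at x)" "u t (x + 1) = u t x"
      "deriv (u t) (x + 1) = deriv (u t) x"
      by (auto intro: sobolev_deriv[OF s] sobolev_circleD(2))
  next
    fix t assume t: "0 < t" "t < b"
    then have tJ: "t \<in> J" using sub by auto
    then show "continuous_on UNIV (v t)" by (intro sobolev_circleD(1)[OF vS])
    fix e :: real assume e: "e > 0"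
    have nb: "\<forall>\<^sub>F r in nhds t. r \<in> {0<..<b}" using t by (intro eventually_nhds_in_open) auto
    \<comment> \<open>At an interior time the limit within the lifespan is the two-sided
      one.\<close>
    have at: "at t within J = at t"
      using t sub by (intro at_within_nhd[of t "{0<..<b}"]) auto
    have "((\<lambda>r. sobolev_norm (s - 1) (\<lambda>x. (u r x - u t x) / (r - t) - v t x)) \<longlongrightarrow> 0) (at t)"
      using dv tJ unfolding sobolev_has_derivative_on_def at[symmetric] by blast
    then have "((\<lambda>r. sobolev_const (s - 1) * sobolev_norm (s - 1) (\<lambda>x. (u r x - u t x) / (r - t) - v t x)) \<longlongrightarrow> sobolev_const (s - 1) * 0) (at t)"
      by (intro tendsto_mult_left)
    then have "\<forall>\<^sub>F r in at t. sobolev_const (s - 1) * sobolev_norm (s - 1) (\<lambda>x. (u r x - u t x) / (r - t) - v t x) < e"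
      using e by (intro order_tendstoD(2)) auto
    moreover have "\<forall>\<^sub>F r in at t. r \<in> {0<..<b}" using nb by (simp add: eventually_at_filter eventually_mono)
    ultimately show "\<forall>\<^sub>F r in at t. \<forall>x. \<bar>(u r x - u t x) / (r - t) - v t x\<bar> \<le> e"
    proof eventually_elim
      case (elim r)
      then have "r \<in> J" using sub by auto
      then have "(\<lambda>x. u r x - u t x) \<in> sobolev_circle (s - 1)"
        using tJ by (intro sobolev_circle_diff sobolev_circle_mono[OF _ uS]) auto
      from sobolev_circle_linear[OF this vS[OF tJ], of "1 / (r - t)" "-1"]
      have "(\<lambda>x. (u r x - u t x) / (r - t) - v t x) \<in> sobolev_circle (s - 1)" by simp
      from sobolev_sup_bound[OF s'(2) this] elim show ?case by (auto intro: order.trans less_imp_le)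
    qed
    fix x
    have us: "u t \<in> sobolev_circle s" by (rule uS[OF tJ])
    have "v t x + g * u t x * deriv (u t) x =
       - circle_convolution (deriv rod_kernel) (\<lambda>y. (3 - g) / 2 * (u t y)\<^sup>2 + g / 2 * (deriv (u t) y)\<^sup>2) x"
      using t tJ by (intro eq) (auto simp: J_def)
    also have "\<dots> = integral {0..1} (\<lambda>z. slope_weight z * ((3 - g) / 2 * (u t (x + z))\<^sup>2 + g / 2 * (deriv (u t) (x + z))\<^sup>2))"
      by (subst circle_convolution_deriv_rod_kernel)
        (auto intro!: continuous_intros sobolev_circleD(1)[OF us] sobolev_deriv(2)[OF s us]
          simp: sobolev_circleD(2)[OF us] sobolev_deriv(4)[OF s us])
    finally show "v t x + g * u t x * deriv (u t) x =
      integral {0..1} (\<lambda>z. slope_weight z * ((3 - g) / 2 * (u t (x + z))\<^sup>2 + g / 2 * (deriv (u t) (x + z))\<^sup>2))" .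
  qed
  then show ?thesis by (rule that)
qed

text \<open>A solution lives on the half-open interval [0, T), so the flow is available for b < T
  only; letting b tend to T bounds T, and in particular rules out infinite T.\<close>

lemma rod_maximal_time_le:
  assumes s: "3/2 < s" and g: "g \<noteq> 0" and c: "\<bar>c\<bar> = 1" "g * c = \<bar>g\<bar>" and B: "0 \<le> B"
    and low: "rod_lower ((3 - g) / g) B ((3 - g) / g - B\<^sup>2)"
    and init: "B * \<bar>u0 x0\<bar> < - c * deriv u0 x0"
  shows "rod_maximal_time s g u0 \<le>
    ereal ((1 / (- c * deriv u0 x0 - B * u0 x0) + 1 / (- c * deriv u0 x0 + B * u0 x0)) / \<bar>g\<bar>)" (is "_ \<le> ereal (?C / _)")
  unfolding rod_maximal_time_def
proof (rule Sup_least, clarify)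
  fix T u assume T: "0 < T" and sol: "rod_solution s g u0 T u"
  have u0: "u 0 = u0" using sol by (simp add: rod_solution_def Let_def)
  show "T \<le> ereal (?C / \<bar>g\<bar>)"
  proof (rule dense_le_bounded[OF T])
    fix y assume y: "0 < y" "y < T"
    then obtain b where yb: "y = ereal b" by (cases y) auto
    obtain ut where "rod_flow g b u (\<lambda>t. deriv (u t)) ut"
      using rod_solution_flow[OF sol s, of b] y by (auto simp: yb)
    then interpret rod_flow g b u "\<lambda>t. deriv (u t)" ut .
    have "\<bar>g\<bar> * b \<le> ?C" unfolding u0[symmetric]
      by (rule time_bound[OF g c B low]) (use init u0 in simp)
    then have "b \<le> ?C / \<bar>g\<bar>" using g by (simp add: pos_le_divide_eq mult.commute)
    then show "y \<le> ereal (?C / \<bar>g\<bar>)" by (simp add: yb)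
  qed
qed

text \<open>B is fixed along the filter, so C depends on the initial datum, x0, c and B but not on
  gamma. The bound C / |gamma| for T* therefore yields finiteness and the O estimate
  together.\<close>

lemma rod_blowup:
  fixes F :: "real filter"
  assumes s: "3/2 < s" and lim: "filterlim (\<lambda>g. (3 - g) / g) (nhds (-1)) F"
    and c: "\<bar>c\<bar> = 1" "\<forall>\<^sub>F g in F. g \<noteq> 0 \<and> g * c = \<bar>g\<bar>" and B: "0 \<le> B"
    and low: "\<forall>\<^sub>F a in nhds (-1). rod_lower a B (a - B\<^sup>2)"
    and init: "B * \<bar>u0 x0\<bar> < - c * deriv u0 x0"
  shows "(\<forall>\<^sub>F g in F. rod_maximal_time s g u0 < \<infinity>) \<and>
    (\<lambda>g. real_of_ereal (rod_maximal_time s g u0)) \<in> O[F](\<lambda>g. 1 / \<bar>g\<bar>)"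
proof -
  define C where "C = 1 / (- c * deriv u0 x0 - B * u0 x0) + 1 / (- c * deriv u0 x0 + B * u0 x0)"
  have "\<forall>\<^sub>F g in F. rod_lower ((3 - g) / g) B ((3 - g) / g - B\<^sup>2)"
    using filterlim_iff[THEN iffD1, OF lim] low by blast
  with c(2) have ev: "\<forall>\<^sub>F g in F. rod_maximal_time s g u0 \<le> ereal (C / \<bar>g\<bar>) \<and> 0 \<le> C / \<bar>g\<bar>"
  proof eventually_elim
    case (elim g)
    have "\<bar>B * u0 x0\<bar> < - c * deriv u0 x0" using init B by (simp add: abs_mult)
    then have "0 \<le> - c * deriv u0 x0 - B * u0 x0" "0 \<le> - c * deriv u0 x0 + B * u0 x0" by linarith+
    from this[THEN divide_nonneg_nonneg[OF zero_le_one]] have "0 \<le> C" unfolding C_def by linarith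
    with elim rod_maximal_time_le[OF s _ c(1) _ B _ init, of g] show ?case by (simp add: C_def)
  qed
  have pos: "0 \<le> real_of_ereal (rod_maximal_time s g u0)" for g
  proof (cases "{T. 0 < T \<and> (\<exists>u. rod_solution s g u0 T u)} = {}")
    case True
    \<comment> \<open>The supremum of the empty set is -infinity, which \<open>real_of_ereal\<close>
      sends to 0.\<close>
    show ?thesis unfolding rod_maximal_time_def True by (simp add: bot_ereal_def)
  next
    case False
    then obtain T where "0 < T" "T \<in> {T. 0 < T \<and> (\<exists>u. rod_solution s g u0 T u)}" by blast
    then have "0 \<le> rod_maximal_time s g u0"
      unfolding rod_maximal_time_def by (meson Sup_upper less_imp_le order.trans)
    then show ?thesis by (rule real_of_ereal_pos)
  qed
  show ?thesis
  proof
    show "\<forall>\<^sub>F g in F. rod_maximal_time s g u0 < \<infinity>"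
      using ev by eventually_elim auto
    show "(\<lambda>g. real_of_ereal (rod_maximal_time s g u0)) \<in> O[F](\<lambda>g. 1 / \<bar>g\<bar>)"
    proof (rule bigoI[of _ "\<bar>C\<bar>"])
      show "\<forall>\<^sub>F g in F. norm (real_of_ereal (rod_maximal_time s g u0)) \<le> \<bar>C\<bar> * norm (1 / \<bar>g\<bar>)"
        using ev
      proof eventually_elim
        case (elim g)
        then have "real_of_ereal (rod_maximal_time s g u0) \<le> C / \<bar>g\<bar>"
          by (cases "rod_maximal_time s g u0") auto
        also have "\<dots> \<le> \<bar>C\<bar> / \<bar>g\<bar>" by (intro divide_right_mono) auto
        finally show ?case unfolding real_norm_def abs_of_nonneg[OF pos] by simp
      qed
    qed
  qed
qed

section \<open>The limits gamma -> +infinity and gamma -> -infinity\<close>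

lemma ratio_limit:
  assumes "filterlim (\<lambda>g::real. g) at_infinity F"
  shows "filterlim (\<lambda>g::real. (3 - g) / g) (nhds (-1)) F"
proof -
  have "((\<lambda>g. 3 / g - 1) \<longlongrightarrow> 0 - 1) F"
    by (intro tendsto_diff tendsto_const tendsto_divide_0[OF tendsto_const assms])
  moreover have "\<forall>\<^sub>F g in F. 3 / g - 1 = (3 - g) / g"
    using filterlim_at_infinity_imp_eventually_ne[OF assms, of 0]
    by eventually_elim (simp add: diff_divide_distrib)
  ultimately show ?thesis by (simp add: filterlim_cong)
qed

theorem corollary1p1:
  shows "\<exists>\<beta>_inf::real.
    (rod_beta \<longlongrightarrow> ereal \<beta>_inf) at_top \<and>
    (rod_beta \<longlongrightarrow> ereal \<beta>_inf) at_bot \<and>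
    \<bar>\<beta>_inf - 295 / 1000\<bar> < 1 / 1000 \<and>
    (\<forall>(s::real) (u0::real \<Rightarrow> real). 3 / 2 < s \<and> u0 \<in> sobolev_circle s \<longrightarrow>
      ((\<exists>x0. deriv u0 x0 > \<beta>_inf * \<bar>u0 x0\<bar>) \<longrightarrow>
         (\<forall>\<^sub>F \<gamma> in at_bot. rod_maximal_time s \<gamma> u0 < \<infinity>) \<and>
         (\<lambda>\<gamma>. real_of_ereal (rod_maximal_time s \<gamma> u0)) \<in> O[at_bot](\<lambda>\<gamma>. 1 / \<bar>\<gamma>\<bar>)) \<and>
      ((\<exists>x0. deriv u0 x0 < - \<beta>_inf * \<bar>u0 x0\<bar>) \<longrightarrow>
         (\<forall>\<^sub>F \<gamma> in at_top. rod_maximal_time s \<gamma> u0 < \<infinity>) \<and>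
         (\<lambda>\<gamma>. real_of_ereal (rod_maximal_time s \<gamma> u0)) \<in> O[at_top](\<lambda>\<gamma>. 1 / \<bar>\<gamma>\<bar>)))"
proof -
  obtain B :: real where B: "\<bar>B - 295/1000\<bar> < 1/1000"
    and lim: "\<And>F. filterlim (\<lambda>g. (3 - g) / g) (nhds (-1)) F \<Longrightarrow> (rod_beta \<longlongrightarrow> ereal B) F"
    and near: "\<And>c. B < c \<Longrightarrow> \<exists>b. B < b \<and> b < c \<and> b \<le> 3/10 \<and> (\<forall>\<^sub>F a in nhds (-1). rod_lower a b (a - b\<^sup>2))"
    by (rule rod_beta_limit) blast
  have top: "filterlim (\<lambda>g::real. (3 - g) / g) (nhds (-1)) at_top"
    and bot: "filterlim (\<lambda>g::real. (3 - g) / g) (nhds (-1)) at_bot"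
    by (rule ratio_limit[OF filterlim_at_top_imp_at_infinity[OF filterlim_ident]],
        rule ratio_limit[OF filterlim_at_bot_imp_at_infinity[OF filterlim_ident]])
  \<comment> \<open>The condition on the initial datum is strict, so it survives replacing B by a
    slightly larger b that is admissible for all a near -1. For y = 0 any larger number
    does.\<close>
  have choose: "\<exists>b. 0 \<le> b \<and> b * y < d \<and> (\<forall>\<^sub>F a in nhds (-1). rod_lower a b (a - b\<^sup>2))"
    if "B * y < d" "0 \<le> y" for y d
  proof -
    have "\<exists>c>B. c * y < d"
    proof (cases "y = 0")
      case True
      with that show ?thesis by (intro exI[of _ "B + 1"]) auto
    next
      case False
      with that have "B < d / y" by (simp add: field_simps)
      then obtain c where "B < c" "c < d / y" using dense by blast
      with False that show ?thesis by (intro exI[of _ c]) (simp add: field_simps)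
    qed
    then obtain c where c: "B < c" "c * y < d" by blast
    obtain b where b: "B < b" "b < c" "\<forall>\<^sub>F a in nhds (-1). rod_lower a b (a - b\<^sup>2)"
      using near[OF c(1)] by blast
    have "b * y \<le> c * y" using b that by (intro mult_right_mono) auto
    moreover have "0 \<le> b" using B b(1) by linarith
    ultimately show ?thesis using b c by (intro exI[of _ b]) auto
  qed
  show ?thesis
  proof (intro exI[of _ B] conjI allI impI; (elim conjE exE)?)
    show "(rod_beta \<longlongrightarrow> ereal B) at_top" "(rod_beta \<longlongrightarrow> ereal B) at_bot"
      by (intro lim top bot)+
    show "\<bar>B - 295/1000\<bar> < 1/1000" by (rule B)
  next
    fix s :: real and u0 x0 assume s: "3/2 < s" and i: "B * \<bar>u0 x0\<bar> < deriv u0 x0"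
    obtain b where b: "0 \<le> b" "b * \<bar>u0 x0\<bar> < deriv u0 x0" "\<forall>\<^sub>F a in nhds (-1). rod_lower a b (a - b\<^sup>2)"
      using choose[OF i] by auto
    have "(\<forall>\<^sub>F g in at_bot. rod_maximal_time s g u0 < \<infinity>) \<and>
      (\<lambda>g. real_of_ereal (rod_maximal_time s g u0)) \<in> O[at_bot](\<lambda>g. 1 / \<bar>g\<bar>)"
    proof (rule rod_blowup[OF s bot, of "-1" b u0 x0])
      show "\<forall>\<^sub>F g :: real in at_bot. g \<noteq> 0 \<and> g * - 1 = \<bar>g\<bar>"
        unfolding eventually_at_bot_linorder by (intro exI[of _ "-1"]) auto
    qed (use b in auto)
    then show "\<forall>\<^sub>F g in at_bot. rod_maximal_time s g u0 < \<infinity>"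
      "(\<lambda>g. real_of_ereal (rod_maximal_time s g u0)) \<in> O[at_bot](\<lambda>g. 1 / \<bar>g\<bar>)" by auto
  next
    fix s :: real and u0 x0 assume s: "3/2 < s" and i: "deriv u0 x0 < - B * \<bar>u0 x0\<bar>"
    then have "B * \<bar>u0 x0\<bar> < - deriv u0 x0" by simp
    then obtain b where b: "0 \<le> b" "b * \<bar>u0 x0\<bar> < - deriv u0 x0" "\<forall>\<^sub>F a in nhds (-1). rod_lower a b (a - b\<^sup>2)"
      using choose[of "\<bar>u0 x0\<bar>"] by auto
    have "(\<forall>\<^sub>F g in at_top. rod_maximal_time s g u0 < \<infinity>) \<and>
      (\<lambda>g. real_of_ereal (rod_maximal_time s g u0)) \<in> O[at_top](\<lambda>g. 1 / \<bar>g\<bar>)"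
    proof (rule rod_blowup[OF s top, of 1 b u0 x0])
      show "\<forall>\<^sub>F g :: real in at_top. g \<noteq> 0 \<and> g * 1 = \<bar>g\<bar>"
        unfolding eventually_at_top_linorder by (intro exI[of _ 1]) auto
    qed (use b in auto)
    then show "\<forall>\<^sub>F g in at_top. rod_maximal_time s g u0 < \<infinity>"
      "(\<lambda>g. real_of_ereal (rod_maximal_time s g u0)) \<in> O[at_top](\<lambda>g. 1 / \<bar>g\<bar>)" by auto
  qed
qed

end
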